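(* Let $k\in\{0,1,2,\dots\}$, let $\beta_2>\beta_1>0$ and let $s$ satisfy $\frac{1}{4k+3}\le s\le\frac{4k+2}{4k+3}$. Then $$\beta_1^{s}\,TW_{\beta_1,k}\ \succeq\ \beta_2^{s}\,TW_{\beta_2,k}.$$
   Context: Let $W$ be a standard Brownian motion on $[0,\infty)$. Let $L^*$ be the space of continuous functions $f:[0,\infty)\to\mathbb{R}$ with $f(0)=0$ and $\int_0^\infty\big[(f')^2(x)+x^{\frac{1}{2k+1}}f^2(x)\big]dx<\infty$. For $\beta>0$ and $k\in\{0,1,2,\dots\}$, the $k$-th higher order Tracy–Widom random variable is $$TW_{\beta,k}:=\sup_{f\in L^*,\ \|f\|_{L^2}=1}\left\{\frac{2}{\sqrt\beta}\int_0^\infty f^2(x)\,x^{-\frac{k}{2k+1}}\,dW_x-\int_0^\infty\big[(f')^2(x)+x^{\frac{1}{2k+1}}f^2(x)\big]dx\right\},$$ which is almost surely well defined and equals minus the ground state eigenvalue of the stochastic operator $S_{\beta,k}=-\frac{d^2}{dx^2}+x^{\frac{1}{2k+1}}+\frac{2}{\sqrt\beta}x^{-\frac{k}{2k+1}}W'(x)$ on $(0,\infty)$ with Dirichlet condition at $0$ (for $k=0$ this is the Tracy–Widom$_\beta$ law). For real random variables $X,Y$, $X\succeq Y$ means $\mathbb{P}(X>t)\ge\mathbb{P}(Y>t)$ for all $t\in\mathbb{R}$. *)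

theory Defs
  imports "HOL-Probability.Probability"
begin

definition brownian_motion :: "'a measure \<Rightarrow> ('a \<Rightarrow> real \<Rightarrow> real) \<Rightarrow> bool" where
  "brownian_motion M W \<longleftrightarrow>
     prob_space M \<and>
     (\<forall>t\<ge>0. (\<lambda>\<omega>. W \<omega> t) \<in> borel_measurable M) \<and>
     (\<forall>\<omega>\<in>space M. W \<omega> 0 = 0 \<and> continuous_on {0..} (W \<omega>)) \<and>
     (\<forall>s t. 0 \<le> s \<and> s < t \<longrightarrow>
        distributed M lborel (\<lambda>\<omega>. W \<omega> t - W \<omega> s)
          (\<lambda>x. ennreal (normal_density 0 (sqrt (t - s)) x))) \<and>
     (\<forall>(n::nat) (ts::nat \<Rightarrow> real). 0 \<le> ts 0 \<and> (\<forall>i<n. ts i < ts (Suc i)) \<longrightarrow>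
        prob_space.indep_vars M (\<lambda>_. borel) (\<lambda>i \<omega>. W \<omega> (ts (Suc i)) - W \<omega> (ts i)) {..<n})"

definition in_Lstar :: "nat \<Rightarrow> (real \<Rightarrow> real) \<Rightarrow> (real \<Rightarrow> real) \<Rightarrow> bool" where
  "in_Lstar k f f' \<longleftrightarrow>
     continuous_on {0..} f \<and> f 0 = 0 \<and>
     (\<forall>x\<ge>0. set_integrable lborel {0..x} f' \<and> f x = (LBINT y=0..x. f' y)) \<and>
     set_integrable lborel {0<..} (\<lambda>x. (f' x)\<^sup>2 + x powr (1 / (2 * real k + 1)) * (f x)\<^sup>2)"

text \<open>Pathwise integral of f^2 x^(-k/(2k+1)) against the path w, on [0,T] by integration
  by parts (Riemann--Stieltjes), then T \<rightarrow> infinity.\<close>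
definition wint :: "nat \<Rightarrow> (real \<Rightarrow> real) \<Rightarrow> (real \<Rightarrow> real) \<Rightarrow> (real \<Rightarrow> real) \<Rightarrow> real" where
  "wint k w f f' =
     (let a = real k / (2 * real k + 1) in
      Lim at_top (\<lambda>T. (f T)\<^sup>2 * T powr (-a) * w T
        - (LBINT x=0..T. w x * (2 * f x * f' x * x powr (-a) - a * (f x)\<^sup>2 * x powr (-a - 1)))))"

definition TW :: "real \<Rightarrow> nat \<Rightarrow> ('a \<Rightarrow> real \<Rightarrow> real) \<Rightarrow> 'a \<Rightarrow> real" where
  "TW \<beta> k W \<omega> =
     Sup {2 / sqrt \<beta> * wint k (W \<omega>) f f'
            - (LBINT x:{0<..}. (f' x)\<^sup>2 + x powr (1 / (2 * real k + 1)) * (f x)\<^sup>2)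
          | f f'. in_Lstar k f f' \<and> set_integrable lborel {0<..} (\<lambda>x. (f x)\<^sup>2)
                  \<and> (LBINT x:{0<..}. (f x)\<^sup>2) = 1}"

end

theory Submission
  imports Defs
begin

text \<open>
  Rescaling space by \<open>\<lambda>\<close>, i.e. replacing \<open>f(x)\<close> by \<open>\<surd>\<lambda> f(\<lambda>x)\<close> and the path \<open>w(x)\<close> by
  \<open>w(\<lambda>x) / \<surd>\<lambda>\<close>, keeps the \<open>L\<^sup>2\<close> norm and the law of Brownian motion, and multiplies the
  noise term and the two energies by different powers of \<open>\<lambda>\<close>. Choosing \<open>\<lambda>\<close> as a power of
  \<open>\<beta>2 / \<beta>1\<close> that equates the noise terms, both energy coefficients of \<open>\<beta>1\<close> are at most those of
  \<open>\<beta>2\<close> precisely for \<open>s\<close> in the given interval, so the two variational problems compare path by path.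

  Two points need work. The comparison of suprema uses that they are finite, which follows from
  a bound on the oscillation of Brownian paths: writing the path as its moving average plus a
  remainder, the noise term is dominated by a small multiple of the energy plus a multiple of the norm.
  And the probability space is not complete, so the supremum has to be measurable on
  \<^emph>\<open>all\<close> continuous paths, including those on which the integrals diverge and \<open>Lim\<close> or \<open>Sup\<close>
  take junk values. Functionals that are lower semicontinuous for locally uniform convergence are
  measurable; divergence is brought into this form by a gliding hump argument.
\<close>

section \<open>Primitives of locally integrable functions\<close>

text \<open>The comparison is a coupling: the \<beta>2 variable at \<open>w\<close> is set against
  the \<beta>1 variable at the rescaled path, and only equality in law leads back to
  \<open>w\<close>. Laws determine probabilities of measurable sets of paths only, while
  \<open>TW\<close> is a supremum over uncountably many test functions, each value itself a
  \<open>Lim\<close>; this is the obstacle that shapes the middle of the proof. The kinetic energy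
  scales by \<open>c^2\<close> and the potential energy by \<open>c powr (- pot_exp k)\<close>, so a
  large \<open>c\<close> hurts the first and a small \<open>c\<close> the second: at s =
  (4k+2)/(4k+3) the first coefficient ties, at s = 1/(4k+3) the second. The critical oscillation of
  a path is sqrt x, because \<open>x powr (- noise_exp k) * sqrt x\<close> is exactly the square
  root of the potential; oscillations of size \<open>e * sqrt x\<close> therefore cost a share of
  the energy that vanishes with \<open>e\<close>. Members of the form domain are merely absolutely
  continuous, so everything is phrased for pairs \<open>f\<close>, \<open>f'\<close> tied by an
  integral, and the product rule comes from Fubini instead of pointwise derivatives.\<close>

abbreviation cpath :: "(real \<Rightarrow> real) \<Rightarrow> bool" where
  "cpath w \<equiv> continuous_on {0..} w"

lemma integrable_dominated:
  fixes f g :: "real \<Rightarrow> real"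
  assumes "integrable lborel g" "f \<in> borel_measurable lborel" "\<And>x. \<bar>f x\<bar> \<le> g x"
  shows "integrable lborel f"
  by (rule Bochner_Integration.integrable_bound[OF assms(1,2)])
     (auto intro!: AE_I2 order_trans[OF assms(3) abs_ge_self])

text \<open>Absolute continuity on the half line, carried as a pair because the derivative is
  determined only almost everywhere. The initial value stays free, so that cut-offs, smoothed paths
  and constants belong to the class.\<close>

definition primitive :: "(real \<Rightarrow> real) \<Rightarrow> (real \<Rightarrow> real) \<Rightarrow> bool" where
  "primitive F F' \<longleftrightarrow>
     (\<forall>x\<ge>0. set_integrable lborel {0..x} F' \<and> F x = F 0 + (LBINT y:{0..x}. F' y))"

lemma primitiveD:
  assumes "primitive F F'" "x \<ge> 0"
  shows "set_integrable lborel {0..x} F'" "F x = F 0 + (LBINT y:{0..x}. F' y)"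
  using assms unfolding primitive_def by blast+

lemma primitive_increment:
  assumes F: "primitive F F'" and xy: "0 \<le> x" "x \<le> y"
  shows "F y - F x = (LBINT t:{x..y}. F' t)"
proof -
  have i: "set_integrable lborel {0..y} F'" using primitiveD(1)[OF F] xy by auto
  have "(LBINT t:{0..x} \<union> {x..y}. F' t) = (LBINT t:{0..x}. F' t) + (LBINT t:{x..y}. F' t)"
  proof (rule set_integral_Un_AE)
    show "AE t in lborel. \<not> (t \<in> {0..x} \<and> t \<in> {x..y})"
      using AE_lborel_singleton[of x] by eventually_elim auto
  qed (use xy in \<open>auto intro!: set_integrable_subset[OF i]\<close>)
  moreover have "{0..x} \<union> {x..y} = {0..y}" using xy by auto
  ultimately show ?thesis
    using primitiveD(2)[OF F, of x] primitiveD(2)[OF F, of y] xy by simp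
qed

lemma primitive_continuous_on:
  assumes F: "primitive F F'"
  shows "continuous_on {0..} F"
proof (rule continuous_on_eq_continuous_within[THEN iffD2], rule ballI)
  fix x :: real assume x: "x \<in> {0..}"
  then have i: "set_integrable lborel {0..x+1} F'" by (intro primitiveD(1)[OF F]) auto
  have "continuous_on {0..x+1} (\<lambda>t. F 0 + integral {0..t} F')"
    by (intro continuous_intros indefinite_integral_continuous_1 set_borel_integral_eq_integral i)
  moreover have "F 0 + integral {0..t} F' = F t" if "t \<in> {0..x+1}" for t
    using primitiveD[OF F, of t] set_borel_integral_eq_integral(2)[of "{0..t}" F'] that by auto
  ultimately have "continuous_on {0..x+1} F" by (rule continuous_on_eq)
  then have "continuous (at x within {0..x+1}) F"
    using x by (auto simp: continuous_on_eq_continuous_within)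
  moreover have "at x within {0..x+1} = at x within {0..}"
    by (rule at_within_nhd[of x "{..<x+1}"]) auto
  ultimately show "continuous (at x within {0..}) F" by simp
qed

lemma primitive_derivI:
  assumes d: "\<And>x. x \<ge> 0 \<Longrightarrow> (F has_real_derivative F' x) (at x within {0..})"
    and c: "continuous_on {0..} F'"
  shows "primitive F F'"
  unfolding primitive_def
proof (intro allI impI conjI)
  fix x :: real assume x: "x \<ge> 0"
  have c': "continuous_on {0..x} F'" by (rule continuous_on_subset[OF c]) auto
  then show "set_integrable lborel {0..x} F'" by (rule borel_integrable_atLeastAtMost')
  have "(LBINT y. indicator {0..x} y *\<^sub>R F' y) = F x - F 0"
  proof (rule integral_FTC_atLeastAtMost[OF x _ c'])
    fix t assume "0 \<le> t" "t \<le> x"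
    with d[of t] have "(F has_real_derivative F' t) (at t within {0..x})"
      by (auto intro: DERIV_subset)
    then show "(F has_vector_derivative F' t) (at t within {0..x})"
      by (simp add: has_real_derivative_iff_has_vector_derivative)
  qed
  then show "F x = F 0 + (LBINT y:{0..x}. F' y)" by (simp add: set_lebesgue_integral_def)
qed

lemma set_integrable_mult_continuous:
  fixes f g :: "real \<Rightarrow> real"
  assumes f: "set_integrable lborel {0..x} f" and g: "continuous_on {0..x} g"
  shows "set_integrable lborel {0..x} (\<lambda>t. g t * f t)"
proof -
  have "bounded (g ` {0..x})"
    by (intro compact_imp_bounded compact_continuous_image g) auto
  then obtain B where B: "\<And>t. t \<in> {0..x} \<Longrightarrow> \<bar>g t\<bar> \<le> B"
    unfolding bounded_iff by (metis imageI real_norm_def)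
  have gm: "(\<lambda>t. indicator {0..x} t * g t) \<in> borel_measurable lborel"
    using set_measurable_continuous_on[OF _ g]
    by (simp add: set_borel_measurable_def)
  have fm: "(\<lambda>t. indicator {0..x} t * f t) \<in> borel_measurable lborel"
    using f by (auto simp: set_integrable_def)
  have "integrable lborel (\<lambda>t. (indicator {0..x} t * g t) * (indicator {0..x} t * f t))"
  proof (rule Bochner_Integration.integrable_bound)
    show "integrable lborel (\<lambda>t. B * (indicator {0..x} t * f t))"
      using f by (auto simp: set_integrable_def)
    show "(\<lambda>t. (indicator {0..x} t * g t) * (indicator {0..x} t * f t)) \<in> borel_measurable lborel"
      using gm fm by (rule borel_measurable_times)
    show "AE t in lborel. norm ((indicator {0..x} t * g t) * (indicator {0..x} t * f t))
        \<le> norm (B * (indicator {0..x} t * f t))"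
    proof (rule AE_I2)
      fix t
      show "norm ((indicator {0..x} t * g t) * (indicator {0..x} t * f t))
        \<le> norm (B * (indicator {0..x} t * f t))"
        using B[of t] by (auto simp: indicator_def abs_mult intro!: mult_right_mono)
    qed
  qed
  then show ?thesis
    unfolding set_integrable_def
    by (rule Bochner_Integration.integrable_cong[THEN iffD1, rotated 2]) (auto simp: indicator_def)
qed

text \<open>Fubini on the square [0, T] x [0, T], cut along the diagonal into two triangles. This is
  integration by parts for densities that are merely integrable.\<close>

lemma integral_triangle_swap:
  fixes f g :: "real \<Rightarrow> real"
  assumes f: "set_integrable lborel {0..T} f" and g: "set_integrable lborel {0..T} g"
  shows "(LBINT x:{0..T}. f x) * (LBINT x:{0..T}. g x) =
     (LBINT x:{0..T}. (LBINT y:{0..x}. f y) * g x) + (LBINT x:{0..T}. f x * (LBINT y:{0..x}. g y))"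
proof -
  define f1 where "f1 = (\<lambda>x. indicator {0..T} x * f x)"
  define g1 where "g1 = (\<lambda>x. indicator {0..T} x * g x)"
  have fi: "integrable lborel f1" and gi: "integrable lborel g1"
    using f g by (auto simp: f1_def g1_def set_integrable_def)
  have [measurable]: "f1 \<in> borel_measurable borel" "g1 \<in> borel_measurable borel"
    using fi gi by auto
  have hi: "integrable (lborel \<Otimes>\<^sub>M lborel) (\<lambda>(x, y). f1 y * g1 x)"
  proof (rule lborel_pair.Fubini_integrable)
    show "(\<lambda>(x, y). f1 y * g1 x) \<in> borel_measurable (lborel \<Otimes>\<^sub>M lborel)" by measurable
    show "integrable lborel (\<lambda>x. \<integral> y. norm (case (x, y) of (x, y) \<Rightarrow> f1 y * g1 x) \<partial>lborel)"
      using fi gi by (simp add: abs_mult)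
  qed (use fi in auto)
  have h1: "integrable (lborel \<Otimes>\<^sub>M lborel) (\<lambda>(x, y). if y \<le> x then f1 y * g1 x else 0)"
    by (rule Bochner_Integration.integrable_bound[OF hi]) (auto simp: split_beta)
  have h2: "integrable (lborel \<Otimes>\<^sub>M lborel) (\<lambda>(x, y). if y \<le> x then 0 else f1 y * g1 x)"
    by (rule Bochner_Integration.integrable_bound[OF hi]) (auto simp: split_beta)
  have e1: "(LBINT x. LBINT y. if y \<le> x then f1 y * g1 x else 0)
      = (LBINT x:{0..T}. (LBINT y:{0..x}. f y) * g x)"
    unfolding set_lebesgue_integral_def
  proof (intro Bochner_Integration.integral_cong refl)
    fix x :: real
    have "(LBINT y. if y \<le> x then f1 y * g1 x else 0) = (LBINT y. indicator {0..T} x * (indicator {0..x} y * f y) * g x)"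
      by (intro Bochner_Integration.integral_cong refl) (auto simp: f1_def g1_def indicator_def)
    also have "\<dots> = indicator {0..T} x *\<^sub>R ((LBINT y. indicator {0..x} y *\<^sub>R f y) * g x)"
      by simp
    finally show "(LBINT y. if y \<le> x then f1 y * g1 x else 0)
      = indicator {0..T} x *\<^sub>R ((LBINT y. indicator {0..x} y *\<^sub>R f y) * g x)" .
  qed
  have "(LBINT x. LBINT y. if y \<le> x then 0 else f1 y * g1 x)
      = (LBINT y. LBINT x. if y \<le> x then 0 else f1 y * g1 x)"
    using lborel_pair.Fubini_integral[OF h2] by simp
  also have "\<dots> = (LBINT x:{0..T}. f x * (LBINT y:{0..x}. g y))"
    unfolding set_lebesgue_integral_def
  proof (intro Bochner_Integration.integral_cong refl)
    fix y :: real
    have "(LBINT x. if y \<le> x then 0 else f1 y * g1 x)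
        = (LBINT x. indicator {0..T} y * f y * (indicator {0..y} x * g x))"
    proof (rule integral_cong_AE)
      have "(\<lambda>x. indicator {0..T} y * f y * (indicator {0..y} x * g x)) = 
        (\<lambda>x. f1 y * (indicator {0..y} x * g1 x))"
        by (auto simp: f1_def g1_def indicator_def)
      then show "(\<lambda>x. indicator {0..T} y * f y * (indicator {0..y} x * g x)) \<in> borel_measurable lborel"
        by simp
      \<comment> \<open>The strict and the closed triangle differ in each slice by the single
        diagonal point x = y.\<close>
      show "AE x in lborel. (if y \<le> x then 0 else f1 y * g1 x)
         = indicator {0..T} y * f y * (indicator {0..y} x * g x)"
        using AE_lborel_singleton[of y]
        by eventually_elim (auto simp: f1_def g1_def indicator_def)
    qed measurable
    also have "\<dots> = indicator {0..T} y *\<^sub>R (f y * (LBINT x. indicator {0..y} x *\<^sub>R g x))"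
      by (simp add: mult.assoc)
    finally show "(LBINT x. if y \<le> x then 0 else f1 y * g1 x)
      = indicator {0..T} y *\<^sub>R (f y * (LBINT x. indicator {0..y} x *\<^sub>R g x))" .
  qed
  finally have e2: "(LBINT x. LBINT y. if y \<le> x then 0 else f1 y * g1 x)
      = (LBINT x:{0..T}. f x * (LBINT y:{0..x}. g y))" .
  have "(LBINT x:{0..T}. f x) * (LBINT x:{0..T}. g x) = (LBINT x. LBINT y. f1 y * g1 x)"
    by (simp add: f1_def g1_def set_lebesgue_integral_def)
  also have "\<dots> = integral\<^sup>L (lborel \<Otimes>\<^sub>M lborel) (\<lambda>(x, y). f1 y * g1 x)"
    using lborel_pair.integral_fst'[OF hi] by simp
  also have "\<dots> = integral\<^sup>L (lborel \<Otimes>\<^sub>M lborel) (\<lambda>p. (case p of (x, y) \<Rightarrow> if y \<le> x then f1 y * g1 x else 0)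
      + (case p of (x, y) \<Rightarrow> if y \<le> x then 0 else f1 y * g1 x))"
    by (intro Bochner_Integration.integral_cong) auto
  also have "\<dots> = integral\<^sup>L (lborel \<Otimes>\<^sub>M lborel) (\<lambda>(x, y). if y \<le> x then f1 y * g1 x else 0)
      + integral\<^sup>L (lborel \<Otimes>\<^sub>M lborel) (\<lambda>(x, y). if y \<le> x then 0 else f1 y * g1 x)"
    by (rule Bochner_Integration.integral_add[OF h1 h2])
  also have "\<dots> = (LBINT x. LBINT y. if y \<le> x then f1 y * g1 x else 0)
     + (LBINT x. LBINT y. if y \<le> x then 0 else f1 y * g1 x)"
    using lborel_pair.integral_fst'[OF h1] lborel_pair.integral_fst'[OF h2] by simp
  finally show ?thesis using e1 e2 by simp
qed

text \<open>With \<open>F'\<close> and \<open>G'\<close> as densities, the inner integrals of the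
  triangle identity are the increments \<open>F t - F 0\<close> and \<open>G t - G 0\<close>; the
  initial values are then removed by linearity.\<close>

lemma primitive_mult:
  assumes F: "primitive F F'" and G: "primitive G G'"
  shows "primitive (\<lambda>x. F x * G x) (\<lambda>x. F' x * G x + F x * G' x)"
  unfolding primitive_def
proof (intro allI impI conjI)
  fix x :: real assume x: "x \<ge> 0"
  have cF: "continuous_on {0..x} F" and cG: "continuous_on {0..x} G"
    by (rule continuous_on_subset[OF primitive_continuous_on[OF F]], simp,
        rule continuous_on_subset[OF primitive_continuous_on[OF G]], simp)
  note iF = primitiveD(1)[OF F x] and iG = primitiveD(1)[OF G x]
  have i1: "set_integrable lborel {0..x} (\<lambda>t. F' t * G t)"
    using set_integrable_mult_continuous[OF iF cG] by (simp add: mult.commute)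
  have i2: "set_integrable lborel {0..x} (\<lambda>t. F t * G' t)"
    using set_integrable_mult_continuous[OF iG cF] .
  show "set_integrable lborel {0..x} (\<lambda>x. F' x * G x + F x * G' x)"
    using i1 i2 by (rule set_integral_add)
  have "(LBINT t:{0..x}. F' t) * (LBINT t:{0..x}. G' t)
     = (LBINT t:{0..x}. (F t - F 0) * G' t) + (LBINT t:{0..x}. F' t * (G t - G 0))"
    unfolding integral_triangle_swap[OF iF iG]
  proof (intro arg_cong2[where f="(+)"] set_lebesgue_integral_cong allI impI)
    fix t assume "t \<in> {0..x}"
    then have "F t - F 0 = (LBINT y:{0..t}. F' y)" "G t - G 0 = (LBINT y:{0..t}. G' y)"
      using primitive_increment[OF F, of 0 t] primitive_increment[OF G, of 0 t] by auto
    then show "(LBINT y:{0..t}. F' y) * G' t = (F t - F 0) * G' t"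
      "F' t * (LBINT y:{0..t}. G' y) = F' t * (G t - G 0)"
      by auto
  qed auto
  also have "\<dots> = (LBINT t:{0..x}. F t * G' t - F 0 * G' t) + (LBINT t:{0..x}. F' t * G t - F' t * G 0)"
    by (simp add: algebra_simps)
  also have "\<dots> = (LBINT t:{0..x}. F t * G' t) - F 0 * (LBINT t:{0..x}. G' t)
      + ((LBINT t:{0..x}. F' t * G t) - (LBINT t:{0..x}. F' t) * G 0)"
    using i1 i2 iF iG by (simp add: set_integral_diff)
  finally have "(LBINT t:{0..x}. F' t * G t) + (LBINT t:{0..x}. F t * G' t) =
    (LBINT t:{0..x}. F' t) * (LBINT t:{0..x}. G' t) + F 0 * (LBINT t:{0..x}. G' t) + (LBINT t:{0..x}. F' t) * G 0"
    by simp
  then show "F x * G x = F 0 * G 0 + (LBINT t:{0..x}. F' t * G t + F t * G' t)"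
    using set_integral_add(2)[OF i1 i2] primitiveD(2)[OF F x] primitiveD(2)[OF G x]
    by (simp add: algebra_simps)
qed

lemma primitive_add:
  assumes F: "primitive F F'" and G: "primitive G G'"
  shows "primitive (\<lambda>x. F x + G x) (\<lambda>x. F' x + G' x)"
  unfolding primitive_def
proof (intro allI impI conjI)
  fix x :: real assume x: "x \<ge> 0"
  show "set_integrable lborel {0..x} (\<lambda>x. F' x + G' x)"
    by (intro set_integral_add primitiveD(1)[OF F x] primitiveD(1)[OF G x])
  show "F x + G x = F 0 + G 0 + (LBINT y:{0..x}. F' y + G' y)"
    using set_integral_add(2)[OF primitiveD(1)[OF F x] primitiveD(1)[OF G x]]
      primitive_increment[OF F order.refl x] primitive_increment[OF G order.refl x]
    by simp
qed

lemma primitive_cmult: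
  assumes F: "primitive F F'"
  shows "primitive (\<lambda>x. c * F x) (\<lambda>x. c * F' x)"
  unfolding primitive_def
proof (intro allI impI conjI)
  fix x :: real assume x: "x \<ge> 0"
  show "set_integrable lborel {0..x} (\<lambda>x. c * F' x)"
    using primitiveD(1)[OF F x] by simp
  show "c * F x = c * F 0 + (LBINT y:{0..x}. c * F' y)"
    using primitive_increment[OF F order.refl x] by (simp add: algebra_simps)
qed

lemma primitive_const: "primitive (\<lambda>x. c) (\<lambda>x. 0)"
  by (rule primitive_derivI) auto

section \<open>The form domain\<close>

definition noise_exp :: "nat \<Rightarrow> real" where "noise_exp k = real k / (2 * real k + 1)"
definition pot_exp :: "nat \<Rightarrow> real" where "pot_exp k = 1 / (2 * real k + 1)"

text \<open>The last identity balances noise against potential: the square of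
  \<open>x powr (- noise_exp k) * sqrt x\<close> is \<open>x powr pot_exp k\<close>. The bound 1/2
  keeps \<open>2 * noise_exp k\<close> and \<open>noise_exp k + 1\<close> below 1 and 3/2, the
  exponents of the estimates that are uniform in \<open>k\<close>.\<close>

lemma noise_exp_nonneg: "0 \<le> noise_exp k" and noise_exp_less: "noise_exp k < 1 / 2" and pot_exp_pos: "0 < pot_exp k"
  and pot_exp_le: "pot_exp k \<le> 1" and pot_exp_noise_exp: "pot_exp k = 1 - 2 * noise_exp k"
  by (auto simp: noise_exp_def pot_exp_def field_simps)

definition edens :: "nat \<Rightarrow> (real \<Rightarrow> real) \<Rightarrow> (real \<Rightarrow> real) \<Rightarrow> real \<Rightarrow> real" where
  "edens k f f' x = (f' x)\<^sup>2 + x powr pot_exp k * (f x)\<^sup>2"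

definition energy :: "nat \<Rightarrow> (real \<Rightarrow> real) \<Rightarrow> (real \<Rightarrow> real) \<Rightarrow> real" where
  "energy k f f' = (LBINT x. edens k f f' x)"

definition sqnorm :: "(real \<Rightarrow> real) \<Rightarrow> real" where
  "sqnorm f = (LBINT x. (f x)\<^sup>2)"

definition weight :: "nat \<Rightarrow> (real \<Rightarrow> real) \<Rightarrow> real \<Rightarrow> real" where
  "weight k f x = (f x)\<^sup>2 * x powr (- noise_exp k)"

definition weight_deriv :: "nat \<Rightarrow> (real \<Rightarrow> real) \<Rightarrow> (real \<Rightarrow> real) \<Rightarrow> real \<Rightarrow> real" where
  "weight_deriv k f f' x = 2 * f x * f' x * x powr (- noise_exp k) - noise_exp k * (f x)\<^sup>2 * x powr (- noise_exp k - 1)"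

text \<open>The integral of \<open>u\<close> against \<open>dw\<close> over [0, T] after integration
  by parts, for \<open>u 0 = 0\<close>. It makes sense for every continuous \<open>w\<close>, of
  bounded variation or not.\<close>

definition stieltjes :: "(real \<Rightarrow> real) \<Rightarrow> (real \<Rightarrow> real) \<Rightarrow> (real \<Rightarrow> real) \<Rightarrow> real \<Rightarrow> real" where
  "stieltjes u u' w T = u T * w T - (LBINT x:{0..T}. w x * u' x)"

text \<open>Members of the form domain, normalised to vanish on the negative half line so that
  integrals over the half line become integrals over the whole line.\<close>
definition admissible :: "nat \<Rightarrow> (real \<Rightarrow> real) \<Rightarrow> (real \<Rightarrow> real) \<Rightarrow> bool" where
  "admissible k f f' \<longleftrightarrow>
     f \<in> borel_measurable borel \<and> f' \<in> borel_measurable borel \<and>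
     (\<forall>x\<le>0. f x = 0 \<and> f' x = 0) \<and> primitive f f' \<and> integrable lborel (edens k f f')"

lemma powr_minus_le_add:
  fixes x :: real
  assumes "0 < x" "0 \<le> c" "c \<le> d"
  shows "x powr (- c) \<le> 1 + x powr (- d)"
proof (cases "x \<ge> 1")
  case True
  have "x powr (- c) \<le> x powr 0" using assms True by (intro powr_mono) auto
  also have "\<dots> \<le> 1 + x powr (- d)" using assms by simp
  finally show ?thesis .
next
  case False
  have "x powr (- c) \<le> x powr (- d)" using assms False by (intro powr_mono') auto
  then show ?thesis by simp
qed

lemma integrable_inverse_sqrt:
  fixes T :: real
  assumes "T \<ge> 0"
  shows "integrable lborel (\<lambda>x. indicator {0..T} x * x powr (- (1/2)))"
    and "(LBINT x. indicator {0..T} x * x powr (- (1/2))) = 2 * sqrt T"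
proof -
  have "((\<lambda>x. x powr (- (1/2))) has_integral (T powr (- (1/2) + 1) / (- (1/2) + 1))) {0..T}"
    by (rule has_integral_powr_from_0) (use assms in auto)
  then have "((\<lambda>x. x powr (- (1/2))) has_integral (2 * sqrt T)) {0..T}"
    using assms by (simp add: powr_half_sqrt field_simps)
  then have "((\<lambda>x. if x \<in> {0..T} then x powr (- (1/2)) else 0) has_integral (2 * sqrt T)) UNIV"
    by (simp only: has_integral_restrict_UNIV)
  moreover have "(\<lambda>x. if x \<in> {0..T} then x powr (- (1/2)) else 0) = (\<lambda>x. indicator {0..T} x * x powr (- (1/2)))"
    by (auto simp: indicator_def)
  ultimately have hi: "((\<lambda>x. indicator {0..T} x * x powr (- (1/2))) has_integral (2 * sqrt T)) UNIV"
    by simp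
  have nn: "integral\<^sup>N lborel (\<lambda>x. indicator {0..T} x * x powr (- (1/2))) = 2 * sqrt T"
    by (rule nn_integral_has_integral_lborel[OF _ _ hi]) auto
  have "has_bochner_integral lborel (\<lambda>x. indicator {0..T} x * x powr (- (1/2))) (2 * sqrt T)"
    by (rule has_bochner_integral_nn_integral) (use nn assms in auto)
  then show "integrable lborel (\<lambda>x. indicator {0..T} x * x powr (- (1/2)))"
    and "(LBINT x. indicator {0..T} x * x powr (- (1/2))) = 2 * sqrt T"
    by (auto dest: has_bochner_integral_integral_eq integrable.intros)
qed

lemma integrable_indicator_Icc: "integrable lborel (\<lambda>x. indicator {a..b::real} x * (c::real))"
  by (intro integrable_mult_left integrable_real_indicator) (auto simp: emeasure_lborel_Icc_eq)

text \<open>Cauchy-Schwarz for \<open>f x\<close> as the integral of \<open>f'\<close>. The linear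
  vanishing of the square at the origin is what compensates the singular weights.\<close>

lemma primitive_square_le:
  assumes f: "primitive f f'" "f 0 = 0" and x: "x \<ge> 0"
    and i: "integrable lborel (\<lambda>t. (f' t)\<^sup>2)"
  shows "(f x)\<^sup>2 \<le> x * (LBINT t. (f' t)\<^sup>2)"
proof (cases "x = 0")
  case True then show ?thesis using f by simp
next
  case False
  with x have x0: "x > 0" by simp
  \<comment> \<open>\<open>c\<close> is the mean of \<open>f'\<close> over [0, x]; expanding the
    integral of (f' - c)^2, which is nonnegative, yields the inequality.\<close>
  define c where "c = f x / x"
  note i1 = primitiveD(1)[OF f(1) x]
  have fx: "f x = (LBINT t:{0..x}. f' t)" using primitiveD(2)[OF f(1) x] f(2) by simp
  have i2: "set_integrable lborel {0..x} (\<lambda>t. (f' t)\<^sup>2)"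
    using integrable_mult_indicator[OF _ i, of "{0..x}"] by (simp add: set_integrable_def)
  have i3: "set_integrable lborel {0..x} (\<lambda>t. c\<^sup>2)"
    using integrable_indicator_Icc[of 0 x "c\<^sup>2"] by (simp add: set_integrable_def)
  have "0 \<le> (LBINT t:{0..x}. (f' t - c)\<^sup>2)"
    unfolding set_lebesgue_integral_def by (intro integral_nonneg_AE) auto
  also have "\<dots> = (LBINT t:{0..x}. ((f' t)\<^sup>2 + c\<^sup>2) - (2 * c) * f' t)"
    by (intro set_lebesgue_integral_cong) (auto simp: power2_eq_square algebra_simps)
  also have "\<dots> = (LBINT t:{0..x}. (f' t)\<^sup>2) + (LBINT t:{0..x}. c\<^sup>2) - 2 * c * f x"
    using i1 i2 i3 by (simp add: set_integral_diff set_integral_add fx)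
  also have "(LBINT t:{0..x}. c\<^sup>2) = x * c\<^sup>2"
    using x by (simp add: set_lebesgue_integral_def)
  finally have "2 * c * f x - x * c\<^sup>2 \<le> (LBINT t:{0..x}. (f' t)\<^sup>2)" by simp
  also have "2 * c * f x - x * c\<^sup>2 = (f x)\<^sup>2 / x"
    using x0 by (simp add: c_def power2_eq_square field_simps)
  also have "(LBINT t:{0..x}. (f' t)\<^sup>2) \<le> (LBINT t. (f' t)\<^sup>2)"
    unfolding set_lebesgue_integral_def
    using i2 i by (intro integral_mono) (auto simp: set_integrable_def indicator_def)
  finally show ?thesis using x0 by (simp add: field_simps)
qed

lemma admissibleD:
  assumes "admissible k f f'"
  shows "f \<in> borel_measurable borel" "f' \<in> borel_measurable borel"
    "\<And>x. x \<le> 0 \<Longrightarrow> f x = 0" "\<And>x. x \<le> 0 \<Longrightarrow> f' x = 0"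
    "primitive f f'" "integrable lborel (edens k f f')"
  using assms unfolding admissible_def by blast+

lemma edens_nonneg: "0 \<le> edens k f f' x"
  by (simp add: edens_def)

lemma energy_nonneg: "0 \<le> energy k f f'"
  unfolding energy_def by (intro integral_nonneg_AE) (simp add: edens_nonneg)

lemma sqnorm_nonneg: "0 \<le> sqnorm f"
  unfolding sqnorm_def by (intro integral_nonneg_AE) simp

lemma admissible_integrable_deriv_sq:
  assumes "admissible k f f'"
  shows "integrable lborel (\<lambda>x. (f' x)\<^sup>2)"
proof (rule Bochner_Integration.integrable_bound[OF admissibleD(6)[OF assms]])
  note [measurable] = admissibleD(1,2)[OF assms]
  show "(\<lambda>x. (f' x)\<^sup>2) \<in> borel_measurable lborel" by measurable
qed (simp add: edens_def)

lemma admissible_integrable_potential: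
  assumes "admissible k f f'"
  shows "integrable lborel (\<lambda>x. x powr pot_exp k * (f x)\<^sup>2)"
proof (rule Bochner_Integration.integrable_bound[OF admissibleD(6)[OF assms]])
  note [measurable] = admissibleD(1,2)[OF assms]
  show "(\<lambda>x. x powr pot_exp k * (f x)\<^sup>2) \<in> borel_measurable lborel" by measurable
qed (simp add: edens_def)

lemma energy_split:
  assumes "admissible k f f'"
  shows "energy k f f' = (LBINT x. (f' x)\<^sup>2) + (LBINT x. x powr pot_exp k * (f x)\<^sup>2)"
  unfolding energy_def edens_def
  by (intro Bochner_Integration.integral_add admissible_integrable_deriv_sq[OF assms]
      admissible_integrable_potential[OF assms])

lemma admissible_square_le:
  assumes "admissible k f f'" "x \<ge> 0"
  shows "(f x)\<^sup>2 \<le> x * (LBINT t. (f' t)\<^sup>2)"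
  using admissibleD[OF assms(1)] assms(2) admissible_integrable_deriv_sq[OF assms(1)]
  by (intro primitive_square_le) auto

text \<open>Finite energy already forces square integrability: on [0, 1] the square is at most
  \<open>x\<close> times the kinetic energy, and beyond 1 the potential is at least 1.\<close>

lemma admissible_integrable_square:
  assumes f: "admissible k f f'"
  shows "integrable lborel (\<lambda>x. (f x)\<^sup>2)"
proof (rule integrable_dominated)
  let ?A = "LBINT t. (f' t)\<^sup>2"
  note [measurable] = admissibleD(1,2)[OF f]
  have A: "?A \<ge> 0" by (intro integral_nonneg_AE) simp
  show "integrable lborel (\<lambda>x. indicator {0..1} x * ?A + x powr pot_exp k * (f x)\<^sup>2)"
    by (intro Bochner_Integration.integrable_add integrable_indicator_Icc
        admissible_integrable_potential[OF f])
  show "(\<lambda>x. (f x)\<^sup>2) \<in> borel_measurable lborel" by measurable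
  fix x :: real
  consider "x \<le> 0" | "0 < x" "x \<le> 1" | "x > 1" by linarith
  then have "(f x)\<^sup>2 \<le> indicator {0..1} x * ?A + x powr pot_exp k * (f x)\<^sup>2"
  proof cases
    case 1
    then show ?thesis using admissibleD(3)[OF f, of x] A by simp
  next
    case 2
    have "(f x)\<^sup>2 \<le> x * ?A" using 2 by (intro admissible_square_le[OF f]) auto
    also have "\<dots> \<le> 1 * ?A" using 2 A by (intro mult_right_mono) auto
    finally show ?thesis using 2 by (simp add: add_increasing2)
  next
    case 3
    have "1 * (f x)\<^sup>2 \<le> x powr pot_exp k * (f x)\<^sup>2"
      using 3 pot_exp_pos[of k] by (intro mult_right_mono ge_one_powr_ge_zero) auto
    then show ?thesis using 3 by simp
  qed
  then show "\<bar>(f x)\<^sup>2\<bar> \<le> indicator {0..1} x * ?A + x powr pot_exp k * (f x)\<^sup>2" by simp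
qed

text \<open>The weights are evaluated at \<open>y\<close> and the bound at the smaller
  \<open>x\<close>, so that one majorant serves all shifted weights \<open>y = x + 1/n\<close>. The
  mixed term is split by 2ab \<le> a^2 + b^2 with the weight attached to \<open>g\<close>.\<close>

lemma weight_deriv_bound:
  fixes x y g g' a :: real
  assumes x: "0 < x" "x \<le> y" and a: "0 \<le> a" "a < 1/2"
  shows "\<bar>2 * g * g' * y powr (- a) - a * g\<^sup>2 * y powr (- a - 1)\<bar>
    \<le> g'\<^sup>2 + g\<^sup>2 * (1 + x powr (- 1)) + g\<^sup>2 * (1 + x powr (- (3/2)))"
proof -
  have 1: "y powr (- a) \<le> x powr (- a)" using x a by (intro powr_mono2') auto
  have 2: "y powr (- a - 1) \<le> x powr (- a - 1)" using x a by (intro powr_mono2') auto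
  have "\<bar>2 * g * g' * y powr (- a)\<bar> = 2 * \<bar>g'\<bar> * (\<bar>g\<bar> * y powr (- a))" by (simp add: abs_mult)
  also have "\<dots> \<le> 2 * \<bar>g'\<bar> * (\<bar>g\<bar> * x powr (- a))"
    using 1 by (intro mult_left_mono) auto
  also have "\<dots> \<le> \<bar>g'\<bar>\<^sup>2 + (\<bar>g\<bar> * x powr (- a))\<^sup>2"
    by (rule sum_squares_bound)
  also have "(\<bar>g\<bar> * x powr (- a))\<^sup>2 = g\<^sup>2 * x powr (- (2 * a))"
  proof -
    have "(x powr (- a))\<^sup>2 = x powr (- (2 * a))"
      by (simp add: power2_eq_square flip: powr_add)
    then show ?thesis by (simp add: power_mult_distrib)
  qed
  also have "\<dots> \<le> g\<^sup>2 * (1 + x powr (- 1))"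
    using x a by (intro mult_left_mono powr_minus_le_add) auto
  finally have i: "\<bar>2 * g * g' * y powr (- a)\<bar> \<le> g'\<^sup>2 + g\<^sup>2 * (1 + x powr (- 1))" by simp
  have "\<bar>a * g\<^sup>2 * y powr (- a - 1)\<bar> = a * (g\<^sup>2 * y powr (- a - 1))" using a by (simp add: abs_mult)
  also have "\<dots> \<le> 1 * (g\<^sup>2 * y powr (- a - 1))" using a by (intro mult_right_mono) auto
  also have "\<dots> \<le> g\<^sup>2 * x powr (- (a + 1))" using 2 by (simp add: mult_left_mono)
  also have "\<dots> \<le> g\<^sup>2 * (1 + x powr (- (3/2)))"
    using x a by (intro mult_left_mono powr_minus_le_add) auto
  finally have ii: "\<bar>a * g\<^sup>2 * y powr (- a - 1)\<bar> \<le> g\<^sup>2 * (1 + x powr (- (3/2)))" .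
  show ?thesis using i ii by linarith
qed

text \<open>As the square of \<open>f\<close> is at most a multiple of \<open>x\<close>, the factor
  x^(-3/2) improves to the integrable x^(-1/2).\<close>

lemma weight_deriv_bound_Icc:
  assumes f: "admissible k f f'" and x: "0 < x" "x \<le> y" "x \<le> T"
  shows "\<bar>2 * f x * f' x * y powr (- noise_exp k) - noise_exp k * (f x)\<^sup>2 * y powr (- noise_exp k - 1)\<bar>
    \<le> (f' x)\<^sup>2 + (LBINT t. (f' t)\<^sup>2) * (1 + 2 * T + x powr (- (1/2)))"
proof -
  let ?A = "LBINT t. (f' t)\<^sup>2"
  have A: "?A \<ge> 0" by (intro integral_nonneg_AE) simp
  have f2: "(f x)\<^sup>2 \<le> x * ?A" using x by (intro admissible_square_le[OF f]) auto
  have "(f x)\<^sup>2 * (1 + x powr (- 1)) \<le> (x * ?A) * (1 + x powr (- 1))"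
    using f2 by (intro mult_right_mono) auto
  also have "\<dots> = ?A * (x + 1)" using x by (simp add: powr_minus field_simps)
  also have "\<dots> \<le> ?A * (T + 1)" using x A by (intro mult_left_mono) auto
  finally have 1: "(f x)\<^sup>2 * (1 + x powr (- 1)) \<le> ?A * (T + 1)" .
  have p: "x * x powr (- (3/2)) = x powr (- (1/2))"
    using x by (simp add: powr_mult_base)
  have "(f x)\<^sup>2 * (1 + x powr (- (3/2))) \<le> (x * ?A) * (1 + x powr (- (3/2)))"
    using f2 by (intro mult_right_mono) auto
  also have "\<dots> = ?A * (x + x * x powr (- (3/2)))" by (simp add: algebra_simps)
  also have "\<dots> \<le> ?A * (T + x powr (- (1/2)))" unfolding p using x A by (intro mult_left_mono) auto
  finally have 2: "(f x)\<^sup>2 * (1 + x powr (- (3/2))) \<le> ?A * (T + x powr (- (1/2)))" .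
  show ?thesis
    using weight_deriv_bound[of x y "noise_exp k" "f x" "f' x", OF x(1,2) noise_exp_nonneg noise_exp_less] 1 2
    by (simp add: algebra_simps)
qed

lemma integrable_weight_majorant:
  assumes f: "admissible k f f'" and T: "T \<ge> 0"
  shows "integrable lborel (\<lambda>x. (f' x)\<^sup>2 + indicator {0..T} x * ((LBINT t. (f' t)\<^sup>2) * (1 + 2 * T + x powr (- (1/2)))))"
proof -
  have "integrable lborel (\<lambda>x. (f' x)\<^sup>2 + (indicator {0..T} x * ((LBINT t. (f' t)\<^sup>2) * (1 + 2 * T))
     + (LBINT t. (f' t)\<^sup>2) * (indicator {0..T} x * x powr (- (1/2)))))"
    by (intro Bochner_Integration.integrable_add integrable_mult_right integrable_indicator_Icc
        integrable_inverse_sqrt(1)[OF T] admissible_integrable_deriv_sq[OF f])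
  then show ?thesis by (simp add: algebra_simps)
qed

text \<open>The singular weight is approximated by the smooth weights \<open>(x + 1/n)\<close> to the same power.\<close>
lemma primitive_weight:
  assumes f: "admissible k f f'"
  shows "primitive (weight k f) (weight_deriv k f f')"
  unfolding primitive_def
proof (intro allI impI)
  fix T :: real assume T: "T \<ge> 0"
  note [measurable] = admissibleD(1,2)[OF f]
  define h where "h n x = (x + 1 / real (Suc n)) powr (- noise_exp k)" for n x
  define h' where "h' n x = - noise_exp k * (x + 1 / real (Suc n)) powr (- noise_exp k - 1)" for n x
  have h: "primitive (h n) (h' n)" for n
  proof (rule primitive_derivI)
    fix x :: real assume "x \<ge> 0"
    then have pos: "x + 1 / real (Suc n) > 0" by (intro add_nonneg_pos) auto
    show "(h n has_real_derivative h' n x) (at x within {0..})"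
      unfolding h_def h'_def
      by (rule derivative_eq_intros refl pos | simp)+
  next
    have "x + 1 / real (Suc n) \<noteq> 0" if "x \<ge> 0" for x
      using that by (smt (verit) divide_pos_pos of_nat_0_less_iff zero_less_Suc)
    then show "continuous_on {0..} (h' n)"
      unfolding h'_def by (intro continuous_intros) auto
  qed
  let ?s = "\<lambda>n x. (f' x * f x + f x * f' x) * h n x + (f x * f x) * h' n x"
  have ps: "primitive (\<lambda>x. (f x * f x) * h n x) (?s n)" for n
    by (intro primitive_mult admissibleD(5)[OF f] h)
  have f0: "f 0 = 0" using admissibleD(3)[OF f, of 0] by simp
  let ?A = "LBINT t. (f' t)\<^sup>2"
  let ?B = "\<lambda>x. (f' x)\<^sup>2 + indicator {0..T} x * (?A * (1 + 2 * T + x powr (- (1/2))))"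
  have A: "?A \<ge> 0" by (intro integral_nonneg_AE) simp
  have lim: "(\<lambda>n. x + 1 / real (Suc n)) \<longlonglongrightarrow> x + 0" for x :: real
    by (intro tendsto_intros LIMSEQ_Suc lim_1_over_n)
  have hlim: "(\<lambda>n. h n x) \<longlonglongrightarrow> x powr (- noise_exp k)" and h'lim: "(\<lambda>n. h' n x) \<longlonglongrightarrow> - noise_exp k * x powr (- noise_exp k - 1)"
    if "x > 0" for x
    unfolding h_def h'_def using lim[of x] that by (auto intro!: tendsto_intros)
  have meas: "(\<lambda>x. indicator {0..T} x * weight_deriv k f f' x) \<in> borel_measurable lborel"
    unfolding weight_deriv_def by measurable
  have conv: "AE x in lborel. (\<lambda>n. indicator {0..T} x *\<^sub>R ?s n x) \<longlonglongrightarrow> indicator {0..T} x *\<^sub>R weight_deriv k f f' x"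
  proof (rule AE_I2)
    fix x :: real
    show "(\<lambda>n. indicator {0..T} x *\<^sub>R ?s n x) \<longlonglongrightarrow> indicator {0..T} x *\<^sub>R weight_deriv k f f' x"
    proof (cases "x > 0")
      case True
      have "(\<lambda>n. indicator {0..T} x *\<^sub>R ?s n x) \<longlonglongrightarrow> indicator {0..T} x *\<^sub>R
          ((f' x * f x + f x * f' x) * x powr (- noise_exp k) + (f x * f x) * (- noise_exp k * x powr (- noise_exp k - 1)))"
        by (intro tendsto_intros hlim h'lim True)
      also have "(f' x * f x + f x * f' x) * x powr (- noise_exp k) + (f x * f x) * (- noise_exp k * x powr (- noise_exp k - 1))
         = weight_deriv k f f' x"
        by (simp add: weight_deriv_def power2_eq_square algebra_simps)
      finally show ?thesis .
    qed (use admissibleD(3,4)[OF f, of x] in \<open>auto simp: weight_deriv_def\<close>)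
  qed
  have bound: "AE x in lborel. norm (indicator {0..T} x *\<^sub>R ?s n x) \<le> ?B x" for n
  proof (rule AE_I2)
    fix x :: real
    consider "0 < x" "x \<le> T" | "x \<le> 0 \<or> x > T" by linarith
    then show "norm (indicator {0..T} x *\<^sub>R ?s n x) \<le> ?B x"
    proof cases
      case 1
      have "?s n x = 2 * f x * f' x * (x + 1 / real (Suc n)) powr (- noise_exp k)
          - noise_exp k * (f x)\<^sup>2 * (x + 1 / real (Suc n)) powr (- noise_exp k - 1)"
        by (simp add: h_def h'_def power2_eq_square algebra_simps)
      moreover have "\<bar>2 * f x * f' x * (x + 1 / real (Suc n)) powr (- noise_exp k)
          - noise_exp k * (f x)\<^sup>2 * (x + 1 / real (Suc n)) powr (- noise_exp k - 1)\<bar>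
          \<le> (f' x)\<^sup>2 + ?A * (1 + 2 * T + x powr (- (1/2)))"
        using 1 by (intro weight_deriv_bound_Icc[OF f]) auto
      ultimately show ?thesis using 1 by simp
    next
      case 2
      then have "indicator {0..T} x *\<^sub>R ?s n x = 0"
        using admissibleD(3,4)[OF f, of x] by (auto simp: indicator_def)
      then show ?thesis using A T by (simp add: indicator_def)
    qed
  qed
  have int: "integrable lborel ?B" by (rule integrable_weight_majorant[OF f T])
  have sm: "(\<lambda>x. indicator {0..T} x *\<^sub>R ?s n x) \<in> borel_measurable lborel" for n
    unfolding h_def h'_def by measurable
  have i: "integrable lborel (\<lambda>x. indicator {0..T} x *\<^sub>R weight_deriv k f f' x)"
    by (rule integrable_dominated_convergence[OF _ sm int conv bound]) (use meas in simp)
  have l1: "(\<lambda>n. LBINT x. indicator {0..T} x *\<^sub>R ?s n x) \<longlonglongrightarrow> (LBINT x. indicator {0..T} x *\<^sub>R weight_deriv k f f' x)"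
    by (rule integral_dominated_convergence[OF _ sm int conv bound]) (use meas in simp)
  have e: "(LBINT x. indicator {0..T} x *\<^sub>R ?s n x) = (f T * f T) * h n T" for n
    using primitive_increment[OF ps, of 0 T n] T f0 by (simp add: set_lebesgue_integral_def)
  have l2: "(\<lambda>n. (f T * f T) * h n T) \<longlonglongrightarrow> weight k f T"
  \<comment> \<open>At the origin the smooth weights may blow up with \<open>n\<close>, whereas the
    limit weight is 0 there; the factor \<open>f 0 = 0\<close> settles this case.\<close>
  proof (cases "T = 0")
    case True then show ?thesis using f0 by (simp add: weight_def)
  next
    case False
    then have "(\<lambda>n. (f T * f T) * h n T) \<longlonglongrightarrow> (f T * f T) * T powr (- noise_exp k)"
      using T by (intro tendsto_intros hlim) auto
    then show ?thesis by (simp add: weight_def power2_eq_square)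
  qed
  have "weight k f T = (LBINT x:{0..T}. weight_deriv k f f' x)"
    using LIMSEQ_unique[OF l1[unfolded e] l2] by (simp add: set_lebesgue_integral_def)
  then show "set_integrable lborel {0..T} (weight_deriv k f f') \<and>
     weight k f T = weight k f 0 + (LBINT y:{0..T}. weight_deriv k f f' y)"
    using i f0 by (simp add: set_integrable_def weight_def)
qed

lemma admissible_cmult:
  assumes f: "admissible k f f'"
  shows "admissible k (\<lambda>x. c * f x) (\<lambda>x. c * f' x)"
proof -
  note [measurable] = admissibleD(1,2)[OF f]
  have "edens k (\<lambda>x. c * f x) (\<lambda>x. c * f' x) = (\<lambda>x. c\<^sup>2 * edens k f f' x)"
    by (auto simp: edens_def power_mult_distrib algebra_simps)
  then show ?thesis
    using admissibleD[OF f] unfolding admissible_def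
    by (auto intro!: primitive_cmult)
qed

lemma admissible_add:
  assumes f: "admissible k f f'" and g: "admissible k g g'"
  shows "admissible k (\<lambda>x. f x + g x) (\<lambda>x. f' x + g' x)"
proof -
  note [measurable] = admissibleD(1,2)[OF f] admissibleD(1,2)[OF g]
  have "integrable lborel (edens k (\<lambda>x. f x + g x) (\<lambda>x. f' x + g' x))"
  proof (rule integrable_dominated)
    show "integrable lborel (\<lambda>x. 2 * edens k f f' x + 2 * edens k g g' x)"
      using admissibleD(6)[OF f] admissibleD(6)[OF g] by auto
    show "edens k (\<lambda>x. f x + g x) (\<lambda>x. f' x + g' x) \<in> borel_measurable lborel"
      unfolding edens_def by measurable
    fix x
    have sq: "(a + b)\<^sup>2 \<le> 2 * a\<^sup>2 + 2 * b\<^sup>2" for a b :: real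
      using sum_squares_bound[of a b] by (simp add: power2_sum)
    have "x powr pot_exp k * (f x + g x)\<^sup>2 \<le> x powr pot_exp k * (2 * (f x)\<^sup>2 + 2 * (g x)\<^sup>2)"
      by (intro mult_left_mono sq) auto
    then have "edens k (\<lambda>x. f x + g x) (\<lambda>x. f' x + g' x) x \<le> 2 * edens k f f' x + 2 * edens k g g' x"
      using sq[of "f' x" "g' x"] unfolding edens_def by (simp add: algebra_simps)
    then show "\<bar>edens k (\<lambda>x. f x + g x) (\<lambda>x. f' x + g' x) x\<bar> \<le> 2 * edens k f f' x + 2 * edens k g g' x"
      by (simp add: edens_nonneg)
  qed
  then show ?thesis
    using admissibleD[OF f] admissibleD[OF g] unfolding admissible_def
    by (auto intro!: primitive_add)
qed

lemma energy_cmult: "energy k (\<lambda>x. c * f x) (\<lambda>x. c * f' x) = c\<^sup>2 * energy k f f'"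
proof -
  have "edens k (\<lambda>x. c * f x) (\<lambda>x. c * f' x) = (\<lambda>x. c\<^sup>2 * edens k f f' x)"
    by (auto simp: edens_def power_mult_distrib algebra_simps)
  then show ?thesis by (simp add: energy_def)
qed

lemma sqnorm_cmult: "sqnorm (\<lambda>x. c * f x) = c\<^sup>2 * sqnorm f"
  by (simp add: sqnorm_def power_mult_distrib)

text \<open>The noise integral truncated at \<open>T\<close>, before the limit that
  \<open>wint\<close> takes.\<close>

definition pint :: "nat \<Rightarrow> (real \<Rightarrow> real) \<Rightarrow> (real \<Rightarrow> real) \<Rightarrow> (real \<Rightarrow> real) \<Rightarrow> real \<Rightarrow> real" where
  "pint k f f' w = stieltjes (weight k f) (weight_deriv k f f') w"

text \<open>The L2 part pays for the derivative of a cut-off, so that multiplying by a cut-off costs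
  only a constant factor.\<close>

definition form_norm :: "nat \<Rightarrow> (real \<Rightarrow> real) \<Rightarrow> (real \<Rightarrow> real) \<Rightarrow> real" where
  "form_norm k f f' = energy k f f' + sqnorm f"

lemma stieltjes_integrable:
  assumes u: "primitive u u'" and w: "cpath w"
  shows "set_integrable lborel {0..T} (\<lambda>x. w x * u' x)"
proof (cases "T \<ge> 0")
  case True
  show ?thesis
    by (rule set_integrable_mult_continuous[OF primitiveD(1)[OF u True]])
       (rule continuous_on_subset[OF w], auto)
qed (auto simp: set_integrable_def)

lemma pint_integrable:
  assumes f: "admissible k f f'" and w: "cpath w"
  shows "set_integrable lborel {0..T} (\<lambda>x. w x * weight_deriv k f f' x)"
  by (rule stieltjes_integrable[OF primitive_weight[OF f] w])

lemma pint_cmult: "pint k (\<lambda>x. c * f x) (\<lambda>x. c * f' x) w T = c\<^sup>2 * pint k f f' w T"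
proof -
  have "(\<lambda>x. w x * weight_deriv k (\<lambda>x. c * f x) (\<lambda>x. c * f' x) x) = (\<lambda>x. c\<^sup>2 * (w x * weight_deriv k f f' x))"
    by (auto simp: weight_deriv_def power_mult_distrib algebra_simps power2_eq_square)
  then show ?thesis
    by (simp add: pint_def stieltjes_def weight_def power_mult_distrib right_diff_distrib)
qed

lemma pint_parallelogram:
  assumes f: "admissible k f f'" and g: "admissible k g g'" and w: "cpath w"
  shows "pint k (\<lambda>x. f x + c * g x) (\<lambda>x. f' x + c * g' x) w T
       + pint k (\<lambda>x. f x + (- c) * g x) (\<lambda>x. f' x + (- c) * g' x) w T
    = 2 * pint k f f' w T + 2 * c\<^sup>2 * pint k g g' w T"
proof -
  let ?P = "\<lambda>c x. weight_deriv k (\<lambda>x. f x + c * g x) (\<lambda>x. f' x + c * g' x) x"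
  have fc: "admissible k (\<lambda>x. f x + c * g x) (\<lambda>x. f' x + c * g' x)" for c
    by (intro admissible_add admissible_cmult f g)
  note i1 = pint_integrable[OF fc[of c] w, of T] and i2 = pint_integrable[OF fc[of "- c"] w, of T]
  have "(LBINT x:{0..T}. w x * ?P c x) + (LBINT x:{0..T}. w x * ?P (- c) x)
     = (LBINT x:{0..T}. w x * ?P c x + w x * ?P (- c) x)"
    using set_integral_add(2)[OF i1 i2] by simp
  also have "\<dots> = (LBINT x:{0..T}. 2 * (w x * weight_deriv k f f' x) + 2 * c\<^sup>2 * (w x * weight_deriv k g g' x))"
    by (intro set_lebesgue_integral_cong)
      (auto simp: weight_deriv_def power2_eq_square algebra_simps)
  also have "\<dots> = 2 * (LBINT x:{0..T}. w x * weight_deriv k f f' x) + 2 * c\<^sup>2 * (LBINT x:{0..T}. w x * weight_deriv k g g' x)"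
    using pint_integrable[OF f w, of T] pint_integrable[OF g w, of T]
    by (subst set_integral_add) auto
  finally show ?thesis
    by (simp add: pint_def stieltjes_def weight_def power2_eq_square algebra_simps)
qed

section \<open>Cut-off functions\<close>

definition ramp :: "real \<Rightarrow> real \<Rightarrow> real" where
  "ramp b x = max 0 (min 1 (x - b))"

lemma ramp_bounds: "0 \<le> ramp b x" "ramp b x \<le> 1"
  by (auto simp: ramp_def)

lemma ramp_measurable [measurable]: "ramp b \<in> borel_measurable borel"
  unfolding ramp_def by measurable

lemma primitive_ramp: "primitive (ramp b) (indicator {b..b+1})"
  unfolding primitive_def
proof (intro allI impI conjI)
  fix x :: real assume x: "x \<ge> 0"
  have e: "(\<lambda>y. indicator {0..x} y *\<^sub>R indicator {b..b+1} y) = (indicator {max 0 b..min x (b+1)} :: real \<Rightarrow> real)"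
    by (auto simp: indicator_def)
  show "set_integrable lborel {0..x} (indicator {b..b+1} :: real \<Rightarrow> real)"
    unfolding set_integrable_def e by (intro integrable_real_indicator) (auto simp: emeasure_lborel_Icc_eq)
  show "ramp b x = ramp b 0 + (LBINT y:{0..x}. indicator {b..b+1} y)"
    unfolding set_lebesgue_integral_def e using x
    by (auto simp: ramp_def measure_def emeasure_lborel_Icc_eq)
qed

text \<open>The product rule gives at most 2 g^2 + 2 g'^2 for the squared derivative, and the
  undifferentiated term adds one more g^2; this is the origin of the 3.\<close>

lemma cutoff_density_le:
  fixes c c' :: real
  assumes "0 \<le> c" "c \<le> 1" "\<bar>c'\<bar> \<le> 1" "x powr pot_exp k \<ge> 0"
  shows "(c' * g + c * g')\<^sup>2 + x powr pot_exp k * (c * g)\<^sup>2 + (c * g)\<^sup>2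
     \<le> 3 * (g'\<^sup>2 + x powr pot_exp k * g\<^sup>2 + g\<^sup>2)"
proof -
  have c1: "c\<^sup>2 \<le> 1" "c'\<^sup>2 \<le> 1"
    using assms by (auto simp: abs_square_le_1 power_le_one)
  have "(c' * g + c * g')\<^sup>2 \<le> 2 * (c' * g)\<^sup>2 + 2 * (c * g')\<^sup>2"
    using sum_squares_bound[of "c' * g" "c * g'"] by (simp add: power2_sum)
  also have "\<dots> \<le> 2 * (1 * g\<^sup>2) + 2 * (1 * g'\<^sup>2)"
    unfolding power_mult_distrib using c1 by (intro add_mono mult_left_mono mult_right_mono) auto
  finally have 1: "(c' * g + c * g')\<^sup>2 \<le> 2 * g\<^sup>2 + 2 * g'\<^sup>2" by simp
  have 2: "(c * g)\<^sup>2 \<le> 1 * g\<^sup>2"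
    unfolding power_mult_distrib using c1 by (intro mult_right_mono) auto
  have 3: "x powr pot_exp k * (c * g)\<^sup>2 \<le> x powr pot_exp k * (1 * g\<^sup>2)"
    using 2 by (intro mult_left_mono) auto
  have "0 \<le> x powr pot_exp k * g\<^sup>2" "0 \<le> g'\<^sup>2" by auto
  with 1 2 3 show ?thesis unfolding distrib_left by linarith
qed

lemma admissible_cutoff:
  assumes f: "admissible k f f'" and c: "primitive c c'"
    and [measurable]: "c \<in> borel_measurable borel" "c' \<in> borel_measurable borel"
    and c01: "\<And>x. 0 \<le> c x \<and> c x \<le> 1" and c': "\<And>x. \<bar>c' x\<bar> \<le> 1"
  shows "admissible k (\<lambda>x. c x * f x) (\<lambda>x. c' x * f x + c x * f' x)"
proof -
  note [measurable] = admissibleD(1,2)[OF f]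
  have "integrable lborel (edens k (\<lambda>x. c x * f x) (\<lambda>x. c' x * f x + c x * f' x))"
  proof (rule integrable_dominated)
    show "integrable lborel (\<lambda>x. 3 * (edens k f f' x + (f x)\<^sup>2))"
      using admissibleD(6)[OF f] admissible_integrable_square[OF f] by auto
    show "edens k (\<lambda>x. c x * f x) (\<lambda>x. c' x * f x + c x * f' x) \<in> borel_measurable lborel"
      unfolding edens_def by measurable
    fix x
    show "\<bar>edens k (\<lambda>x. c x * f x) (\<lambda>x. c' x * f x + c x * f' x) x\<bar> \<le> 3 * (edens k f f' x + (f x)\<^sup>2)"
      using cutoff_density_le[of "c x" "c' x" x k "f x" "f' x"] c01[of x] c'[of x] zero_le_power2[of "c x * f x"]
        powr_ge_zero[of x "pot_exp k"]
      unfolding abs_of_nonneg[OF edens_nonneg] unfolding edens_def by linarith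
  qed
  then show ?thesis
    using admissibleD[OF f] unfolding admissible_def
    by (auto intro!: primitive_mult c)
qed

abbreviation cut :: "real \<Rightarrow> (real \<Rightarrow> real) \<Rightarrow> real \<Rightarrow> real" where
  "cut b f \<equiv> (\<lambda>x. (1 - ramp b x) * f x)"

abbreviation dcut :: "real \<Rightarrow> (real \<Rightarrow> real) \<Rightarrow> (real \<Rightarrow> real) \<Rightarrow> real \<Rightarrow> real" where
  "dcut b f f' \<equiv> (\<lambda>x. - indicator {b..b+1} x * f x + (1 - ramp b x) * f' x)"

lemma admissible_ramp:
  assumes f: "admissible k f f'"
  shows "admissible k (\<lambda>x. ramp b x * f x) (\<lambda>x. indicator {b..b+1} x * f x + ramp b x * f' x)"
  by (rule admissible_cutoff[OF f primitive_ramp]) (auto simp: ramp_bounds indicator_def)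

lemma primitive_one_minus_ramp:
  "primitive (\<lambda>x. 1 - ramp b x) (\<lambda>x. - indicator {b..b+1} x)"
  using primitive_add[OF primitive_const[of 1] primitive_cmult[OF primitive_ramp[of b], of "-1"]] by simp

lemma admissible_one_minus_ramp:
  assumes f: "admissible k f f'"
  shows "admissible k (cut b f) (dcut b f f')"
  by (rule admissible_cutoff[OF f primitive_one_minus_ramp]) (auto simp: ramp_bounds indicator_def)

text \<open>Keeps the set of form values nonempty, on which the rules for \<open>Sup\<close> on the
  reals depend.\<close>

lemma admissible_exists:
  obtains f f' where "admissible k f f'" "sqnorm f = 1"
proof -
  \<comment> \<open>A tent: it rises from 0 to 1 on [1, 2] and falls back to 0 on [2, 3].\<close>
  define g where "g = cut 2 (ramp 1)"
  define g' :: "real \<Rightarrow> real" where "g' = dcut 2 (ramp 1) (indicator {1..1+1})"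
  have p: "primitive g g'"
    unfolding g_def g'_def by (intro primitive_mult primitive_one_minus_ramp primitive_ramp)
  have [measurable]: "g \<in> borel_measurable borel" "g' \<in> borel_measurable borel"
    unfolding g_def g'_def by measurable
  have "(1 - ramp 2 x) * ramp 1 x \<le> 1 * 1" for x
    by (rule mult_mono) (auto simp: ramp_bounds)
  then have "g x \<ge> 0" "g x \<le> 1" for x
    by (simp_all add: g_def ramp_bounds)
  then have gb: "\<bar>g x\<bar> \<le> 1" "\<bar>g' x\<bar> \<le> 1" and supp: "x \<notin> {1..3} \<Longrightarrow> g x = 0 \<and> g' x = 0" for x
    by (auto simp: g_def g'_def ramp_def indicator_def)
  have ad: "admissible k g g'"
    unfolding admissible_def
  proof (intro conjI allI impI p)
    show "integrable lborel (edens k g g')"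
    proof (rule integrable_dominated)
      show "integrable lborel (\<lambda>x::real. indicator {1..3} x * (1 + 3 powr pot_exp k * 1 :: real))"
        by (rule integrable_indicator_Icc)
      show "edens k g g' \<in> borel_measurable lborel" unfolding edens_def by measurable
      fix x :: real
      show "\<bar>edens k g g' x\<bar> \<le> indicator {1..3} x * (1 + 3 powr pot_exp k * 1 :: real)"
      proof (cases "x \<in> {1..3}")
        case True
        have "(g x)\<^sup>2 \<le> 1" "(g' x)\<^sup>2 \<le> 1" using gb[of x] by (auto simp: abs_square_le_1)
        moreover have "x powr pot_exp k \<le> 3 powr pot_exp k" using True pot_exp_pos[of k] by (intro powr_mono2) auto
        ultimately have "edens k g g' x \<le> 1 + 3 powr pot_exp k * 1"
          unfolding edens_def by (intro add_mono mult_mono) auto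
        then show ?thesis using True edens_nonneg[of k g g' x] by simp
      qed (use supp[of x] in \<open>simp add: edens_def\<close>)
    qed
  qed (use supp in auto)
  have "sqnorm g \<noteq> 0"
  proof
    assume "sqnorm g = 0"
    then have "AE x in lborel. (g x)\<^sup>2 = 0"
      using integral_nonneg_eq_0_iff_AE[OF admissible_integrable_square[OF ad]]
      by (simp add: sqnorm_def)
    then have "AE x in lborel. x \<notin> {1<..<(2::real)}"
      by eventually_elim (auto simp: g_def ramp_def)
    then have "emeasure lborel {1<..<(2::real)} = 0"
      by (subst AE_iff_measurable[symmetric, of _ _ "\<lambda>x. x \<notin> {1<..<(2::real)}"]) auto
    then show False by simp
  qed
  with sqnorm_nonneg[of g] have n: "sqnorm g > 0" by simp
  show ?thesis
  proof (rule that)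
    show "admissible k (\<lambda>x. (1 / sqrt (sqnorm g)) * g x) (\<lambda>x. (1 / sqrt (sqnorm g)) * g' x)"
      by (rule admissible_cmult[OF ad])
    show "sqnorm (\<lambda>x. (1 / sqrt (sqnorm g)) * g x) = 1"
      unfolding sqnorm_cmult using n by (simp add: power_divide)
  qed
qed

section \<open>Reduction of the variational problem to the normalised form domain\<close>

definition form_vals :: "real \<Rightarrow> nat \<Rightarrow> (real \<Rightarrow> real) \<Rightarrow> real set" where
  "form_vals \<beta> k w = {2 / sqrt \<beta> * Lim at_top (pint k f f' w) - energy k f f' | f f'.
      admissible k f f' \<and> sqnorm f = 1}"

lemma wint_eq_Lim_pint:
  assumes "\<And>x. x > 0 \<Longrightarrow> f x = g x \<and> f' x = g' x" "f 0 = 0" "g 0 = 0"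
  shows "wint k w f f' = Lim at_top (pint k g g' w)"
proof -
  have e: "(f T)\<^sup>2 * T powr (- noise_exp k) * w T - (LBINT x=0..T. w x * (2 * f x * f' x * x powr (- noise_exp k)
      - noise_exp k * (f x)\<^sup>2 * x powr (- noise_exp k - 1))) = pint k g g' w T" if "T > 0" for T
  proof -
    have "(LBINT x=0..T. w x * (2 * f x * f' x * x powr (- noise_exp k) - noise_exp k * (f x)\<^sup>2 * x powr (- noise_exp k - 1)))
      = (LBINT x:{0..T}. w x * (2 * f x * f' x * x powr (- noise_exp k) - noise_exp k * (f x)\<^sup>2 * x powr (- noise_exp k - 1)))"
      using that interval_integral_Icc[of 0 T "\<lambda>x. w x * (2 * f x * f' x * x powr (- noise_exp k) - noise_exp k * (f x)\<^sup>2 * x powr (- noise_exp k - 1))"] by (simp add: zero_ereal_def)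
    also have "\<dots> = (LBINT x:{0..T}. w x * weight_deriv k g g' x)"
    proof (rule set_lebesgue_integral_cong, simp, intro allI impI)
      \<comment> \<open>At x = 0 both integrands vanish because \<open>f 0 = g 0 = 0\<close>,
        whatever the two derivatives are there.\<close>
      fix x assume "x \<in> {0..T}"
      then show "w x * (2 * f x * f' x * x powr (- noise_exp k) - noise_exp k * (f x)\<^sup>2 * x powr (- noise_exp k - 1)) = w x * weight_deriv k g g' x"
        using assms(1)[of x] assms(2,3) by (cases "x = 0") (auto simp: weight_deriv_def)
    qed
    finally show ?thesis using assms(1)[OF that] by (simp add: pint_def stieltjes_def weight_def)
  qed
  have ev: "eventually (\<lambda>T. (f T)\<^sup>2 * T powr (- noise_exp k) * w T - (LBINT x=0..T. w x * (2 * f x * f' x * x powr (- noise_exp k)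
      - noise_exp k * (f x)\<^sup>2 * x powr (- noise_exp k - 1))) = pint k g g' w T) at_top"
    using eventually_gt_at_top[of 0] by eventually_elim (rule e)
  have "Lim at_top (\<lambda>T. (f T)\<^sup>2 * T powr (- noise_exp k) * w T - (LBINT x=0..T. w x * (2 * f x * f' x * x powr (- noise_exp k)
      - noise_exp k * (f x)\<^sup>2 * x powr (- noise_exp k - 1)))) = Lim at_top (pint k g g' w)"
    by (rule Lim_cong[OF ev refl])
  then show ?thesis
    by (simp add: wint_def Let_def noise_exp_def[symmetric])
qed

text \<open>\<open>in_Lstar\<close> says nothing about the negative half line, where
  \<open>f\<close> and \<open>f'\<close> could even fail to be measurable. Setting both to zero
  there leaves every integral over the half line unchanged.\<close>

lemma in_Lstar_truncate:
  assumes "in_Lstar k f f'"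
  defines "g \<equiv> \<lambda>x. if x > 0 then f x else 0" and "g' \<equiv> \<lambda>x. if x > 0 then f' x else 0"
  shows "admissible k g g'"
proof -
  from assms(1) have c: "continuous_on {0..} f" and f0: "f 0 = 0"
    and p: "\<And>x. x \<ge> 0 \<Longrightarrow> set_integrable lborel {0..x} f' \<and> f x = (LBINT y=0..x. f' y)"
    and i: "set_integrable lborel {0<..} (\<lambda>x. (f' x)\<^sup>2 + x powr pot_exp k * (f x)\<^sup>2)"
    by (auto simp: in_Lstar_def pot_exp_def)
  have gm: "g \<in> borel_measurable borel"
  proof -
    have "continuous_on {0<..} f" by (rule continuous_on_subset[OF c]) auto
    then have "(\<lambda>x. indicator {0<..} x *\<^sub>R f x) \<in> borel_measurable borel"
      by (intro borel_measurable_continuous_on_indicator) auto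
    moreover have "(\<lambda>x. indicator {0<..} x *\<^sub>R f x) = g" by (auto simp: g_def indicator_def)
    ultimately show ?thesis by simp
  qed
  \<comment> \<open>Measurability of \<open>f'\<close> is available only on the intervals [0, n],
    through integrability, so \<open>g'\<close> is obtained as a pointwise limit of
    restrictions.\<close>
  have g'm: "g' \<in> borel_measurable borel"
  proof (rule borel_measurable_LIMSEQ_real)
    show "(\<lambda>x. indicator {0<..} x * (indicator {0..real n} x *\<^sub>R f' x)) \<in> borel_measurable borel" for n
      using p[of "real n"] unfolding set_integrable_def by auto
    fix x :: real
    have "eventually (\<lambda>n. indicator {0<..} x * (indicator {0..real n} x *\<^sub>R f' x) = g' x) sequentially"
      using eventually_ge_at_top[of "nat \<lceil>x\<rceil>"]
    proof eventually_elim
      case (elim n) then have "x \<le> real n" by linarith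
      then show ?case by (auto simp: g'_def indicator_def)
    qed
    then show "(\<lambda>n. indicator {0<..} x * (indicator {0..real n} x *\<^sub>R f' x)) \<longlonglongrightarrow> g' x"
      by (rule tendsto_eventually)
  qed
  have pg: "primitive g g'"
    unfolding primitive_def
  proof (intro allI impI conjI)
    fix x :: real assume x: "x \<ge> 0"
    have ae: "AE t in lborel. t \<in> {0..x} \<longrightarrow> f' t = g' t"
      using AE_lborel_singleton[of 0] by eventually_elim (auto simp: g'_def)
    have fm: "set_borel_measurable lborel {0..x} f'"
      using p[OF x] unfolding set_integrable_def set_borel_measurable_def by auto
    have hm: "set_borel_measurable lborel {0..x} g'"
      using g'm unfolding set_borel_measurable_def by measurable
    show "set_integrable lborel {0..x} g'"
      unfolding set_integrable_def
    proof (rule integrable_cong_AE_imp)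
      show "integrable lborel (\<lambda>t. indicator {0..x} t *\<^sub>R f' t)"
        using p[OF x] by (simp add: set_integrable_def)
      show "(\<lambda>t. indicator {0..x} t *\<^sub>R g' t) \<in> borel_measurable lborel"
        using hm by (simp add: set_borel_measurable_def)
      show "AE t in lborel. indicator {0..x} t *\<^sub>R f' t = indicator {0..x} t *\<^sub>R g' t"
        using ae by eventually_elim (auto simp: indicator_def)
    qed
    have "f x = (LBINT t:{0..x}. f' t)"
      using p[OF x] interval_integral_Icc[OF x, of f'] by (simp add: zero_ereal_def)
    also have "\<dots> = (LBINT t:{0..x}. g' t)"
      unfolding set_lebesgue_integral_def
    proof (rule integral_cong_AE)
      show "AE t in lborel. indicator {0..x} t *\<^sub>R f' t = indicator {0..x} t *\<^sub>R g' t"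
        using ae by eventually_elim (auto simp: indicator_def)
    qed (use fm hm in \<open>auto simp: set_borel_measurable_def\<close>)
    finally show "g x = g 0 + (LBINT t:{0..x}. g' t)"
      using x f0 by (cases "x = 0") (auto simp: g_def)
  qed
  have "edens k g g' = (\<lambda>x. indicator {0<..} x *\<^sub>R ((f' x)\<^sup>2 + x powr pot_exp k * (f x)\<^sup>2))"
    by (auto simp: edens_def g_def g'_def indicator_def)
  with i have "integrable lborel (edens k g g')" by (simp add: set_integrable_def)
  with gm g'm pg show ?thesis by (auto simp: admissible_def g_def g'_def)
qed

lemma admissible_in_Lstar:
  assumes f: "admissible k f f'"
  shows "in_Lstar k f f'"
  unfolding in_Lstar_def pot_exp_def[symmetric]
proof (intro conjI allI impI)
  show "continuous_on {0..} f" by (rule primitive_continuous_on[OF admissibleD(5)[OF f]])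
  show f0: "f 0 = 0" using admissibleD(3)[OF f, of 0] by simp
  fix x :: real assume x: "x \<ge> 0"
  show "set_integrable lborel {0..x} f'" by (rule primitiveD(1)[OF admissibleD(5)[OF f] x])
  show "f x = (LBINT y=0..x. f' y)"
    using primitive_increment[OF admissibleD(5)[OF f] order.refl x] f0 interval_integral_Icc[OF x, of f']
    by (simp add: zero_ereal_def)
next
  show "set_integrable lborel {0<..} (\<lambda>x. (f' x)\<^sup>2 + x powr pot_exp k * (f x)\<^sup>2)"
    using integrable_mult_indicator[OF _ admissibleD(6)[OF f], of "{0<..}"]
    by (simp add: set_integrable_def edens_def)
qed

text \<open>The two sets of values agree for every path, whether or not the limits exist:
  \<open>Lim\<close> is carried over by eventual equality of its arguments, and so is any junk
  value.\<close>

lemma TW_eq_Sup_form_vals: "TW \<beta> k W \<omega> = Sup (form_vals \<beta> k (W \<omega>))"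
proof -
  let ?E = "\<lambda>f f'. LBINT x:{0<..}. (f' x)\<^sup>2 + x powr pot_exp k * (f x)\<^sup>2"
  let ?S = "{2 / sqrt \<beta> * wint k (W \<omega>) f f' - ?E f f' | f f'. in_Lstar k f f' \<and>
      set_integrable lborel {0<..} (\<lambda>x. (f x)\<^sup>2) \<and> (LBINT x:{0<..}. (f x)\<^sup>2) = 1}"
  have "?S = form_vals \<beta> k (W \<omega>)"
  proof (intro equalityI subsetI)
    fix v assume "v \<in> ?S"
    then obtain f f' where v: "v = 2 / sqrt \<beta> * wint k (W \<omega>) f f' - ?E f f'"
      and f: "in_Lstar k f f'" and n: "(LBINT x:{0<..}. (f x)\<^sup>2) = 1" by auto
    define g where "g = (\<lambda>x. if x > 0 then f x else 0)"
    define g' where "g' = (\<lambda>x. if x > 0 then f' x else 0)"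
    have ad: "admissible k g g'" unfolding g_def g'_def by (rule in_Lstar_truncate[OF f])
    have "wint k (W \<omega>) f f' = Lim at_top (pint k g g' (W \<omega>))"
      using f by (intro wint_eq_Lim_pint) (auto simp: g_def g'_def in_Lstar_def)
    moreover have "?E f f' = energy k g g'"
      unfolding energy_def set_lebesgue_integral_def
      by (intro Bochner_Integration.integral_cong) (auto simp: g_def g'_def edens_def indicator_def)
    moreover have "(LBINT x:{0<..}. (f x)\<^sup>2) = sqnorm g"
      unfolding sqnorm_def set_lebesgue_integral_def
      by (intro Bochner_Integration.integral_cong) (auto simp: g_def indicator_def)
    ultimately show "v \<in> form_vals \<beta> k (W \<omega>)" using ad n v by (auto simp: form_vals_def)
  next
    fix v assume "v \<in> form_vals \<beta> k (W \<omega>)"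
    then obtain f f' where v: "v = 2 / sqrt \<beta> * Lim at_top (pint k f f' (W \<omega>)) - energy k f f'"
      and f: "admissible k f f'" and n: "sqnorm f = 1" by (auto simp: form_vals_def)
    have f0: "f x = 0 \<and> f' x = 0" if "\<not> x > 0" for x
      using that admissibleD(3,4)[OF f, of x] by auto
    have "wint k (W \<omega>) f f' = Lim at_top (pint k f f' (W \<omega>))"
      using f0 by (intro wint_eq_Lim_pint) auto
    moreover have "?E f f' = energy k f f'"
      unfolding energy_def set_lebesgue_integral_def
    proof (intro Bochner_Integration.integral_cong refl)
      show "indicator {0<..} x *\<^sub>R ((f' x)\<^sup>2 + x powr pot_exp k * (f x)\<^sup>2) = edens k f f' x" for x
        using f0[of x] by (cases "x > 0") (auto simp: edens_def)
    qed
    moreover have "(LBINT x:{0<..}. (f x)\<^sup>2) = sqnorm f"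
      unfolding sqnorm_def set_lebesgue_integral_def
    proof (intro Bochner_Integration.integral_cong refl)
      show "indicator {0<..} x *\<^sub>R (f x)\<^sup>2 = (f x)\<^sup>2" for x
        using f0[of x] by (cases "x > 0") auto
    qed
    moreover have "set_integrable lborel {0<..} (\<lambda>x. (f x)\<^sup>2)"
      using integrable_mult_indicator[OF _ admissible_integrable_square[OF f], of "{0<..}"]
      by (simp add: set_integrable_def)
    ultimately show "v \<in> ?S"
      using v n admissible_in_Lstar[OF f] by (intro CollectI exI[of _ f] exI[of _ f']) simp
  qed
  then show ?thesis by (simp add: TW_def pot_exp_def)
qed

section \<open>Convergence and divergence of the pathwise integral\<close>

abbreviation converges :: "(real \<Rightarrow> real) \<Rightarrow> bool" where
  "converges J \<equiv> \<exists>l. (J \<longlongrightarrow> l) at_top"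

abbreviation tail :: "nat \<Rightarrow> (real \<Rightarrow> real) \<Rightarrow> (real \<Rightarrow> real) \<Rightarrow> real \<Rightarrow> real" where
  "tail k f f' T \<equiv> (LBINT x. indicator {T..} x * (edens k f f' x + (f x)\<^sup>2))"

lemma primitive_indefinite:
  assumes "\<And>x. x \<ge> 0 \<Longrightarrow> set_integrable lborel {0..x} h"
  shows "primitive (\<lambda>x. LBINT y:{0..x}. h y) h"
  unfolding primitive_def
proof (intro allI impI conjI)
  fix x :: real assume x: "x \<ge> 0"
  show "set_integrable lborel {0..x} h" by (rule assms[OF x])
  have "(LBINT y:{0..0}. h y) = (LBINT y:{}. h y)"
    unfolding set_lebesgue_integral_def
  proof (rule integral_cong_AE)
    show "(\<lambda>y. indicator {0..0} y *\<^sub>R h y) \<in> borel_measurable lborel"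
      using assms[of 0] by (auto simp: set_integrable_def)
    show "AE y in lborel. indicator {0..0} y *\<^sub>R h y = indicator {} y *\<^sub>R h y"
      using AE_lborel_singleton[of 0] by eventually_elim (auto simp: indicator_def)
  qed simp
  then show "(LBINT y:{0..x}. h y) = (LBINT y:{0..0}. h y) + (LBINT y:{0..x}. h y)"
    by (simp add: set_lebesgue_integral_def)
qed

lemma primitive_pint:
  assumes f: "admissible k f f'" and w: "cpath w"
  shows "primitive (\<lambda>T. LBINT x:{0..T}. w x * weight_deriv k f f' x) (\<lambda>x. w x * weight_deriv k f f' x)"
  by (rule primitive_indefinite) (rule pint_integrable[OF f w])

lemma continuous_on_pint:
  assumes f: "admissible k f f'" and w: "cpath w"
  shows "continuous_on {0..} (pint k f f' w)"
  unfolding pint_def stieltjes_def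
  by (intro continuous_intros w primitive_continuous_on[OF primitive_weight[OF f]]
      primitive_continuous_on[OF primitive_pint[OF f w]])

lemma pint_diff:
  assumes f: "admissible k f f'" and w: "cpath w" and ST: "0 \<le> S" "S \<le> T"
  shows "pint k f f' w T - pint k f f' w S
    = weight k f T * w T - weight k f S * w S - (LBINT x:{S..T}. w x * weight_deriv k f f' x)"
  using primitive_increment[OF primitive_pint[OF f w] ST] by (simp add: pint_def stieltjes_def)

text \<open>Locality of the increments. The derivatives are compared only strictly inside the
  interval, because the closed indicator in the derivative of a ramp has the wrong value at the end
  point.\<close>

lemma pint_diff_cong:
  assumes f: "admissible k f f'" and g: "admissible k g g'" and w: "cpath w"
    and ST: "0 \<le> S" "S \<le> T"
    and eq: "\<And>x. S \<le> x \<Longrightarrow> x \<le> T \<Longrightarrow> f x = g x" "\<And>x. S < x \<Longrightarrow> x < T \<Longrightarrow> f' x = g' x"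
  shows "pint k f f' w T - pint k f f' w S = pint k g g' w T - pint k g g' w S"
proof -
  have sub: "set_integrable lborel {S..T} (\<lambda>x. w x * weight_deriv k f f' x)"
     "set_integrable lborel {S..T} (\<lambda>x. w x * weight_deriv k g g' x)"
    by (rule set_integrable_subset[OF pint_integrable[OF f w, of T]], simp, use ST in force)
       (rule set_integrable_subset[OF pint_integrable[OF g w, of T]], simp, use ST in force)
  have "(LBINT x:{S..T}. w x * weight_deriv k f f' x) = (LBINT x:{S..T}. w x * weight_deriv k g g' x)"
    unfolding set_lebesgue_integral_def
  proof (rule integral_cong_AE)
    show "AE x in lborel. indicator {S..T} x *\<^sub>R (w x * weight_deriv k f f' x)
        = indicator {S..T} x *\<^sub>R (w x * weight_deriv k g g' x)"
      using AE_lborel_singleton[of S] AE_lborel_singleton[of T]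
    proof eventually_elim
      case (elim x)
      then show ?case
        using eq(1)[of x] eq(2)[of x] by (cases "S < x \<and> x < T") (auto simp: indicator_def weight_deriv_def)
    qed
  qed (use sub in \<open>auto simp: set_integrable_def\<close>)
  then show ?thesis
    unfolding pint_diff[OF f w ST] pint_diff[OF g w ST]
    using eq(1)[of T] eq(1)[of S] ST by (simp add: weight_def)
qed

lemma tendsto_at_top_Cauchy:
  fixes J :: "real \<Rightarrow> real"
  assumes "\<And>e. e > 0 \<Longrightarrow> \<exists>N. \<forall>S\<ge>N. \<forall>T\<ge>S. \<bar>J T - J S\<bar> \<le> e"
  shows "converges J"
proof -
  have "Cauchy (\<lambda>n. J (real n))"
  proof (rule CauchyI')
    fix e :: real assume "e > 0"
    then obtain N where N: "\<And>S T. S \<ge> N \<Longrightarrow> T \<ge> S \<Longrightarrow> \<bar>J T - J S\<bar> \<le> e / 2"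
      using assms[of "e/2"] by auto
    show "\<exists>M. \<forall>m\<ge>M. \<forall>n>m. dist (J (real m)) (J (real n)) < e"
    proof (intro exI[of _ "nat \<lceil>N\<rceil>"] allI impI)
      fix m n assume "m \<ge> nat \<lceil>N\<rceil>" "n > m"
      then have "real m \<ge> N" "real n \<ge> real m" by linarith+
      from N[OF this] \<open>e > 0\<close> show "dist (J (real m)) (J (real n)) < e"
        by (simp add: dist_real_def abs_minus_commute)
    qed
  qed
  then obtain l where l: "(\<lambda>n. J (real n)) \<longlonglongrightarrow> l"
    using Cauchy_convergent_iff convergent_def by blast
  have "(J \<longlongrightarrow> l) at_top"
  proof (rule tendstoI)
    fix e :: real assume e: "e > 0"
    then obtain N where N: "\<And>S T. S \<ge> N \<Longrightarrow> T \<ge> S \<Longrightarrow> \<bar>J T - J S\<bar> \<le> e / 2"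
      using assms[of "e/2"] by auto
    have "dist (J x) l < e" if x: "x \<ge> N" for x
    proof -
      have "(\<lambda>n. \<bar>J (real n) - J x\<bar>) \<longlonglongrightarrow> \<bar>l - J x\<bar>" by (intro tendsto_intros l)
      moreover have "eventually (\<lambda>n. \<bar>J (real n) - J x\<bar> \<le> e / 2) sequentially"
        using eventually_ge_at_top[of "nat \<lceil>x\<rceil>"]
      proof eventually_elim
        case (elim n) then have "real n \<ge> x" by linarith
        with N[OF x] show ?case by simp
      qed
      ultimately have "\<bar>l - J x\<bar> \<le> e / 2" by (intro tendsto_upperbound) auto
      with e show ?thesis by (simp add: dist_real_def abs_minus_commute)
    qed
    then show "eventually (\<lambda>x. dist (J x) l < e) at_top"
      by (intro eventually_mono[OF eventually_ge_at_top[of N]])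
  qed
  then show ?thesis by blast
qed

lemma admissible_integrable_form_norm:
  assumes f: "admissible k f f'"
  shows "integrable lborel (\<lambda>x. edens k f f' x + (f x)\<^sup>2)"
  using admissibleD(6)[OF f] admissible_integrable_square[OF f] by (rule Bochner_Integration.integrable_add)

lemma form_norm_eq:
  assumes f: "admissible k f f'"
  shows "form_norm k f f' = (LBINT x. edens k f f' x + (f x)\<^sup>2)"
  unfolding form_norm_def energy_def sqnorm_def
  using admissibleD(6)[OF f] admissible_integrable_square[OF f] by simp

lemma form_norm_nonneg: "0 \<le> form_norm k f f'"
  by (simp add: form_norm_def energy_nonneg sqnorm_nonneg)

lemma form_norm_cutoff_le:
  assumes f: "admissible k f f'"
    and cf: "admissible k (\<lambda>x. c x * f x) (\<lambda>x. c' x * f x + c x * f' x)"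
    and c01: "\<And>x. 0 \<le> c x \<and> c x \<le> 1" and c': "\<And>x. \<bar>c' x\<bar> \<le> 1"
    and supp: "\<And>x. x < B \<Longrightarrow> c x = 0 \<and> c' x = 0"
  shows "form_norm k (\<lambda>x. c x * f x) (\<lambda>x. c' x * f x + c x * f' x)
     \<le> 3 * tail k f f' B"
proof -
  have i: "integrable lborel (\<lambda>x. indicator {B..} x * (edens k f f' x + (f x)\<^sup>2))"
    using integrable_mult_indicator[OF _ admissible_integrable_form_norm[OF f], of "{B..}"] by simp
  have "form_norm k (\<lambda>x. c x * f x) (\<lambda>x. c' x * f x + c x * f' x)
     \<le> (LBINT x. 3 * (indicator {B..} x * (edens k f f' x + (f x)\<^sup>2)))"
    unfolding form_norm_eq[OF cf]
  proof (rule integral_mono)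
    show "integrable lborel (\<lambda>x. edens k (\<lambda>x. c x * f x) (\<lambda>x. c' x * f x + c x * f' x) x + (c x * f x)\<^sup>2)"
      using admissible_integrable_form_norm[OF cf] .
    show "integrable lborel (\<lambda>x. 3 * (indicator {B..} x * (edens k f f' x + (f x)\<^sup>2)))"
      by (rule integrable_mult_right[OF i])
    fix x
    show "edens k (\<lambda>x. c x * f x) (\<lambda>x. c' x * f x + c x * f' x) x + (c x * f x)\<^sup>2
        \<le> 3 * (indicator {B..} x * (edens k f f' x + (f x)\<^sup>2))"
    proof (cases "x < B")
      case True with supp[of x] show ?thesis by (simp add: edens_def)
    next
      case False
      then show ?thesis
        using cutoff_density_le[of "c x" "c' x" x k "f x" "f' x"] c01[of x] c'[of x] by (simp add: edens_def)
    qed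
  qed
  then show ?thesis using i by simp
qed

lemma tail_form_norm_tendsto_0:
  assumes f: "admissible k f f'"
  shows "((\<lambda>B. tail k f f' B) \<longlongrightarrow> 0) at_top"
proof -
  let ?q = "\<lambda>x. edens k f f' x + (f x)\<^sup>2"
  note iq = admissible_integrable_form_norm[OF f]
  have "((\<lambda>B. LBINT x. indicator {B..} x * ?q x) \<longlongrightarrow> (LBINT x::real. (0::real))) at_top"
  proof (rule integral_dominated_convergence_at_top[where s="\<lambda>B x. indicator {B..} x * ?q x" and w="?q"])
    show "(\<lambda>x. indicator {B..} x * ?q x) \<in> borel_measurable lborel" for B
      using integrable_mult_indicator[OF _ iq, of "{B..}"] by simp
    show "AE x in lborel. ((\<lambda>B. indicator {B..} x * ?q x) \<longlongrightarrow> 0) at_top"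
    proof (rule AE_I2)
      fix x
      have "eventually (\<lambda>B. indicator {B..} x * ?q x = 0) at_top"
        using eventually_gt_at_top[of x] by eventually_elim (simp add: indicator_def)
      then show "((\<lambda>B. indicator {B..} x * ?q x) \<longlongrightarrow> 0) at_top" by (rule tendsto_eventually)
    qed
    show "\<forall>\<^sub>F B in at_top. AE x in lborel. norm (indicator {B..} x * ?q x) \<le> ?q x"
      by (intro always_eventually allI AE_I2) (auto simp: indicator_def edens_nonneg)
  qed (use iq in auto)
  then show ?thesis by simp
qed

text \<open>A uniform bound on the increments applied to the cut-off \<open>ramp (S - 1)\<close> times \<open>f\<close> gives
  the Cauchy criterion for \<open>f\<close>.\<close>
lemma pint_convergent_of_bound:
  assumes w: "cpath w" and R: "R \<ge> 0" and C: "C \<ge> 0"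
    and bd: "\<And>T g g'. T > R \<Longrightarrow> admissible k g g' \<Longrightarrow> \<bar>pint k g g' w T - pint k g g' w R\<bar> \<le> C * form_norm k g g'"
    and f: "admissible k f f'"
  shows "converges (pint k f f' w)"
proof (rule tendsto_at_top_Cauchy)
  fix e :: real assume e: "e > 0"
  have "((\<lambda>B. 2 * C * (3 * tail k f f' B)) \<longlongrightarrow> 2 * C * (3 * 0)) at_top"
    by (intro tendsto_intros tail_form_norm_tendsto_0[OF f])
  then have "eventually (\<lambda>B. 2 * C * (3 * tail k f f' B) < e) at_top"
    by (rule order_tendstoD) (use e in auto)
  then obtain B0 where B0: "\<And>B. B \<ge> B0 \<Longrightarrow> 2 * C * (3 * tail k f f' B) < e"
    by (auto simp: eventually_at_top_linorder)
  show "\<exists>N. \<forall>S\<ge>N. \<forall>T\<ge>S. \<bar>pint k f f' w T - pint k f f' w S\<bar> \<le> e"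
  \<comment> \<open>The ramp occupies [S - 1, S]: its start must reach \<open>B0\<close> to make the
    tail small, and \<open>S\<close> itself must exceed \<open>R\<close>, as the assumed bound
    compares values beyond \<open>R\<close> with the one at \<open>R\<close>.\<close>
  proof (intro exI[of _ "max (B0 + 1) (R + 1)"] allI impI)
    fix S T assume S: "S \<ge> max (B0 + 1) (R + 1)" and T: "T \<ge> S"
    let ?g = "\<lambda>x. ramp (S - 1) x * f x"
    let ?g' = "\<lambda>x. indicator {S - 1..S - 1 + 1} x * f x + ramp (S - 1) x * f' x"
    have g: "admissible k ?g ?g'" by (rule admissible_ramp[OF f])
    have "pint k f f' w T - pint k f f' w S = pint k ?g ?g' w T - pint k ?g ?g' w S"
      by (rule pint_diff_cong[OF f g w]) (use S T R in \<open>auto simp: ramp_def\<close>)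
    then have "\<bar>pint k f f' w T - pint k f f' w S\<bar> \<le> \<bar>pint k ?g ?g' w T - pint k ?g ?g' w R\<bar> + \<bar>pint k ?g ?g' w S - pint k ?g ?g' w R\<bar>"
      by linarith
    also have "\<dots> \<le> C * form_norm k ?g ?g' + C * form_norm k ?g ?g'"
      using S T by (intro add_mono bd g) auto
    also have "\<dots> = 2 * C * form_norm k ?g ?g'" by simp
    also have "\<dots> \<le> 2 * C * (3 * tail k f f' (S - 1))"
    proof (intro mult_left_mono form_norm_cutoff_le f g)
      fix x :: real assume "x < S - 1"
      then show "ramp (S - 1) x = 0 \<and> indicator {S - 1..S - 1 + 1} x = (0::real)"
        by (auto simp: ramp_def)
    qed (use C in \<open>auto simp: ramp_bounds indicator_def\<close>)
    also have "\<dots> \<le> e" using B0[of "S - 1"] S by simp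
    finally show "\<bar>pint k f f' w T - pint k f f' w S\<bar> \<le> e" .
  qed
qed

text \<open>Increments between \<open>R + 1\<close> and \<open>T\<close> do not see cut-offs acting
  on [R, R + 1] and [T, T + 1]. A test function with a large increment can thus be confined to
  [R, T + 1] and normalised to increment 1, which makes its form norm small.\<close>

lemma localised_hump:
  assumes w: "cpath w"
    and unb: "\<And>(R::nat) (C::nat). \<exists>T>real R. \<exists>f f'. admissible k f f' \<and>
        \<bar>pint k f f' w T - pint k f f' w (real R)\<bar> > real C * form_norm k f f'"
  shows "\<exists>T>real R + 1. \<exists>g g'. admissible k g g' \<and> form_norm k g g' \<le> (1/2) ^ m \<and>
      \<bar>pint k g g' w T - pint k g g' w (real R + 1)\<bar> = 1 \<and>
      (\<forall>x. x < real R \<or> x > T + 1 \<longrightarrow> g x = 0 \<and> g' x = 0)"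
proof -
  \<comment> \<open>Each of the two cut-offs can cost a factor 3 in the form norm, hence 9; the
    power of 2 becomes the final smallness.\<close>
  obtain T f f' where T: "T > real (R + 1)" and f: "admissible k f f'"
    and big: "\<bar>pint k f f' w T - pint k f f' w (real (R + 1))\<bar> > real (9 * 2 ^ m) * form_norm k f f'"
    using unb[of "R + 1" "9 * 2 ^ m"] by blast
  define g1 where "g1 = (\<lambda>x. ramp R x * f x)"
  define g1' where "g1' = (\<lambda>x. indicator {real R..real R + 1} x * f x + ramp R x * f' x)"
  have g1: "admissible k g1 g1'" unfolding g1_def g1'_def by (rule admissible_ramp[OF f])
  define g2 where "g2 = (\<lambda>x. (1 - ramp T x) * g1 x)"
  define g2' where "g2' = (\<lambda>x. - indicator {T..T + 1} x * g1 x + (1 - ramp T x) * g1' x)"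
  have g2: "admissible k g2 g2'" unfolding g2_def g2'_def by (rule admissible_one_minus_ramp[OF g1])
  have nle: "tail k h h' 0 \<le> form_norm k h h'"
    if h: "admissible k h h'" for h h'
    unfolding form_norm_eq[OF h] using admissible_integrable_form_norm[OF h]
    using integrable_mult_indicator[OF _ admissible_integrable_form_norm[OF h], of "{0..}"]
    by (intro integral_mono) (auto simp: indicator_def edens_nonneg)
  have n1: "form_norm k g1 g1' \<le> 3 * form_norm k f f'"
  proof -
    have "form_norm k g1 g1' \<le> 3 * tail k f f' 0"
      unfolding g1_def g1'_def
      by (rule form_norm_cutoff_le[OF f admissible_ramp[OF f]]) (auto simp: ramp_bounds ramp_def indicator_def)
    then show ?thesis using nle[OF f] by simp
  qed
  have "form_norm k g2 g2' = (LBINT x. edens k g2 g2' x + (g2 x)\<^sup>2)" by (rule form_norm_eq[OF g2])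
  also have "\<dots> \<le> (LBINT x. 3 * (edens k g1 g1' x + (g1 x)\<^sup>2))"
  proof (rule integral_mono[OF admissible_integrable_form_norm[OF g2]])
    show "integrable lborel (\<lambda>x. 3 * (edens k g1 g1' x + (g1 x)\<^sup>2))"
      using admissible_integrable_form_norm[OF g1] by (rule integrable_mult_right)
    fix x show "edens k g2 g2' x + (g2 x)\<^sup>2 \<le> 3 * (edens k g1 g1' x + (g1 x)\<^sup>2)"
      using cutoff_density_le[of "1 - ramp T x" "- indicator {T..T + 1} x" x k "g1 x" "g1' x"]
        ramp_bounds[of T x] by (simp add: edens_def g2_def g2'_def indicator_def)
  qed
  also have "\<dots> = 3 * form_norm k g1 g1'" unfolding form_norm_eq[OF g1] by (rule integral_mult_right_zero)
  finally have n2: "form_norm k g2 g2' \<le> 9 * form_norm k f f'" using n1 by simp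
  have "pint k f f' w T - pint k f f' w (real R + 1) = pint k g2 g2' w T - pint k g2 g2' w (real R + 1)"
    by (rule pint_diff_cong[OF f g2 w]) (use T in \<open>auto simp: g2_def g2'_def g1_def g1'_def ramp_def\<close>)
  then have big2: "\<bar>pint k g2 g2' w T - pint k g2 g2' w (real R + 1)\<bar> > real (9 * 2 ^ m) * form_norm k f f'"
    using big by (simp add: add.commute)
  define d where "d = \<bar>pint k g2 g2' w T - pint k g2 g2' w (real R + 1)\<bar>"
  have dpos: "d > 0" using big2 form_norm_nonneg[of k f f'] unfolding d_def
    by (smt (verit) mult_nonneg_nonneg of_nat_0_le_iff)
  have nd: "form_norm k g2 g2' * 2 ^ m \<le> d"
  proof -
    have "form_norm k g2 g2' * 2 ^ m \<le> (9 * form_norm k f f') * 2 ^ m"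
      by (rule mult_right_mono[OF n2]) simp
    also have "\<dots> = real (9 * 2 ^ m) * form_norm k f f'" by simp
    finally show ?thesis using big2 unfolding d_def by linarith
  qed
  \<comment> \<open>The form is quadratic in the test function, so this factor divides the increment
    \<open>d\<close> by itself.\<close>
  define s where "s = 1 / sqrt d"
  have s2: "s\<^sup>2 = 1 / d" using dpos by (simp add: s_def power_divide)
  show ?thesis
  proof (rule exI[of _ T], rule conjI, use T in simp, rule exI[of _ "\<lambda>x. s * g2 x"],
      rule exI[of _ "\<lambda>x. s * g2' x"], intro conjI allI impI)
    show "admissible k (\<lambda>x. s * g2 x) (\<lambda>x. s * g2' x)" by (rule admissible_cmult[OF g2])
    have "form_norm k (\<lambda>x. s * g2 x) (\<lambda>x. s * g2' x) = form_norm k g2 g2' / d"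
      by (simp add: form_norm_def energy_cmult sqnorm_cmult s2 add_divide_distrib)
    also have "\<dots> \<le> (1 / 2) ^ m"
      using nd dpos by (simp add: field_simps)
    finally show "form_norm k (\<lambda>x. s * g2 x) (\<lambda>x. s * g2' x) \<le> (1 / 2) ^ m" .
    show "\<bar>pint k (\<lambda>x. s * g2 x) (\<lambda>x. s * g2' x) w T - pint k (\<lambda>x. s * g2 x) (\<lambda>x. s * g2' x) w (real R + 1)\<bar> = 1"
      unfolding pint_cmult s2 using dpos
      by (simp add: d_def flip: diff_divide_distrib)
    fix x assume "x < real R \<or> x > T + 1"
    then show "s * g2 x = 0" "s * g2' x = 0"
      by (auto simp: g2_def g2'_def g1_def g1'_def ramp_def)
  qed
qed

text \<open>If the increments are not uniformly bounded, a sum of normalised humps with disjoint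
  supports has increments of size one arbitrarily far out.\<close>
lemma gliding_hump:
  assumes w: "cpath w"
    and unb: "\<And>(R::nat) (C::nat). \<exists>T>real R. \<exists>f f'. admissible k f f' \<and>
        \<bar>pint k f f' w T - pint k f f' w (real R)\<bar> > real C * form_norm k f f'"
  shows "\<exists>f f'. admissible k f f' \<and> \<not> converges (pint k f f' w)"
proof -
  have "\<forall>R m. \<exists>T g g'. T > real R + 1 \<and> admissible k g g' \<and> form_norm k g g' \<le> (1/2) ^ m \<and>
      \<bar>pint k g g' w T - pint k g g' w (real R + 1)\<bar> = 1 \<and>
      (\<forall>x. x < real R \<or> x > T + 1 \<longrightarrow> g x = 0 \<and> g' x = 0)"
  proof (intro allI)
    fix R m show "\<exists>T g g'. T > real R + 1 \<and> admissible k g g' \<and> form_norm k g g' \<le> (1/2) ^ m \<and>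
      \<bar>pint k g g' w T - pint k g g' w (real R + 1)\<bar> = 1 \<and>
      (\<forall>x. x < real R \<or> x > T + 1 \<longrightarrow> g x = 0 \<and> g' x = 0)"
      using localised_hump[OF w unb, of R m] by blast
  qed
  then obtain T0 G0 G0' where H0: "\<And>R m. T0 R m > real R + 1 \<and> admissible k (G0 R m) (G0' R m)
      \<and> form_norm k (G0 R m) (G0' R m) \<le> (1/2) ^ m \<and>
      \<bar>pint k (G0 R m) (G0' R m) w (T0 R m) - pint k (G0 R m) (G0' R m) w (real R + 1)\<bar> = 1 \<and>
      (\<forall>x. x < real R \<or> x > T0 R m + 1 \<longrightarrow> G0 R m x = 0 \<and> G0' R m x = 0)"
    unfolding choice_iff by (elim exE) blast
  \<comment> \<open>The summand 2 places the start of each hump strictly beyond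
    \<open>T + 1\<close>, where the previous hump ends; the supports become disjoint.\<close>
  define R where "R = rec_nat 0 (\<lambda>m r. nat \<lceil>T0 r m\<rceil> + 2)"
  have RS: "R (Suc m) = nat \<lceil>T0 (R m) m\<rceil> + 2" for m by (simp add: R_def)
  define T where "T m = T0 (R m) m" for m
  define g where "g m = G0 (R m) m" for m
  define g' where "g' m = G0' (R m) m" for m
  have T: "T m > real (R m) + 1" and adg: "admissible k (g m) (g' m)" and ng: "form_norm k (g m) (g' m) \<le> (1/2) ^ m"
    and inc: "\<bar>pint k (g m) (g' m) w (T m) - pint k (g m) (g' m) w (real (R m) + 1)\<bar> = 1"
    and supp: "\<And>x. x < real (R m) \<or> x > T m + 1 \<Longrightarrow> g m x = 0 \<and> g' m x = 0" for m
    using H0[of "R m" m] by (auto simp: T_def g_def g'_def)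
  have step: "real (R (Suc m)) > T m + 1" for m
    unfolding RS T_def[symmetric] using of_nat_ceiling[of "T m"] by simp
  have Rmono: "R m < R (Suc m)" for m using step[of m] T[of m] by linarith
  have Rle: "real (R m) \<le> real (R n)" if "m \<le> n" for m n
    using that lift_Suc_mono_le[of R m n] Rmono by (simp add: less_imp_le)
  have Rge: "real m \<le> real (R m)" for m
  proof (induction m)
    case (Suc m) then show ?case using Rmono[of m] by linarith
  qed simp
  have disj: "(g m x = 0 \<and> g' m x = 0) \<or> (g n x = 0 \<and> g' n x = 0)" if "m < n" for m n x
  proof (cases "x > T m + 1")
    case False
    have "real (R (Suc m)) \<le> real (R n)" using that by (intro Rle) auto
    with False step[of m] have "x < real (R n)" by linarith
    with supp[of x n] show ?thesis by blast
  qed (use supp[of x m] in blast)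
  define F where "F n x = (\<Sum>m<n. g m x)" for n x
  define F' where "F' n x = (\<Sum>m<n. g' m x)" for n x
  \<comment> \<open>Since \<open>R m >= m\<close>, every hump with index at least \<open>N x\<close>
    starts to the right of \<open>x\<close>. The infinite sum is therefore finite at each point and
    locally constant in its length.\<close>
  define N where "N x = nat \<lceil>x\<rceil> + 1" for x :: real
  define f where "f x = F (N x) x" for x
  define f' where "f' x = F' (N x) x" for x
  have late: "g m x = 0 \<and> g' m x = 0" if "N x \<le> m" for m x
  proof -
    have "x < real m" using that unfolding N_def by linarith
    with Rge[of m] supp[of x m] show ?thesis by auto
  qed
  have stab: "f x = F n x \<and> f' x = F' n x" if "N x \<le> n" for x n
  proof -
    have "F n x = F (N x) x"
      unfolding F_def using that late by (intro sum.mono_neutral_right) auto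
    moreover have "F' n x = F' (N x) x"
      unfolding F'_def using that late by (intro sum.mono_neutral_right) auto
    ultimately show ?thesis by (simp add: f_def f'_def)
  qed
  have N_mono: "N x \<le> N y" if "x \<le> y" for x y
    using that unfolding N_def by linarith
  have adF: "admissible k (F n) (F' n)" for n
  proof (induction n)
    case 0
    have "edens k (\<lambda>x. 0) (\<lambda>x. 0) = (\<lambda>x. 0)" by (auto simp: edens_def)
    then show ?case
      unfolding F_def[abs_def] F'_def[abs_def] admissible_def using primitive_const[of 0] by simp
  next
    case (Suc n)
    have "F (Suc n) = (\<lambda>x. F n x + g n x)" "F' (Suc n) = (\<lambda>x. F' n x + g' n x)"
      by (auto simp: F_def F'_def)
    then show ?case using admissible_add[OF Suc adg[of n]] by simp
  qed
  have Fzero: "F n x = 0 \<and> F' n x = 0 \<or> g n x = 0 \<and> g' n x = 0" for n x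
  proof (cases "g n x = 0 \<and> g' n x = 0")
    case False
    then have "g m x = 0 \<and> g' m x = 0" if "m < n" for m using disj[OF that, of x] by blast
    then show ?thesis by (simp add: F_def F'_def)
  qed auto
  have nF: "form_norm k (F n) (F' n) \<le> (\<Sum>m<n. (1/2) ^ m)" for n
  proof (induction n)
    case 0
    have "edens k (\<lambda>x. 0) (\<lambda>x. 0) = (\<lambda>x. 0)" by (auto simp: edens_def)
    then show ?case
      unfolding F_def[abs_def] F'_def[abs_def] by (simp add: form_norm_def energy_def sqnorm_def)
  next
    case (Suc n)
    \<comment> \<open>Disjoint supports remove the cross terms, so the form norms add up and stay
      below the geometric series.\<close>
    have e: "edens k (F (Suc n)) (F' (Suc n)) x + (F (Suc n) x)\<^sup>2
       = (edens k (F n) (F' n) x + (F n x)\<^sup>2) + (edens k (g n) (g' n) x + (g n x)\<^sup>2)" for x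
      using Fzero[of n x] by (auto simp: F_def F'_def edens_def)
    have "form_norm k (F (Suc n)) (F' (Suc n)) = form_norm k (F n) (F' n) + form_norm k (g n) (g' n)"
      unfolding form_norm_eq[OF adF] form_norm_eq[OF adg] e
      by (intro Bochner_Integration.integral_add admissible_integrable_form_norm adF adg)
    with Suc ng[of n] show ?case by simp
  qed
  have nF2: "form_norm k (F n) (F' n) \<le> 2" for n
  proof -
    have "form_norm k (F n) (F' n) \<le> (\<Sum>m<n. (1/2) ^ m)" by (rule nF)
    also have "\<dots> = 2 * (1 - (1/2) ^ n)" by (subst sum_gp_strict) auto
    also have "\<dots> \<le> 2 * (1 - 0)" by (intro mult_left_mono diff_left_mono) auto
    finally show ?thesis by simp
  qed
  have fm: "f \<in> borel_measurable borel" "f' \<in> borel_measurable borel"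
  proof -
    have ev: "eventually (\<lambda>n. F n x = f x) sequentially" "eventually (\<lambda>n. F' n x = f' x) sequentially" for x
      unfolding eventually_sequentially by (rule exI[of _ "N x"], simp add: stab)+
    show "f \<in> borel_measurable borel"
      by (rule borel_measurable_LIMSEQ_real[OF tendsto_eventually[OF ev(1)]])
         (use admissibleD(1)[OF adF] in auto)
    show "f' \<in> borel_measurable borel"
      by (rule borel_measurable_LIMSEQ_real[OF tendsto_eventually[OF ev(2)]])
         (use admissibleD(2)[OF adF] in auto)
  qed
  note [measurable] = fm
  have pf: "primitive f f'"
    unfolding primitive_def
  proof (intro allI impI)
    fix x :: real assume x: "x \<ge> 0"
    have s: "f t = F (N x) t \<and> f' t = F' (N x) t" if "t \<le> x" for t
      using stab[of t "N x"] N_mono[OF that] by auto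
    note p = primitiveD(1)[OF admissibleD(5)[OF adF[of "N x"]] x] 
      primitive_increment[OF admissibleD(5)[OF adF[of "N x"]] order.refl x]
    have "set_integrable lborel {0..x} f' \<longleftrightarrow> set_integrable lborel {0..x} (F' (N x))"
      by (rule set_integrable_cong) (use s in auto)
    moreover have "(LBINT t:{0..x}. f' t) = (LBINT t:{0..x}. F' (N x) t)"
      by (rule set_lebesgue_integral_cong) (use s in auto)
    ultimately show "set_integrable lborel {0..x} f' \<and> f x = f 0 + (LBINT t:{0..x}. f' t)"
      using p s[of x] s[of 0] x by simp
  qed
  \<comment> \<open>Fatou along the partial sums, whose energies are all at most 2.\<close>
  have "integrable lborel (edens k f f')"
  proof (rule integrableI_bounded)
    have [measurable]: "F n \<in> borel_measurable borel" "F' n \<in> borel_measurable borel" for n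
      using admissibleD(1,2)[OF adF] by auto
    show "edens k f f' \<in> borel_measurable lborel" unfolding edens_def by measurable
    have "(\<integral>\<^sup>+x. norm (edens k f f' x) \<partial>lborel) = (\<integral>\<^sup>+x. liminf (\<lambda>n. ennreal (edens k (F n) (F' n) x)) \<partial>lborel)"
    proof (rule nn_integral_cong)
      fix x
      have "eventually (\<lambda>n. ennreal (edens k (F n) (F' n) x) = ennreal (norm (edens k f f' x))) sequentially"
        using eventually_ge_at_top[of "N x"]
        by eventually_elim (simp add: stab edens_def)
      then have "(\<lambda>n. ennreal (edens k (F n) (F' n) x)) \<longlonglongrightarrow> ennreal (norm (edens k f f' x))"
        by (rule tendsto_eventually)
      then show "ennreal (norm (edens k f f' x)) = liminf (\<lambda>n. ennreal (edens k (F n) (F' n) x))"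
        by (rule lim_imp_Liminf[symmetric, rotated]) auto
    qed
    also have "\<dots> \<le> liminf (\<lambda>n. \<integral>\<^sup>+x. ennreal (edens k (F n) (F' n) x) \<partial>lborel)"
      by (rule nn_integral_liminf) (unfold edens_def, measurable)
    also have "\<dots> \<le> liminf (\<lambda>n::nat. ennreal 2)"
    proof (rule Liminf_mono, rule always_eventually, rule allI)
      fix n
      have "(\<integral>\<^sup>+x. ennreal (edens k (F n) (F' n) x) \<partial>lborel) = ennreal (energy k (F n) (F' n))"
        unfolding energy_def
        by (intro nn_integral_eq_integral admissibleD(6)[OF adF]) (simp add: edens_nonneg)
      also have "\<dots> \<le> ennreal 2"
        using nF2[of n] sqnorm_nonneg[of "F n"] by (intro ennreal_leI) (simp add: form_norm_def)
      finally show "(\<integral>\<^sup>+x. ennreal (edens k (F n) (F' n) x) \<partial>lborel) \<le> ennreal 2" .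
    qed
    also have "\<dots> = ennreal 2" by (rule Liminf_const) simp
    also have "\<dots> < \<infinity>" by simp
    finally show "(\<integral>\<^sup>+x. norm (edens k f f' x) \<partial>lborel) < \<infinity>" .
  qed
  moreover have "f x = 0 \<and> f' x = 0" if "x \<le> 0" for x
    using stab[of x "N x"] admissibleD(3,4)[OF adF, of x "N x"] that by auto
  ultimately have adf: "admissible k f f'"
    using pf fm by (auto simp: admissible_def)
  have incf: "\<bar>pint k f f' w (T m) - pint k f f' w (real (R m) + 1)\<bar> = 1" for m
  proof -
    have e: "f x = g m x \<and> f' x = g' m x" if x: "real (R m) \<le> x" "x \<le> T m + 1" for x
    proof -
      have o: "g n x = 0 \<and> g' n x = 0" if "n \<noteq> m" for n
      proof (cases "n < m")
        case True
        then have "real (R (Suc n)) \<le> real (R m)" by (intro Rle) auto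
        with step[of n] x supp[of x n] show ?thesis by auto
      next
        case False
        with that have "real (R (Suc m)) \<le> real (R n)" by (intro Rle) auto
        with step[of m] x supp[of x n] show ?thesis by auto
      qed
      define M where "M = max (N x) (Suc m)"
      have "f x = F M x" "f' x = F' M x" using stab[of x M] by (auto simp: M_def)
      moreover have "F M x = g m x"
        unfolding F_def using o by (subst sum.remove[of _ m]) (auto simp: M_def)
      moreover have "F' M x = g' m x"
        unfolding F'_def using o by (subst sum.remove[of _ m]) (auto simp: M_def)
      ultimately show ?thesis by simp
    qed
    have "pint k f f' w (T m) - pint k f f' w (real (R m) + 1)
        = pint k (g m) (g' m) w (T m) - pint k (g m) (g' m) w (real (R m) + 1)"
      by (rule pint_diff_cong[OF adf adg w]) (use T[of m] e in auto)
    then show ?thesis using inc[of m] by simp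
  qed
  have "\<not> converges (pint k f f' w)"
  proof
    assume "converges (pint k f f' w)"
    then obtain l where l: "(pint k f f' w \<longlongrightarrow> l) at_top" by blast
    then have "eventually (\<lambda>T. dist (pint k f f' w T) l < 1/2) at_top"
      by (rule tendstoD) simp
    then obtain B where B: "\<And>T. T \<ge> B \<Longrightarrow> dist (pint k f f' w T) l < 1/2"
      by (auto simp: eventually_at_top_linorder)
    \<comment> \<open>Beyond \<open>B\<close> two values of a convergent integral differ by less
      than 1, but hump number \<open>m\<close> lies beyond \<open>B\<close> and produces a
      difference of exactly 1.\<close>
    define m where "m = nat \<lceil>B\<rceil>"
    have "B \<le> real m" unfolding m_def by linarith
    then have "B \<le> real (R m) + 1" "B \<le> T m" using Rge[of m] T[of m] by linarith+
    with B[of "real (R m) + 1"] B[of "T m"] incf[of m] show False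
      unfolding dist_real_def by linarith
  qed
  with adf show ?thesis by blast
qed

definition divergent :: "nat \<Rightarrow> (real \<Rightarrow> real) \<Rightarrow> bool" where
  "divergent k w \<longleftrightarrow> (\<exists>f f'. admissible k f f' \<and> \<not> converges (pint k f f' w))"

text \<open>Nonconvergence of one integral depends on the whole path and is not an open condition.
  The right-hand side is a countable intersection, over natural \<open>R\<close> and
  \<open>C\<close>, of conditions that are open in \<open>w\<close>; this is the form in which
  measurability can be shown.\<close>

lemma divergent_iff_unbounded:
  assumes w: "cpath w"
  shows "divergent k w \<longleftrightarrow> (\<forall>(R::nat) (C::nat). \<exists>T>real R. \<exists>f f'. admissible k f f' \<and>
        \<bar>pint k f f' w T - pint k f f' w (real R)\<bar> > real C * form_norm k f f')"
    (is "_ \<longleftrightarrow> ?U")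
proof
  assume ?U then show "divergent k w" unfolding divergent_def by (intro gliding_hump[OF w]) blast
next
  assume d: "divergent k w"
  show ?U
  proof (rule ccontr)
    assume "\<not> ?U"
    then obtain R C :: nat where "\<And>T g g'. T > real R \<Longrightarrow> admissible k g g' \<Longrightarrow>
       \<bar>pint k g g' w T - pint k g g' w (real R)\<bar> \<le> real C * form_norm k g g'"
      by (meson not_le)
    then have "converges (pint k f f' w)" if "admissible k f f'" for f f'
      by (intro pint_convergent_of_bound[OF w _ _ _ that, of "real R" "real C"]) auto
    with d show False by (auto simp: divergent_def)
  qed
qed

section \<open>The set of form values\<close>

lemma admissible_zero: "admissible k (\<lambda>x. 0) (\<lambda>x. 0)"
proof -
  obtain f f' where "admissible k f f'" using admissible_exists[of k] by blast
  from admissible_cmult[OF this, of 0] show ?thesis by simp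
qed

lemma pint_zero: "pint k (\<lambda>x. 0) (\<lambda>x. 0) w T = 0"
  by (simp add: pint_def stieltjes_def weight_def weight_deriv_def)

text \<open>Summation by parts: cutting off smoothly averages the partial integrals.\<close>
lemma pint_cutoff_average:
  assumes f: "admissible k f f'" and w: "cpath w" and b: "b \<ge> 0"
  shows "pint k (cut b f) (dcut b f f') w (b + 1)
     = (LBINT x:{b..b+1}. 2 * (1 - ramp b x) * pint k f f' w x)"
proof -
  let ?c = "\<lambda>x. 1 - ramp b x" and ?c' = "\<lambda>x. - indicator {b..b+1} x :: real"
  let ?P = "\<lambda>T. LBINT x:{0..T}. w x * weight_deriv k f f' x"
  let ?h = "\<lambda>x. (?c' x * ?c x + ?c x * ?c' x) * ?P x + (?c x * ?c x) * (w x * weight_deriv k f f' x)"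
  let ?g = "\<lambda>x. ?c x * f x" and ?g' = "\<lambda>x. ?c' x * f x + ?c x * f' x"
  have g: "admissible k ?g ?g'" by (rule admissible_one_minus_ramp[OF f])
  have p: "primitive (\<lambda>x. (?c x * ?c x) * ?P x) ?h"
    by (intro primitive_mult primitive_one_minus_ramp primitive_pint f w)
  have b1: "b + 1 \<ge> 0" using b by simp
  have c1: "?c (b + 1) = 0" by (simp add: ramp_def)
  have P0: "?P 0 = 0"
    using primitive_increment[OF primitive_pint[OF f w], of 0 0] by (simp add: atLeastAtMost_singleton)
  \<comment> \<open>\<open>?h\<close> is the derivative of the squared cut-off times
    \<open>?P\<close>, a product that vanishes at both ends of [0, b + 1]. Subtracting it leaves
    only the part supported on the ramp.\<close>
  have h0: "(LBINT x:{0..b+1}. ?h x) = 0"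
    using primitive_increment[OF p order.refl b1] c1 P0 by simp
  note hi = primitiveD(1)[OF p b1]
  have gi: "set_integrable lborel {0..b+1} (\<lambda>x. w x * weight_deriv k ?g ?g' x)"
    by (rule pint_integrable[OF g w])
  have "(LBINT x:{0..b+1}. w x * weight_deriv k ?g ?g' x) = (LBINT x:{0..b+1}. w x * weight_deriv k ?g ?g' x) - (LBINT x:{0..b+1}. ?h x)"
    using h0 by simp
  also have "\<dots> = (LBINT x:{0..b+1}. w x * weight_deriv k ?g ?g' x - ?h x)"
    using gi hi by (simp add: set_integral_diff)
  also have "\<dots> = (LBINT x:{0..b+1}. - (indicator {b..b+1} x * (2 * ?c x * pint k f f' w x)))"
    by (intro set_lebesgue_integral_cong allI impI)
      (auto simp: weight_deriv_def weight_def pint_def stieltjes_def power2_eq_square algebra_simps indicator_def)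
  also have "\<dots> = - (LBINT x:{b..b+1}. 2 * ?c x * pint k f f' w x)"
  proof -
    have "(\<lambda>x. indicator {0..b+1} x *\<^sub>R - (indicator {b..b+1} x * (2 * ?c x * pint k f f' w x)))
       = (\<lambda>x. - (indicator {b..b+1} x *\<^sub>R (2 * ?c x * pint k f f' w x)))"
      using b by (auto simp: indicator_def)
    then show ?thesis by (simp add: set_lebesgue_integral_def)
  qed
  finally show ?thesis
    using c1 by (simp add: pint_def stieltjes_def weight_def)
qed

text \<open>The averaging weight is minus the derivative of the squared cut-off, which drops from 1
  to 0 across the ramp.\<close>

lemma integral_cutoff_weight:
  assumes b: "b \<ge> 0"
  shows "(LBINT x:{b..b+1}. 2 * (1 - ramp b x)) = 1"
proof -
  let ?c = "\<lambda>x. 1 - ramp b x" and ?c' = "\<lambda>x. - indicator {b..b+1} x :: real"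
  have p: "primitive (\<lambda>x. ?c x * ?c x) (\<lambda>x. ?c' x * ?c x + ?c x * ?c' x)"
    by (intro primitive_mult primitive_one_minus_ramp)
  have "?c (b + 1) * ?c (b + 1) - ?c 0 * ?c 0 = (LBINT x:{0..b+1}. ?c' x * ?c x + ?c x * ?c' x)"
    by (rule primitive_increment[OF p]) (use b in auto)
  also have "\<dots> = - (LBINT x:{b..b+1}. 2 * ?c x)"
  proof -
    have "(\<lambda>x. indicator {0..b+1} x *\<^sub>R (?c' x * ?c x + ?c x * ?c' x))
       = (\<lambda>x. - (indicator {b..b+1} x *\<^sub>R (2 * ?c x)))"
      using b by (auto simp: indicator_def)
    then show ?thesis by (simp add: set_lebesgue_integral_def)
  qed
  finally show ?thesis using b by (simp add: ramp_def)
qed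

text \<open>The cut-off integral is a weighted mean, with total mass one, of partial integrals over
  [n, n + 1]; means of values that tend to \<open>l\<close> tend to \<open>l\<close>.\<close>

lemma pint_cutoff_tendsto:
  assumes f: "admissible k f f'" and w: "cpath w" and l: "(pint k f f' w \<longlongrightarrow> l) at_top"
  shows "(\<lambda>n. pint k (cut (real n) f)
     (dcut (real n) f f') w (real n + 1)) \<longlonglongrightarrow> l"
proof (rule LIMSEQ_I)
  fix e :: real assume e: "e > 0"
  have "eventually (\<lambda>T. dist (pint k f f' w T) l < e / 2) at_top"
    by (rule tendstoD[OF l]) (use e in simp)
  then obtain B where B: "\<And>T. T \<ge> B \<Longrightarrow> dist (pint k f f' w T) l < e / 2"
    by (auto simp: eventually_at_top_linorder)
  show "\<exists>no. \<forall>n\<ge>no. norm (pint k (cut (real n) f)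
     (dcut (real n) f f') w (real n + 1) - l) < e"
  proof (intro exI[of _ "nat \<lceil>B\<rceil>"] allI impI)
    fix n assume "n \<ge> nat \<lceil>B\<rceil>"
    then have n: "real n \<ge> B" by linarith
    let ?c = "\<lambda>x. 2 * (1 - ramp (real n) x)"
    have cc: "continuous_on {real n..real n + 1} ?c"
      unfolding ramp_def by (intro continuous_intros)
    have cJ: "continuous_on {real n..real n + 1} (pint k f f' w)"
      by (rule continuous_on_subset[OF continuous_on_pint[OF f w]]) auto
    have i1: "set_integrable lborel {real n..real n + 1} (\<lambda>x. ?c x * pint k f f' w x)"
      by (intro borel_integrable_atLeastAtMost' continuous_intros cJ) (simp add: ramp_def, intro continuous_intros)
    have i2: "set_integrable lborel {real n..real n + 1} ?c"
      by (intro borel_integrable_atLeastAtMost' cc)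
    have i3: "set_integrable lborel {real n..real n + 1} (\<lambda>x. l * ?c x)" using i2 by (rule set_integrable_mult_right)
    have i4: "set_integrable lborel {real n..real n + 1} (\<lambda>x. (e / 2) * ?c x)" using i2 by (rule set_integrable_mult_right)
    have "pint k (cut (real n) f)
     (dcut (real n) f f') w (real n + 1) - l
      = (LBINT x:{real n..real n+1}. ?c x * pint k f f' w x) - l * (LBINT x:{real n..real n+1}. ?c x)"
      by (subst pint_cutoff_average[OF f w]) (simp_all only: integral_cutoff_weight[OF of_nat_0_le_iff] mult_1_right of_nat_0_le_iff)
    also have "\<dots> = (LBINT x:{real n..real n+1}. ?c x * pint k f f' w x - l * ?c x)"
      using set_integral_diff(2)[OF i1 i3] by simp
    finally have eq: "pint k (cut (real n) f)
     (dcut (real n) f f') w (real n + 1) - l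
      = (LBINT x:{real n..real n+1}. ?c x * pint k f f' w x - l * ?c x)" .
    have "\<bar>LBINT x:{real n..real n+1}. ?c x * pint k f f' w x - l * ?c x\<bar>
       \<le> (LBINT x:{real n..real n+1}. \<bar>?c x * pint k f f' w x - l * ?c x\<bar>)"
      using set_integral_norm_bound[OF set_integral_diff(1)[OF i1 i3]] by simp
    also have "\<dots> \<le> (LBINT x:{real n..real n+1}. (e / 2) * ?c x)"
    proof (rule set_integral_mono[OF set_integrable_abs[OF set_integral_diff(1)[OF i1 i3]] i4])
      fix x assume x: "x \<in> {real n..real n + 1}"
      have "\<bar>?c x * pint k f f' w x - l * ?c x\<bar> = \<bar>?c x * (pint k f f' w x - l)\<bar>"
        by (rule arg_cong[where f=abs]) (simp add: algebra_simps)
      also have "\<dots> = ?c x * \<bar>pint k f f' w x - l\<bar>"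
        using ramp_bounds[of "real n" x] by (simp add: abs_mult)
      also have "\<dots> \<le> ?c x * (e / 2)"
        using B[of x] x n ramp_bounds[of "real n" x] by (intro mult_left_mono) (auto simp: dist_real_def)
      finally show "\<bar>?c x * pint k f f' w x - l * ?c x\<bar> \<le> (e / 2) * ?c x" by (simp only: mult.commute)
    qed
    also have "\<dots> = (e / 2) * (LBINT x:{real n..real n+1}. ?c x)" by (rule set_integral_mult_right)
    also have "\<dots> = e / 2" by (subst integral_cutoff_weight) simp_all
    also have "\<dots> < e" using e by simp
    finally show "norm (pint k (cut (real n) f)
     (dcut (real n) f f') w (real n + 1) - l) < e"
      unfolding eq by simp
  qed
qed

lemma cutoff_energy_tendsto:
  assumes f: "admissible k f f'"
  shows "(\<lambda>n. energy k (cut (real n) f)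
     (dcut (real n) f f')) \<longlonglongrightarrow> energy k f f'"
    and "(\<lambda>n. sqnorm (cut (real n) f)) \<longlonglongrightarrow> sqnorm f"
proof -
  let ?g = "\<lambda>n x. (1 - ramp (real n) x) * f x"
  let ?g' = "\<lambda>n x. - indicator {real n..real n+1} x * f x + (1 - ramp (real n) x) * f' x"
  have g: "admissible k (?g n) (?g' n)" for n by (rule admissible_one_minus_ramp[OF f])
  have i: "integrable lborel (\<lambda>x. 3 * (edens k f f' x + (f x)\<^sup>2))"
    using admissible_integrable_form_norm[OF f] by (rule integrable_mult_right)
  have ev: "eventually (\<lambda>n. ?g n x = f x \<and> ?g' n x = f' x) sequentially" for x
    using eventually_gt_at_top[of "nat \<lceil>x\<rceil>"]
  proof eventually_elim
    case (elim n) then have "x < real n" by linarith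
    then show ?case by (auto simp: ramp_def)
  qed
  have bd: "edens k (?g n) (?g' n) x + (?g n x)\<^sup>2 \<le> 3 * (edens k f f' x + (f x)\<^sup>2)" for n x
    using cutoff_density_le[of "1 - ramp (real n) x" "- indicator {real n..real n + 1} x" x k "f x" "f' x"]
        ramp_bounds[of "real n" x] by (simp add: edens_def indicator_def)
  show "(\<lambda>n. energy k (?g n) (?g' n)) \<longlonglongrightarrow> energy k f f'"
    unfolding energy_def
  proof (rule integral_dominated_convergence[OF _ _ i])
    show "AE x in lborel. (\<lambda>n. edens k (?g n) (?g' n) x) \<longlonglongrightarrow> edens k f f' x"
    proof (rule AE_I2)
      fix x
      have "eventually (\<lambda>n. edens k (?g n) (?g' n) x = edens k f f' x) sequentially"
        using ev[of x] by eventually_elim (simp only: edens_def)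
      then show "(\<lambda>n. edens k (?g n) (?g' n) x) \<longlonglongrightarrow> edens k f f' x" by (rule tendsto_eventually)
    qed
    show "AE x in lborel. norm (edens k (?g n) (?g' n) x) \<le> 3 * (edens k f f' x + (f x)\<^sup>2)" for n
    proof (rule AE_I2)
      fix x
      show "norm (edens k (?g n) (?g' n) x) \<le> 3 * (edens k f f' x + (f x)\<^sup>2)"
        using bd[of n x] zero_le_power2[of "?g n x"]
        unfolding real_norm_def abs_of_nonneg[OF edens_nonneg] by linarith
    qed
  qed (use admissibleD(6)[OF f] admissibleD(6)[OF g] in auto)
  show "(\<lambda>n. sqnorm (?g n)) \<longlonglongrightarrow> sqnorm f"
    unfolding sqnorm_def
  proof (rule integral_dominated_convergence[OF _ _ i])
    show "AE x in lborel. (\<lambda>n. (?g n x)\<^sup>2) \<longlonglongrightarrow> (f x)\<^sup>2"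
    proof (rule AE_I2)
      fix x
      have "eventually (\<lambda>n. (?g n x)\<^sup>2 = (f x)\<^sup>2) sequentially"
        using ev[of x] by eventually_elim (simp only:)
      then show "(\<lambda>n. (?g n x)\<^sup>2) \<longlonglongrightarrow> (f x)\<^sup>2" by (rule tendsto_eventually)
    qed
    show "AE x in lborel. norm ((?g n x)\<^sup>2) \<le> 3 * (edens k f f' x + (f x)\<^sup>2)" for n
    proof (rule AE_I2)
      fix x
      show "norm ((?g n x)\<^sup>2) \<le> 3 * (edens k f f' x + (f x)\<^sup>2)"
        using bd[of n x] edens_nonneg[of k "?g n" "?g' n" x] zero_le_power2[of "?g n x"]
        unfolding real_norm_def abs_of_nonneg[OF zero_le_power2] by linarith
    qed
  qed (use admissible_integrable_square[OF f] admissible_integrable_square[OF g] in auto)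
qed

text \<open>Restricted to compactly supported test functions: their partial integral is final at
  \<open>R\<close>, so the inequality involves the path on [0, R] only and survives small uniform
  perturbations.\<close>

definition attains :: "real \<Rightarrow> nat \<Rightarrow> real \<Rightarrow> (real \<Rightarrow> real) \<Rightarrow> bool" where
  "attains \<beta> k t w \<longleftrightarrow> (\<exists>f f' R. R \<ge> 0 \<and> admissible k f f' \<and> sqnorm f = 1 \<and>
     (\<forall>x\<ge>R. f x = 0) \<and> (\<forall>x>R. f' x = 0) \<and> 2 / sqrt \<beta> * pint k f f' w R - energy k f f' > t)"

lemma normalise:
  assumes f: "admissible k f f'" and n: "sqnorm f > 0"
  shows "\<exists>c. c \<noteq> 0 \<and> c\<^sup>2 = 1 / sqnorm f \<and> admissible k (\<lambda>x. c * f x) (\<lambda>x. c * f' x) \<and> sqnorm (\<lambda>x. c * f x) = 1"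
proof (intro exI conjI)
  show c: "(1 / sqrt (sqnorm f))\<^sup>2 = 1 / sqnorm f" using n by (simp add: power_divide)
  show "sqnorm (\<lambda>x. 1 / sqrt (sqnorm f) * f x) = 1" unfolding sqnorm_cmult c using n by simp
  show "admissible k (\<lambda>x. 1 / sqrt (sqnorm f) * f x) (\<lambda>x. 1 / sqrt (sqnorm f) * f' x)"
    by (rule admissible_cmult[OF f])
qed (use n in simp)

text \<open>A strict inequality survives cutting off far enough out and renormalising, so compactly
  supported test functions see every genuine value.\<close>

lemma attains_of_convergent:
  assumes f: "admissible k f f'" and w: "cpath w" and l: "(pint k f f' w \<longlongrightarrow> l) at_top"
    and n: "sqnorm f = 1" and t: "2 / sqrt \<beta> * l - energy k f f' > t"
  shows "attains \<beta> k t w"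
proof -
  let ?g = "\<lambda>n x. (1 - ramp (real n) x) * f x"
  let ?g' = "\<lambda>n x. - indicator {real n..real n+1} x * f x + (1 - ramp (real n) x) * f' x"
  have g: "admissible k (?g n) (?g' n)" for n by (rule admissible_one_minus_ramp[OF f])
  \<comment> \<open>The cut-off changes the L2 norm, so the limit is taken for the quotient by
    \<open>sqnorm\<close>, which is invariant under scaling of the test function.\<close>
  have "(\<lambda>n. (2 / sqrt \<beta> * pint k (?g n) (?g' n) w (real n + 1) - energy k (?g n) (?g' n)) / sqnorm (?g n))
     \<longlonglongrightarrow> (2 / sqrt \<beta> * l - energy k f f') / sqnorm f"
    by (intro tendsto_intros pint_cutoff_tendsto[OF f w l] cutoff_energy_tendsto[OF f]) (simp add: n)
  then have e1: "eventually (\<lambda>n. (2 / sqrt \<beta> * pint k (?g n) (?g' n) w (real n + 1) - energy k (?g n) (?g' n)) / sqnorm (?g n) > t) sequentially"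
    by (rule order_tendstoD) (use t n in simp)
  have e2: "eventually (\<lambda>n. sqnorm (?g n) > 0) sequentially"
    by (rule order_tendstoD(1)[OF cutoff_energy_tendsto(2)[OF f]]) (use n in simp)
  obtain n where n1: "(2 / sqrt \<beta> * pint k (?g n) (?g' n) w (real n + 1) - energy k (?g n) (?g' n)) / sqnorm (?g n) > t"
    and n2: "sqnorm (?g n) > 0"
    using eventually_happens[OF eventually_conj[OF e1 e2]] by auto
  obtain c where c: "c\<^sup>2 = 1 / sqnorm (?g n)" "admissible k (\<lambda>x. c * ?g n x) (\<lambda>x. c * ?g' n x)"
    "sqnorm (\<lambda>x. c * ?g n x) = 1"
    using normalise[OF g n2] by blast
  show ?thesis
    unfolding attains_def
  proof (rule exI[of _ "\<lambda>x. c * ?g n x"], rule exI[of _ "\<lambda>x. c * ?g' n x"], rule exI[of _ "real n + 1"],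
      intro conjI c(2,3) allI impI)
    fix x assume "x \<ge> real n + 1" then show "c * ?g n x = 0" by (simp add: ramp_def)
  next
    fix x assume "x > real n + 1" then show "c * ?g' n x = 0" by (simp add: ramp_def)
  next
    show "2 / sqrt \<beta> * pint k (\<lambda>x. c * ?g n x) (\<lambda>x. c * ?g' n x) w (real n + 1) - energy k (\<lambda>x. c * ?g n x) (\<lambda>x. c * ?g' n x) > t"
      unfolding pint_cmult energy_cmult c(1) using n1 by (simp add: field_simps diff_divide_distrib)
  qed simp
qed

lemma compact_support_convergent:
  assumes f: "admissible k f f'" and w: "cpath w" and R: "R \<ge> 0"
    and z: "\<And>x. x \<ge> R \<Longrightarrow> f x = 0" "\<And>x. x > R \<Longrightarrow> f' x = 0"
  shows "(pint k f f' w \<longlongrightarrow> pint k f f' w R) at_top"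
proof (rule tendsto_eventually)
  show "eventually (\<lambda>T. pint k f f' w T = pint k f f' w R) at_top"
    using eventually_ge_at_top[of R]
  proof eventually_elim
    case (elim T)
    have "pint k f f' w T - pint k f f' w R = pint k (\<lambda>x. 0) (\<lambda>x. 0) w T - pint k (\<lambda>x. 0) (\<lambda>x. 0) w R"
      by (rule pint_diff_cong[OF f admissible_zero w R elim]) (use z in auto)
    then show ?case by (simp add: pint_zero)
  qed
qed

text \<open>The quadratic form is a polynomial along lines, so by the parallelogram identity one of
  \<open>h + c g\<close> and \<open>h - c g\<close> diverges whenever \<open>g\<close> does.\<close>
lemma divergent_dense:
  assumes w: "cpath w" and d: "divergent k w"
    and h: "admissible k h h'" "sqnorm h = 1" "energy k h h' < e"
  shows "\<exists>f f'. admissible k f f' \<and> sqnorm f = 1 \<and> energy k f f' < e \<and> \<not> converges (pint k f f' w)"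
proof (cases "converges (pint k h h' w)")
  case False with h show ?thesis by blast
next
  case True
  then obtain lh where lh: "(pint k h h' w \<longlongrightarrow> lh) at_top" by blast
  obtain g g' where g: "admissible k g g'" and ng: "\<not> converges (pint k g g' w)"
    using d unfolding divergent_def by blast
  define f where "f c x = h x + c * g x" for c x
  define f' where "f' c x = h' x + c * g' x" for c x
  have af: "admissible k (f c) (f' c)" for c
    unfolding f_def[abs_def] f'_def[abs_def] by (intro admissible_add admissible_cmult h g)
  \<comment> \<open>Polarisation: the linear coefficient of this polynomial in \<open>c\<close> is
    read off from its value at \<open>c = 1\<close>.\<close>
  have E: "energy k (f c) (f' c) = energy k h h' + c * (energy k (f 1) (f' 1) - energy k h h' - energy k g g') + c\<^sup>2 * energy k g g'" for c
  proof -
    have "edens k (f c) (f' c) = (\<lambda>x. edens k h h' x + (c * (edens k (f 1) (f' 1) x - edens k h h' x - edens k g g' x) + c\<^sup>2 * edens k g g' x))"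
      by (rule ext) (simp add: edens_def f_def f'_def power2_eq_square algebra_simps)
    then show ?thesis
      unfolding energy_def using admissibleD(6)[OF af[of 1]] admissibleD(6)[OF h(1)] admissibleD(6)[OF g]
      by (simp add: algebra_simps)
  qed
  have N: "sqnorm (f c) = sqnorm h + c * (sqnorm (f 1) - sqnorm h - sqnorm g) + c\<^sup>2 * sqnorm g" for c
  proof -
    have "(f c x)\<^sup>2 = (h x)\<^sup>2 + (c * ((f 1 x)\<^sup>2 - (h x)\<^sup>2 - (g x)\<^sup>2) + c\<^sup>2 * (g x)\<^sup>2)" for x
      by (simp add: f_def power2_eq_square algebra_simps)
    then show ?thesis
      unfolding sqnorm_def using admissible_integrable_square[OF af[of 1]] admissible_integrable_square[OF h(1)]
        admissible_integrable_square[OF g]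
      by simp
  qed
  have lN: "((\<lambda>c. sqnorm (f c)) \<longlongrightarrow> sqnorm h + 0 * (sqnorm (f 1) - sqnorm h - sqnorm g) + 0\<^sup>2 * sqnorm g) (at 0)"
    by (rule tendsto_cong[THEN iffD2, OF always_eventually[OF allI[OF N]]]) (intro tendsto_intros)
  have lE: "((\<lambda>c. energy k (f c) (f' c)) \<longlongrightarrow> energy k h h' + 0 * (energy k (f 1) (f' 1) - energy k h h' - energy k g g') + 0\<^sup>2 * energy k g g') (at 0)"
    by (rule tendsto_cong[THEN iffD2, OF always_eventually[OF allI[OF E]]]) (intro tendsto_intros)
  have e1: "eventually (\<lambda>c. sqnorm (f c) > 0) (at 0)"
    by (rule order_tendstoD(1)[OF lN]) (use h in simp)
  have "((\<lambda>c. energy k (f c) (f' c) / sqnorm (f c)) \<longlongrightarrow> energy k h h' / sqnorm h) (at 0)"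
    using tendsto_divide[OF lE lN] h(2) by simp
  then have e2: "eventually (\<lambda>c. energy k (f c) (f' c) / sqnorm (f c) < e) (at 0)"
    by (rule order_tendstoD(2)) (use h in simp)
  obtain r where r: "r > 0" and P: "\<And>c. c \<noteq> 0 \<Longrightarrow> \<bar>c\<bar> < r \<Longrightarrow> sqnorm (f c) > 0 \<and> energy k (f c) (f' c) / sqnorm (f c) < e"
    using eventually_conj[OF e1 e2] unfolding eventually_at by (auto simp: dist_real_def)
  define c where "c = r / 2"
  have c: "c \<noteq> 0" "\<bar>c\<bar> < r" using r by (auto simp: c_def)
  have "\<not> (converges (pint k (f c) (f' c) w) \<and> (\<exists>l. (pint k (f (- c)) (f' (- c)) w \<longlongrightarrow> l) at_top))"
  proof
    assume "converges (pint k (f c) (f' c) w) \<and> (\<exists>l. (pint k (f (- c)) (f' (- c)) w \<longlongrightarrow> l) at_top)"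
    then obtain l1 l2 where l: "(pint k (f c) (f' c) w \<longlongrightarrow> l1) at_top" "(pint k (f (- c)) (f' (- c)) w \<longlongrightarrow> l2) at_top"
      by blast
    have "pint k (f c) (f' c) w T + pint k (f (- c)) (f' (- c)) w T = 2 * pint k h h' w T + 2 * c\<^sup>2 * pint k g g' w T" for T
      unfolding f_def[abs_def] f'_def[abs_def] by (rule pint_parallelogram[OF h(1) g w])
    then have "pint k g g' w T = (pint k (f c) (f' c) w T + pint k (f (- c)) (f' (- c)) w T - 2 * pint k h h' w T) / (2 * c\<^sup>2)" for T
      using c by (simp add: field_simps)
    then have eqg: "pint k g g' w = (\<lambda>T. (pint k (f c) (f' c) w T + pint k (f (- c)) (f' (- c)) w T - 2 * pint k h h' w T) / (2 * c\<^sup>2))"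
      by (rule ext)
    have "((\<lambda>T. (pint k (f c) (f' c) w T + pint k (f (- c)) (f' (- c)) w T - 2 * pint k h h' w T) / (2 * c\<^sup>2))
        \<longlongrightarrow> (l1 + l2 - 2 * lh) / (2 * c\<^sup>2)) at_top"
      by (intro tendsto_intros l lh) (use c in simp)
    then have "(pint k g g' w \<longlongrightarrow> (l1 + l2 - 2 * lh) / (2 * c\<^sup>2)) at_top" by (subst eqg)
    with ng show False by blast
  qed
  then obtain c0 where c0: "c0 \<noteq> 0" "\<bar>c0\<bar> < r" and nc: "\<not> converges (pint k (f c0) (f' c0) w)"
    using c by (metis abs_minus_cancel neg_equal_0_iff_equal)
  from P[OF c0] have n0: "sqnorm (f c0) > 0" and e0: "energy k (f c0) (f' c0) / sqnorm (f c0) < e" by auto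
  obtain b where b: "b \<noteq> 0" "b\<^sup>2 = 1 / sqnorm (f c0)" "admissible k (\<lambda>x. b * f c0 x) (\<lambda>x. b * f' c0 x)"
     "sqnorm (\<lambda>x. b * f c0 x) = 1"
    using normalise[OF af n0] by blast
  have "\<not> converges (pint k (\<lambda>x. b * f c0 x) (\<lambda>x. b * f' c0 x) w)"
  proof
    assume "converges (pint k (\<lambda>x. b * f c0 x) (\<lambda>x. b * f' c0 x) w)"
    then obtain l where l: "(pint k (\<lambda>x. b * f c0 x) (\<lambda>x. b * f' c0 x) w \<longlongrightarrow> l) at_top" by blast
    have "((\<lambda>T. (1 / b\<^sup>2) * pint k (\<lambda>x. b * f c0 x) (\<lambda>x. b * f' c0 x) w T) \<longlongrightarrow> (1 / b\<^sup>2) * l) at_top"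
      by (intro tendsto_intros l)
    then have "(pint k (f c0) (f' c0) w \<longlongrightarrow> (1 / b\<^sup>2) * l) at_top"
      unfolding pint_cmult using b(1) by simp
    with nc show False by blast
  qed
  moreover have "energy k (\<lambda>x. b * f c0 x) (\<lambda>x. b * f' c0 x) < e"
    unfolding energy_cmult b(2) using e0 by simp
  ultimately show ?thesis using b by blast
qed

text \<open>A nonexistent \<open>Lim\<close> is the same junk value for every integrand, so on a path with divergent
  integrals the set of form values acquires the extra values junk minus energy.\<close>
lemma Lim_nonconvergent:
  fixes J :: "real \<Rightarrow> real"
  assumes "\<not> (\<exists>l. (J \<longlongrightarrow> l) at_top)"
  shows "Lim at_top J = (THE l. False)"
proof -
  have "(\<lambda>l. (J \<longlongrightarrow> l) at_top) = (\<lambda>l. False)" using assms by auto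
  then show ?thesis unfolding Topological_Spaces.Lim_def by simp
qed

text \<open>Genuine and junk values are separated. \<open>?K\<close> does not mention the path, and
  on a divergent path every energy bound met by some normalised test function is also met by one
  whose integral diverges; hence the junk values contribute exactly \<open>divergent\<close> and a
  constant.\<close>

lemma form_vals_gt_iff:
  assumes w: "cpath w"
  shows "(\<exists>v\<in>form_vals \<beta> k w. v > t) \<longleftrightarrow> attains \<beta> k t w \<or>
     (divergent k w \<and> (\<exists>h h'. admissible k h h' \<and> sqnorm h = 1 \<and> 2 / sqrt \<beta> * (THE l. False) - energy k h h' > t))"
    (is "_ \<longleftrightarrow> _ \<or> (_ \<and> ?K)")
proof
  assume "\<exists>v\<in>form_vals \<beta> k w. v > t"
  then obtain f f' where f: "admissible k f f'" "sqnorm f = 1"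
    and t: "2 / sqrt \<beta> * Lim at_top (pint k f f' w) - energy k f f' > t"
    by (auto simp: form_vals_def)
  show "attains \<beta> k t w \<or> (divergent k w \<and> ?K)"
  proof (cases "converges (pint k f f' w)")
    case True
    then obtain l where l: "(pint k f f' w \<longlongrightarrow> l) at_top" by blast
    then have "Lim at_top (pint k f f' w) = l" by (intro tendsto_Lim) auto
    with attains_of_convergent[OF f(1) w l f(2)] t show ?thesis by simp
  next
    case False
    with t f have ?K unfolding Lim_nonconvergent[OF False] by blast
    with False f show ?thesis unfolding divergent_def by blast
  qed
next
  assume "attains \<beta> k t w \<or> (divergent k w \<and> ?K)"
  then show "\<exists>v\<in>form_vals \<beta> k w. v > t"
  proof
    assume "attains \<beta> k t w"
    then obtain f f' R where f: "R \<ge> 0" "admissible k f f'" "sqnorm f = 1" "\<forall>x\<ge>R. f x = 0" "\<forall>x>R. f' x = 0"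
      and t: "2 / sqrt \<beta> * pint k f f' w R - energy k f f' > t"
      unfolding attains_def by blast
    have "(pint k f f' w \<longlongrightarrow> pint k f f' w R) at_top"
      using f by (intro compact_support_convergent[OF _ w]) auto
    then have "Lim at_top (pint k f f' w) = pint k f f' w R" by (intro tendsto_Lim) auto
    with t have "2 / sqrt \<beta> * Lim at_top (pint k f f' w) - energy k f f' > t" by simp
    with f show ?thesis unfolding form_vals_def by blast
  next
    assume "divergent k w \<and> ?K"
    then obtain h h' where d: "divergent k w" and h: "admissible k h h'" "sqnorm h = 1"
      and t: "energy k h h' < 2 / sqrt \<beta> * (THE l. False) - t" by (auto simp: less_diff_eq add.commute)
    obtain f f' where f: "admissible k f f'" "sqnorm f = 1" and e: "energy k f f' < 2 / sqrt \<beta> * (THE l. False) - t"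
      and n: "\<not> converges (pint k f f' w)"
      using divergent_dense[OF w d h t] by blast
    have "2 / sqrt \<beta> * Lim at_top (pint k f f' w) - energy k f f' > t"
      unfolding Lim_nonconvergent[OF n] using e by simp
    with f show ?thesis unfolding form_vals_def by blast
  qed
qed

lemma form_vals_nonempty: "form_vals \<beta> k w \<noteq> {}"
proof -
  obtain f f' where "admissible k f f'" "sqnorm f = 1" using admissible_exists[of k] by blast
  then show ?thesis unfolding form_vals_def by blast
qed

text \<open>Without upper bounds the \<open>Least\<close> that defines the supremum has no
  candidate, so all unbounded sets share one unspecified real number.\<close>

lemma Sup_unbounded:
  fixes X :: "real set"
  assumes "\<not> bdd_above X"
  shows "Sup X = (THE x. False)"
proof -
  have e: "(\<lambda>z. \<forall>x\<in>X. x \<le> z) = (\<lambda>z. False)" using assms unfolding bdd_above_def by (intro ext) blast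
  show ?thesis unfolding Sup_real_def e Least_def by simp
qed

text \<open>Boundedness is tested against natural numbers, so that countably many events of the kind
  "some value exceeds a threshold" suffice, on every path.\<close>

lemma Sup_form_vals_gt_iff:
  "Sup (form_vals \<beta> k w) > t \<longleftrightarrow>
     (\<exists>n::nat. \<not> (\<exists>v\<in>form_vals \<beta> k w. v > real n)) \<and> (\<exists>v\<in>form_vals \<beta> k w. v > t) \<or>
     (\<forall>n::nat. \<exists>v\<in>form_vals \<beta> k w. v > real n) \<and> (THE x::real. False) > t"
proof (cases "bdd_above (form_vals \<beta> k w)")
  case True
  then obtain M where M: "\<And>v. v \<in> form_vals \<beta> k w \<Longrightarrow> v \<le> M" by (auto simp: bdd_above_def)
  obtain n :: nat where "M \<le> real n" using real_arch_simple by blast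
  with M have "\<not> (\<exists>v\<in>form_vals \<beta> k w. v > real n)" by force
  moreover have "Sup (form_vals \<beta> k w) > t \<longleftrightarrow> (\<exists>v\<in>form_vals \<beta> k w. v > t)"
    by (rule less_cSup_iff[OF form_vals_nonempty True])
  ultimately show ?thesis by blast
next
  case False
  then have "\<forall>n::nat. \<exists>v\<in>form_vals \<beta> k w. v > real n"
    by (meson bdd_aboveI not_le)
  with Sup_unbounded[OF False] show ?thesis by auto
qed

section \<open>Measurability on path space\<close>

abbreviation path_space :: "(real \<Rightarrow> real) measure" where
  "path_space \<equiv> PiM {0..} (\<lambda>_. borel)"

text \<open>Since the probability space need not be complete, \<open>Q\<close> has to agree with a measurable set on
  every continuous path and not just on almost every one.\<close>
definition path_event :: "((real \<Rightarrow> real) \<Rightarrow> bool) \<Rightarrow> bool" where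
  "path_event Q \<longleftrightarrow> (\<exists>A\<in>sets path_space.
     \<forall>w. cpath w \<longrightarrow> (Q w \<longleftrightarrow> restrict w {0..} \<in> A))"

lemma restrict_in_path_space: "restrict w {0..} \<in> space path_space"
  by (simp add: space_PiM)

lemma path_event_const: "path_event (\<lambda>w. c)"
proof (cases c)
  case True
  then show ?thesis
    unfolding path_event_def
    by (intro bexI[of _ "space path_space"]) (auto simp: restrict_in_path_space)
next
  case False
  then show ?thesis unfolding path_event_def by (intro bexI[of _ "{}"]) auto
qed

lemma path_event_not:
  assumes "path_event Q"
  shows "path_event (\<lambda>w. \<not> Q w)"
proof -
  obtain A where A: "A \<in> sets path_space"
    "\<And>w. cpath w \<Longrightarrow> Q w \<longleftrightarrow> restrict w {0..} \<in> A"
    using assms unfolding path_event_def by blast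
  then show ?thesis
    unfolding path_event_def
    by (intro bexI[of _ "space path_space - A"]) (auto simp: restrict_in_path_space)
qed

lemma path_event_ex:
  fixes Q :: "'c::countable \<Rightarrow> _"
  assumes "\<And>n. path_event (Q n)"
  shows "path_event (\<lambda>w. \<exists>n. Q n w)"
proof -
  have "\<forall>n. \<exists>A. A \<in> sets path_space \<and>
    (\<forall>w. cpath w \<longrightarrow> (Q n w \<longleftrightarrow> restrict w {0..} \<in> A))"
    using assms unfolding path_event_def by blast
  then obtain A where "\<And>n. A n \<in> sets path_space"
    "\<And>n w. cpath w \<Longrightarrow> Q n w \<longleftrightarrow> restrict w {0..} \<in> A n"
    by metis
  then show ?thesis
    unfolding path_event_def by (intro bexI[of _ "\<Union>n. A n"]) auto
qed

lemma path_event_disj: "path_event P \<Longrightarrow> path_event Q \<Longrightarrow> path_event (\<lambda>w. P w \<or> Q w)"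
  using path_event_ex[of "\<lambda>b. if b then P else Q"] by (simp add: ex_bool_eq)

lemma path_event_conj: "path_event P \<Longrightarrow> path_event Q \<Longrightarrow> path_event (\<lambda>w. P w \<and> Q w)"
  using path_event_not[OF path_event_disj[OF path_event_not path_event_not, of P Q]] by simp

lemma path_event_all:
  fixes Q :: "'c::countable \<Rightarrow> _"
  assumes "\<And>n. path_event (Q n)"
  shows "path_event (\<lambda>w. \<forall>n. Q n w)"
  using path_event_not[OF path_event_ex[of "\<lambda>n w. \<not> Q n w"]] path_event_not[OF assms] by simp

lemma path_event_cong:
  assumes "\<And>w. cpath w \<Longrightarrow> P w \<longleftrightarrow> Q w"
  shows "path_event P \<longleftrightarrow> path_event Q"
  unfolding path_event_def using assms by auto

lemma continuous_le_of_Rats: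
  fixes h :: "real \<Rightarrow> real"
  assumes h: "continuous_on {0..real n} h" and n: "n > 0"
    and le: "\<And>x. x \<in> \<rat> \<Longrightarrow> 0 \<le> x \<Longrightarrow> x \<le> real n \<Longrightarrow> \<bar>h x\<bar> \<le> c"
    and x: "0 \<le> x" "x \<le> real n"
  shows "\<bar>h x\<bar> \<le> c"
proof -
  have cl: "closure ({0<..<real n} \<inter> \<rat>) = {0..real n}"
    using closure_open_Int_superset[of "{0<..<real n}" "\<rat>"] n by (simp add: Rats_closure_real closure_greaterThanLessThan)
  have "norm (h x) \<le> c"
    by (rule continuous_on_closure_norm_le[of "{0<..<real n} \<inter> \<rat>"]) (use cl h le x in auto)
  then show ?thesis by simp
qed

definition gridpt :: "nat \<Rightarrow> real \<Rightarrow> real" where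
  "gridpt M x = real (nat \<lfloor>x * real M\<rfloor>) / real M"

lemma gridpt:
  assumes "M > 0" "0 \<le> x"
  shows "0 \<le> gridpt M x" "gridpt M x \<le> x" "x - gridpt M x \<le> 1 / real M"
proof -
  have a: "real (nat \<lfloor>x * real M\<rfloor>) \<le> x * real M" "x * real M \<le> real (nat \<lfloor>x * real M\<rfloor>) + 1"
    using assms by (auto simp: of_nat_nat)
  show "0 \<le> gridpt M x" by (simp add: gridpt_def)
  show "gridpt M x \<le> x" using a assms by (simp add: gridpt_def field_simps)
  have "x - gridpt M x = (x * real M - real (nat \<lfloor>x * real M\<rfloor>)) / real M"
    using assms by (simp add: gridpt_def diff_divide_distrib)
  also have "\<dots> \<le> 1 / real M" using a by (intro divide_right_mono) linarith+
  finally show "x - gridpt M x \<le> 1 / real M" .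
qed

text \<open>Sets of paths that are open for locally uniform convergence are measurable: a path is
  recovered, up to its oscillation, from finitely many grid values, and the possible vectors of
  grid values form an open set.\<close>
lemma path_event_open:
  assumes op: "\<And>w. cpath w \<Longrightarrow> Q w \<Longrightarrow>
     \<exists>(n::nat) e. e > 0 \<and> (\<forall>v. cpath v \<and> (\<forall>x\<in>{0..real n}. \<bar>v x - w x\<bar> \<le> e) \<longrightarrow> Q v)"
  shows "path_event Q"
proof -
  let ?P = path_space
  \<comment> \<open>Only rational points are tested, which makes this a countable condition on
    coordinates; continuity extends it to all points.\<close>
  define osc where "osc M n j w \<longleftrightarrow>
     (\<forall>x\<in>\<rat> \<inter> {0..real n}. \<bar>w x - w (gridpt M x)\<bar> \<le> 1 / real j)" for M n j and w :: "real \<Rightarrow> real"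
  define good where "good M n j w \<longleftrightarrow> cpath w \<and> osc M n j w \<and>
     (\<forall>v. cpath v \<and> (\<forall>x\<in>{0..real n}. \<bar>v x - w x\<bar> \<le> 3 / real j) \<longrightarrow> Q v)"
     for M n j and w :: "real \<Rightarrow> real"
  \<comment> \<open>The union over reference paths is uncountable, but it is a union of open sets of
    real sequences, and open sets for the product topology on countably many coordinates are
    Borel.\<close>
  define V where "V M n j = (\<Union>w\<in>{w. good M n j w}.
      {z :: nat \<Rightarrow> real. \<forall>i\<le>n * M. \<bar>z i - w (real i / real M)\<bar> < 1 / real j})" for M n j
  define A where "A M n j = {w\<in>space ?P. osc M n j w \<and> (\<lambda>i. w (real i / real M)) \<in> V M n j}" for M n j
  have coord: "(\<lambda>w. w x) \<in> borel_measurable ?P" if "x \<ge> 0" for x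
    using that by (intro measurable_component_singleton) auto
  have opV: "open (V M n j)" for M n j
    unfolding V_def
  proof (intro open_UN ballI)
    fix w :: "real \<Rightarrow> real"
    have "{z :: nat \<Rightarrow> real. \<forall>i\<le>n * M. \<bar>z i - w (real i / real M)\<bar> < 1 / real j}
       = (\<Inter>i\<in>{..n * M}. {z. \<bar>z i - w (real i / real M)\<bar> < 1 / real j})" by auto
    also have "open \<dots>"
      by (intro open_INT ballI open_Collect_less continuous_intros continuous_on_product_coordinates) auto
    finally show "open {z :: nat \<Rightarrow> real. \<forall>i\<le>n * M. \<bar>z i - w (real i / real M)\<bar> < 1 / real j}" .
  qed
  have mA: "A M n j \<in> sets ?P" if M: "M > 0" for M n j
  proof -
    have "{w\<in>space ?P. osc M n j w} \<in> sets ?P"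
      unfolding osc_def
    proof (rule sets.sets_Collect_countable_All')
      show "countable (\<rat> \<inter> {0..real n})" by (intro countable_Int1 countable_rat)
      fix x assume x: "x \<in> \<rat> \<inter> {0..real n}"
      then have [measurable]: "(\<lambda>w. w x) \<in> borel_measurable ?P" "(\<lambda>w. w (gridpt M x)) \<in> borel_measurable ?P"
        using gridpt(1)[OF M] by (auto intro!: coord)
      show "{w\<in>space ?P. \<bar>w x - w (gridpt M x)\<bar> \<le> 1 / real j} \<in> sets ?P" by measurable
    qed
    moreover have "{w\<in>space ?P. (\<lambda>i. w (real i / real M)) \<in> V M n j} \<in> sets ?P"
    proof -
      have "(\<lambda>w i. w (real i / real M)) \<in> borel_measurable ?P"
        by (intro measurable_coordinatewise_then_product coord) auto
      from measurable_sets[OF this, of "V M n j"] opV show ?thesis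
        by (simp add: vimage_def Int_def conj_commute)
    qed
    ultimately have "{w\<in>space ?P. osc M n j w} \<inter> {w\<in>space ?P. (\<lambda>i. w (real i / real M)) \<in> V M n j} \<in> sets ?P"
      by (rule sets.Int)
    moreover have "A M n j = {w\<in>space ?P. osc M n j w} \<inter> {w\<in>space ?P. (\<lambda>i. w (real i / real M)) \<in> V M n j}"
      by (auto simp: A_def)
    ultimately show ?thesis by simp
  qed
  \<comment> \<open>The successors keep mesh, horizon and tolerance positive.\<close>
  let ?A = "\<Union>M. \<Union>n. \<Union>j. A (Suc M) (Suc n) (Suc j)"
  have "?A \<in> sets ?P" using mA by auto
  moreover have "Q w \<longleftrightarrow> restrict w {0..} \<in> ?A" if w: "cpath w" for w
  proof
    assume "Q w"
    from op[OF w this] obtain n :: nat and e where e: "e > 0"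
      and n: "\<And>v. cpath v \<Longrightarrow> (\<And>x. x \<in> {0..real n} \<Longrightarrow> \<bar>v x - w x\<bar> \<le> e) \<Longrightarrow> Q v"
      by blast
    obtain j where j: "3 / e < real (Suc j)" by (metis reals_Archimedean2 less_trans of_nat_less_iff lessI)
    then have j': "3 / real (Suc j) \<le> e" using e by (simp add: field_simps)
    have "uniformly_continuous_on {0..real (Suc n)} w"
      by (intro compact_uniformly_continuous continuous_on_subset[OF w]) auto
    then obtain d where d: "d > 0" and dd: "\<And>x y. x \<in> {0..real (Suc n)} \<Longrightarrow> y \<in> {0..real (Suc n)} \<Longrightarrow>
        dist x y < d \<Longrightarrow> dist (w x) (w y) < 1 / real (Suc j)"
      unfolding uniformly_continuous_on_def by (metis divide_pos_pos of_nat_0_less_iff zero_less_Suc zero_less_one)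
    obtain M where M: "1 / d < real (Suc M)" by (metis reals_Archimedean2 less_trans of_nat_less_iff lessI)
    then have M': "1 / real (Suc M) < d" using d by (simp add: field_simps)
    have o: "osc (Suc M) (Suc n) (Suc j) w"
      unfolding osc_def
    proof
      fix x assume x: "x \<in> \<rat> \<inter> {0..real (Suc n)}"
      note g = gridpt[of "Suc M" x]
      have "dist (w x) (w (gridpt (Suc M) x)) < 1 / real (Suc j)"
        by (rule dd) (use x g M' in \<open>auto simp: dist_real_def\<close>)
      then show "\<bar>w x - w (gridpt (Suc M) x)\<bar> \<le> 1 / real (Suc j)" by (simp add: dist_real_def)
    qed
    \<comment> \<open>The path is its own reference path.\<close>
    have "good (Suc M) (Suc n) (Suc j) w"
      unfolding good_def
    proof (intro conjI w o allI impI)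
      fix v assume v: "cpath v \<and> (\<forall>x\<in>{0..real (Suc n)}. \<bar>v x - w x\<bar> \<le> 3 / real (Suc j))"
      have "\<bar>v x - w x\<bar> \<le> e" if "x \<in> {0..real n}" for x
      proof -
        have "\<bar>v x - w x\<bar> \<le> 3 / real (Suc j)" using v that by auto
        with j' show ?thesis by linarith
      qed
      then show "Q v" using n[of v] v by blast
    qed
    then have "(\<lambda>i. w (real i / real (Suc M))) \<in> V (Suc M) (Suc n) (Suc j)"
      unfolding V_def by (intro UN_I[of w]) auto
    moreover have "osc (Suc M) (Suc n) (Suc j) (restrict w {0..})"
      using o gridpt(1)[of "Suc M"] unfolding osc_def by auto
    moreover have "(\<lambda>i. restrict w {0..} (real i / real (Suc M))) = (\<lambda>i. w (real i / real (Suc M)))" by auto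
    ultimately have "restrict w {0..} \<in> A (Suc M) (Suc n) (Suc j)"
      unfolding A_def by (simp add: restrict_in_path_space del: of_nat_Suc)
    then show "restrict w {0..} \<in> ?A" by blast
  next
    assume "restrict w {0..} \<in> ?A"
    then obtain M n j where a: "restrict w {0..} \<in> A (Suc M) (Suc n) (Suc j)" by blast
    have eq: "(\<lambda>i. restrict w {0..} (real i / real (Suc M))) = (\<lambda>i. w (real i / real (Suc M)))" by auto
    have o: "osc (Suc M) (Suc n) (Suc j) w"
      using a gridpt(1)[of "Suc M"] unfolding A_def osc_def by auto
    from a obtain w0 where g: "good (Suc M) (Suc n) (Suc j) w0"
      and z: "\<And>i. i \<le> Suc n * Suc M \<Longrightarrow> \<bar>w (real i / real (Suc M)) - w0 (real i / real (Suc M))\<bar> < 1 / real (Suc j)"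
      unfolding A_def mem_Collect_eq eq unfolding V_def by blast
    have w0: "cpath w0" using g by (simp add: good_def)
    \<comment> \<open>Three errors of size 1/j: from \<open>x\<close> to its grid point along
      \<open>w\<close>, between the two paths at the grid point, and back to \<open>x\<close> along
      \<open>w0\<close>. This explains the 3 in \<open>good\<close>.\<close>
    have "\<bar>w x - w0 x\<bar> \<le> 3 / real (Suc j)" if x: "0 \<le> x" "x \<le> real (Suc n)" for x
    proof (rule continuous_le_of_Rats[where h="\<lambda>x. w x - w0 x", OF _ _ _ x])
      show "continuous_on {0..real (Suc n)} (\<lambda>x. w x - w0 x)"
        by (intro continuous_intros continuous_on_subset[OF w] continuous_on_subset[OF w0]) auto
      fix x assume x: "x \<in> \<rat>" "0 \<le> x" "x \<le> real (Suc n)"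
      have 1: "\<bar>w x - w (gridpt (Suc M) x)\<bar> \<le> 1 / real (Suc j)" using o x unfolding osc_def by auto
      have 2: "\<bar>w0 x - w0 (gridpt (Suc M) x)\<bar> \<le> 1 / real (Suc j)" using g x unfolding good_def osc_def by auto
      have "x * real (Suc M) \<le> real (Suc n) * real (Suc M)" using x by (intro mult_right_mono) auto
      then have "real_of_int \<lfloor>x * real (Suc M)\<rfloor> \<le> real (Suc n * Suc M)"
        using of_int_floor_le[of "x * real (Suc M)"] by (simp only: of_nat_mult)
      then have "nat \<lfloor>x * real (Suc M)\<rfloor> \<le> Suc n * Suc M"
        by linarith
      from z[OF this] have 3: "\<bar>w (gridpt (Suc M) x) - w0 (gridpt (Suc M) x)\<bar> < 1 / real (Suc j)"
        by (simp only: gridpt_def)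
      show "\<bar>w x - w0 x\<bar> \<le> 3 / real (Suc j)" using 1 2 3 by linarith
    qed simp
    with g w show "Q w" unfolding good_def by auto
  qed
  ultimately show ?thesis unfolding path_event_def by blast
qed

text \<open>Integration by parts has moved the differential off the path, so the truncated integral
  is Lipschitz for the uniform distance on [0, T], with the total variation of the weight in the
  constant.\<close>

lemma pint_lipschitz:
  assumes f: "admissible k f f'" and w: "cpath w" and v: "cpath v"
    and T: "T \<ge> 0" and e: "\<And>x. x \<in> {0..T} \<Longrightarrow> \<bar>v x - w x\<bar> \<le> e"
  shows "\<bar>pint k f f' v T - pint k f f' w T\<bar> \<le> e * (\<bar>weight k f T\<bar> + (LBINT x:{0..T}. \<bar>weight_deriv k f f' x\<bar>))"
proof -
  note iv = pint_integrable[OF f v, of T] and iw = pint_integrable[OF f w, of T]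
  have i: "set_integrable lborel {0..T} (\<lambda>x. \<bar>weight_deriv k f f' x\<bar>)"
    by (rule set_integrable_abs[OF primitiveD(1)[OF primitive_weight[OF f] T]])
  have d: "(LBINT x:{0..T}. v x * weight_deriv k f f' x) - (LBINT x:{0..T}. w x * weight_deriv k f f' x)
     = (LBINT x:{0..T}. v x * weight_deriv k f f' x - w x * weight_deriv k f f' x)"
    using set_integral_diff(2)[OF iv iw] by simp
  have "\<bar>LBINT x:{0..T}. v x * weight_deriv k f f' x - w x * weight_deriv k f f' x\<bar>
      \<le> (LBINT x:{0..T}. \<bar>v x * weight_deriv k f f' x - w x * weight_deriv k f f' x\<bar>)"
    using set_integral_norm_bound[OF set_integral_diff(1)[OF iv iw]] by simp
  also have "\<dots> \<le> (LBINT x:{0..T}. e * \<bar>weight_deriv k f f' x\<bar>)"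
  proof (rule set_integral_mono[OF set_integrable_abs[OF set_integral_diff(1)[OF iv iw]] set_integrable_mult_right[OF i]])
    fix x assume x: "x \<in> {0..T}"
    have "\<bar>v x * weight_deriv k f f' x - w x * weight_deriv k f f' x\<bar> = \<bar>v x - w x\<bar> * \<bar>weight_deriv k f f' x\<bar>"
      by (simp add: algebra_simps flip: abs_mult)
    also have "\<dots> \<le> e * \<bar>weight_deriv k f f' x\<bar>" using e[OF x] by (intro mult_right_mono) auto
    finally show "\<bar>v x * weight_deriv k f f' x - w x * weight_deriv k f f' x\<bar> \<le> e * \<bar>weight_deriv k f f' x\<bar>" .
  qed
  also have "\<dots> = e * (LBINT x:{0..T}. \<bar>weight_deriv k f f' x\<bar>)" by (rule set_integral_mult_right)
  finally have 1: "\<bar>(LBINT x:{0..T}. v x * weight_deriv k f f' x) - (LBINT x:{0..T}. w x * weight_deriv k f f' x)\<bar>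
     \<le> e * (LBINT x:{0..T}. \<bar>weight_deriv k f f' x\<bar>)" unfolding d .
  have "\<bar>weight k f T * v T - weight k f T * w T\<bar> = \<bar>v T - w T\<bar> * \<bar>weight k f T\<bar>"
    by (simp add: algebra_simps flip: abs_mult)
  also have "\<dots> \<le> e * \<bar>weight k f T\<bar>" using e[of T] T by (intro mult_right_mono) auto
  finally have 2: "\<bar>weight k f T * v T - weight k f T * w T\<bar> \<le> e * \<bar>weight k f T\<bar>" .
  show ?thesis using 1 2 unfolding pint_def stieltjes_def distrib_left by linarith
qed

lemma small_positive:
  fixes K d :: real
  assumes "d > 0"
  shows "\<exists>e>0. e * K < d"
proof -
  have "d / (\<bar>K\<bar> + 1) * K \<le> d / (\<bar>K\<bar> + 1) * \<bar>K\<bar>" using assms by (intro mult_left_mono) auto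
  also have "\<dots> < d" using assms by (simp add: field_simps)
  finally show ?thesis using assms by (intro exI[of _ "d / (\<bar>K\<bar> + 1)"]) auto
qed

lemma pint_locally_uniform:
  assumes f: "admissible k f f'" and w: "cpath w" and T: "T \<ge> 0" and d: "d > 0"
  shows "\<exists>e>0. \<forall>v. cpath v \<and> (\<forall>x\<in>{0..T}. \<bar>v x - w x\<bar> \<le> e) \<longrightarrow>
     \<bar>pint k f f' v T - pint k f f' w T\<bar> < d"
proof -
  obtain e where e: "e > 0" "e * (\<bar>weight k f T\<bar> + (LBINT x:{0..T}. \<bar>weight_deriv k f f' x\<bar>)) < d"
    using small_positive[OF d] by blast
  then show ?thesis
    by (intro exI[of _ e] conjI allI impI le_less_trans[OF pint_lipschitz[OF f w _ T] e(2)]) auto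
qed

lemma path_event_attains:
  assumes \<beta>: "\<beta> > 0"
  shows "path_event (attains \<beta> k t)"
proof (rule path_event_open)
  fix w assume w: "cpath w" and "attains \<beta> k t w"
  then obtain f f' R where f: "R \<ge> 0" "admissible k f f'" "sqnorm f = 1" "\<forall>x\<ge>R. f x = 0" "\<forall>x>R. f' x = 0"
      and t: "2 / sqrt \<beta> * pint k f f' w R - energy k f f' > t"
    unfolding attains_def by blast
  define d where "d = (2 / sqrt \<beta> * pint k f f' w R - energy k f f' - t) / (2 / sqrt \<beta>)"
  have d: "d > 0" using t \<beta> by (simp add: d_def)
  obtain e where e: "e > 0" and E: "\<And>v. cpath v \<Longrightarrow> (\<forall>x\<in>{0..R}. \<bar>v x - w x\<bar> \<le> e) \<Longrightarrow>
     \<bar>pint k f f' v R - pint k f f' w R\<bar> < d"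
    using pint_locally_uniform[OF f(2) w f(1) d] by blast
  show "\<exists>(n::nat) e. e > 0 \<and> (\<forall>v. cpath v \<and> (\<forall>x\<in>{0..real n}. \<bar>v x - w x\<bar> \<le> e) \<longrightarrow> attains \<beta> k t v)"
  proof (intro exI[of _ "nat \<lceil>R\<rceil>"] exI[of _ e] conjI e allI impI)
    fix v assume v: "cpath v \<and> (\<forall>x\<in>{0..real (nat \<lceil>R\<rceil>)}. \<bar>v x - w x\<bar> \<le> e)"
    have "\<forall>x\<in>{0..R}. \<bar>v x - w x\<bar> \<le> e"
    proof
      fix x assume "x \<in> {0..R}"
      then have "x \<in> {0..real (nat \<lceil>R\<rceil>)}" unfolding atLeastAtMost_iff by linarith
      with v show "\<bar>v x - w x\<bar> \<le> e" by blast
    qed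
    from E[OF conjunct1[OF v] this] have "pint k f f' w R - pint k f f' v R < d" by linarith
    then have "2 / sqrt \<beta> * (pint k f f' w R - pint k f f' v R) < 2 / sqrt \<beta> * d"
      using \<beta> by (intro mult_strict_left_mono) auto
    also have "\<dots> = 2 / sqrt \<beta> * pint k f f' w R - energy k f f' - t" using \<beta> by (simp add: d_def)
    finally have "2 / sqrt \<beta> * pint k f f' v R - energy k f f' > t" by (simp only: right_diff_distrib)
    with f show "attains \<beta> k t v" unfolding attains_def by blast
  qed
qed

lemma path_event_divergent: "path_event (divergent k)"
proof -
  define Q where "Q R C w \<longleftrightarrow> (\<exists>T>real R. \<exists>f f'. admissible k f f' \<and>
        \<bar>pint k f f' w T - pint k f f' w (real R)\<bar> > real C * form_norm k f f')" for R C :: nat and w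
  have "path_event (Q R C)" for R C
  proof (rule path_event_open)
    fix w assume w: "cpath w" and "Q R C w"
    then obtain T f f' where T: "T > real R" and f: "admissible k f f'"
      and big: "\<bar>pint k f f' w T - pint k f f' w (real R)\<bar> > real C * form_norm k f f'"
      unfolding Q_def by blast
    \<comment> \<open>Half of the gap, as both end points of the increment may move.\<close>
    define d where "d = (\<bar>pint k f f' w T - pint k f f' w (real R)\<bar> - real C * form_norm k f f') / 2"
    have d: "d > 0" using big by (simp add: d_def)
    have T0: "T \<ge> 0" using T by simp
    obtain e1 where e1: "e1 > 0" and E1: "\<And>v. cpath v \<Longrightarrow> (\<forall>x\<in>{0..T}. \<bar>v x - w x\<bar> \<le> e1) \<Longrightarrow>
       \<bar>pint k f f' v T - pint k f f' w T\<bar> < d"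
      using pint_locally_uniform[OF f w T0 d] by blast
    obtain e2 where e2: "e2 > 0" and E2: "\<And>v. cpath v \<Longrightarrow> (\<forall>x\<in>{0..real R}. \<bar>v x - w x\<bar> \<le> e2) \<Longrightarrow>
       \<bar>pint k f f' v (real R) - pint k f f' w (real R)\<bar> < d"
      using pint_locally_uniform[OF f w of_nat_0_le_iff d] by blast
    show "\<exists>(n::nat) e. e > 0 \<and> (\<forall>v. cpath v \<and> (\<forall>x\<in>{0..real n}. \<bar>v x - w x\<bar> \<le> e) \<longrightarrow> Q R C v)"
    proof (intro exI[of _ "nat \<lceil>T\<rceil>"] exI[of _ "min e1 e2"] conjI allI impI)
      fix v assume v: "cpath v \<and> (\<forall>x\<in>{0..real (nat \<lceil>T\<rceil>)}. \<bar>v x - w x\<bar> \<le> min e1 e2)"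
      have le: "\<bar>v x - w x\<bar> \<le> min e1 e2" if "0 \<le> x" "x \<le> T" for x
      proof -
        have "x \<in> {0..real (nat \<lceil>T\<rceil>)}" using that unfolding atLeastAtMost_iff by linarith
        with v show ?thesis by blast
      qed
      have "\<bar>pint k f f' v T - pint k f f' w T\<bar> < d"
        by (rule E1) (use v le in auto)
      moreover have "\<bar>pint k f f' v (real R) - pint k f f' w (real R)\<bar> < d"
        by (rule E2) (use v le T in force)+
      ultimately have "\<bar>pint k f f' v T - pint k f f' v (real R)\<bar> > real C * form_norm k f f'"
      proof -
        assume *: "\<bar>pint k f f' v T - pint k f f' w T\<bar> < d"
          "\<bar>pint k f f' v (real R) - pint k f f' w (real R)\<bar> < d"
        have "\<bar>pint k f f' w T - pint k f f' w (real R)\<bar> \<le> \<bar>pint k f f' v T - pint k f f' v (real R)\<bar>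
           + \<bar>pint k f f' v T - pint k f f' w T\<bar> + \<bar>pint k f f' v (real R) - pint k f f' w (real R)\<bar>"
          by linarith
        also have "\<dots> < \<bar>pint k f f' v T - pint k f f' v (real R)\<bar> + d + d" using * by linarith
        finally show ?thesis by (simp add: d_def)
      qed
      with T f show "Q R C v" unfolding Q_def by blast
    qed (use e1 e2 in auto)
  qed
  then have "path_event (\<lambda>w. \<forall>R C. Q R C w)" by (intro path_event_all)
  moreover have "path_event (divergent k) \<longleftrightarrow> path_event (\<lambda>w. \<forall>R C. Q R C w)"
    by (rule path_event_cong) (simp add: divergent_iff_unbounded Q_def)
  ultimately show ?thesis by simp
qed

lemma path_event_Sup_form_vals:
  assumes \<beta>: "\<beta> > 0"
  shows "path_event (\<lambda>w. Sup (form_vals \<beta> k w) > t)"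
proof -
  have ex: "path_event (\<lambda>w. \<exists>v\<in>form_vals \<beta> k w. v > s)" for s
    by (subst path_event_cong[OF form_vals_gt_iff])
       (auto intro!: path_event_disj path_event_conj path_event_attains[OF \<beta>] path_event_divergent path_event_const)
  show ?thesis
    unfolding Sup_form_vals_gt_iff
    by (intro path_event_disj path_event_conj path_event_ex path_event_all path_event_not ex path_event_const)
qed

section \<open>Paths with small oscillation\<close>

text \<open>Unit-step oscillation of smaller order than sqrt x. Brownian paths satisfy this almost
  surely with room to spare, and sqrt x is the order at which the noise would compete with the whole
  potential.\<close>

definition tame :: "(real \<Rightarrow> real) \<Rightarrow> bool" where
  "tame w \<longleftrightarrow> cpath w \<and>
     (\<forall>e>0. \<exists>C\<ge>0. \<forall>x\<ge>0. \<forall>y\<in>{x..x+1}. \<bar>w y - w x\<bar> \<le> e * sqrt x + C)"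

text \<open>The approximation is the moving average of the path over a unit interval.\<close>
lemma tame_smoothing:
  assumes w: "tame w"
  obtains V V' where "primitive V V'" "continuous_on {0..} V" "continuous_on {0..} V'"
    "\<forall>e>0. \<exists>C\<ge>0. \<forall>x\<ge>0. \<bar>V' x\<bar> \<le> e * sqrt x + C \<and> \<bar>w x - V x\<bar> \<le> e * sqrt x + C"
proof -
  \<comment> \<open>The constant extension to the left, together with the base point -1 of
    \<open>P\<close>, makes the antiderivative differentiable from both sides at 0.\<close>
  define u where "u x = w (max 0 x)" for x
  have cw: "cpath w" using w by (simp add: tame_def)
  have cu: "continuous_on S u" for S
    unfolding u_def by (rule continuous_on_compose2[OF cw]) (auto intro!: continuous_intros)
  define P where "P x = integral {-1..x} u" for x
  have P: "(P has_real_derivative u x) (at x)" if "x \<ge> 0" for x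
  proof -
    have "(P has_real_derivative u x) (at x within {-1..x+1})"
      unfolding P_def by (rule integral_has_real_derivative[OF cu]) (use that in auto)
    moreover have "at x within {-1..x+1} = at x"
      by (rule at_within_interior) (use that in \<open>simp add: interior_atLeastAtMost_real\<close>)
    ultimately show ?thesis by simp
  qed
  define V where "V x = P (x + 1) - P x" for x
  define V' where "V' x = u (x + 1) - u x" for x
  have dV: "(V has_real_derivative V' x) (at x)" if "x \<ge> 0" for x
  proof -
    have "((\<lambda>x. P (x + 1)) has_real_derivative u (x + 1)) (at x)"
      using P[of "x + 1"] that by (simp add: DERIV_shift)
    then show ?thesis unfolding V_def[abs_def] V'_def using P[OF that] by (intro DERIV_diff)
  qed
  have cV': "continuous_on {0..} V'"
    unfolding V'_def
    by (intro continuous_on_diff cu continuous_on_compose2[OF cu[of UNIV]]) (auto intro!: continuous_intros)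
  have pV: "primitive V V'"
    by (rule primitive_derivI[OF _ cV']) (rule has_field_derivative_at_within[OF dV])
  \<comment> \<open>The average is attained by the path inside the interval, so the remainder
    \<open>w x - V x\<close> is itself an increment of \<open>w\<close> over at most one
    unit.\<close>
  have mv: "\<exists>y. x < y \<and> y < x + 1 \<and> V x = w y" if x: "x \<ge> 0" for x
  proof -
    have "\<exists>y>x. y < x + 1 \<and> P (x + 1) - P x = (x + 1 - x) * u y"
      by (rule MVT2) (use x P in auto)
    then show ?thesis using x by (auto simp: V_def u_def max_def)
  qed
  have est: "\<exists>C\<ge>0. \<forall>x\<ge>0. \<bar>V' x\<bar> \<le> e * sqrt x + C \<and> \<bar>w x - V x\<bar> \<le> e * sqrt x + C" if "e > 0" for e
  proof -
    have "\<exists>C\<ge>0. \<forall>x\<ge>0. \<forall>y\<in>{x..x+1}. \<bar>w y - w x\<bar> \<le> e * sqrt x + C"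
      using w that unfolding tame_def by simp
    then obtain C where C0: "C \<ge> 0" "\<forall>x\<ge>0. \<forall>y\<in>{x..x+1}. \<bar>w y - w x\<bar> \<le> e * sqrt x + C"
      by (elim exE conjE)
    have C: "C \<ge> 0" "\<bar>w y - w x\<bar> \<le> e * sqrt x + C" if "x \<ge> 0" "y \<in> {x..x+1}" for x y
      using C0 that by auto
    show ?thesis
    proof (intro exI[of _ C] conjI allI impI C0(1))
      fix x :: real assume x: "x \<ge> 0"
      show "\<bar>V' x\<bar> \<le> e * sqrt x + C" using C(2)[of x "x + 1"] x by (simp add: V'_def u_def)
      obtain y where "x < y" "y < x + 1" "V x = w y" using mv[OF x] by blast
      then show "\<bar>w x - V x\<bar> \<le> e * sqrt x + C" using C(2)[of x y] x by (simp add: abs_minus_commute)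
    qed
  qed
  show ?thesis by (rule that[OF pV primitive_continuous_on[OF pV] cV']) (use est in blast)
qed

text \<open>The square of \<open>f\<close> at \<open>T\<close> is compared with its value at each
  \<open>S\<close> in [T, T + 1] and averaged over \<open>S\<close>. The average costs one tail; the
  integral of 2 f f', with the weight attached to \<open>f\<close>, costs the other by 2ab \<le> a^2
  + b^2.\<close>

lemma boundary_tail_bound:
  assumes f: "admissible k f f'" and T: "T \<ge> 1"
  shows "T powr (pot_exp k / 2) * (f T)\<^sup>2 \<le> 2 * tail k f f' T"
proof -
  let ?q = "\<lambda>x. edens k f f' x + (f x)\<^sup>2"
  let ?tail = "LBINT x. indicator {T..} x * ?q x"
  note [measurable] = admissibleD(1,2)[OF f]
  have iq: "integrable lborel (\<lambda>x. indicator A x * ?q x)" if "A \<in> sets lborel" for A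
    using integrable_mult_indicator[OF that admissible_integrable_form_norm[OF f]] by simp
  have pf2: "primitive (\<lambda>x. f x * f x) (\<lambda>x. f' x * f x + f x * f' x)"
    by (intro primitive_mult admissibleD(5)[OF f])
  have step: "T powr (pot_exp k / 2) * (f T)\<^sup>2 - ?tail \<le> S powr pot_exp k * (f S)\<^sup>2" if S: "S \<in> {T..T+1}" for S
  proof -
    have "f S * f S - f T * f T = (LBINT x:{T..S}. f' x * f x + f x * f' x)"
      by (rule primitive_increment[OF pf2]) (use S T in auto)
    then have e1: "T powr (pot_exp k / 2) * (f T)\<^sup>2 = T powr (pot_exp k / 2) * (f S)\<^sup>2
       - T powr (pot_exp k / 2) * (LBINT x:{T..S}. f' x * f x + f x * f' x)"
      by (simp add: power2_eq_square algebra_simps)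
    have e2: "T powr (pot_exp k / 2) * (f S)\<^sup>2 \<le> S powr pot_exp k * (f S)\<^sup>2"
    proof (rule mult_right_mono)
      have "T powr (pot_exp k / 2) \<le> S powr (pot_exp k / 2)" using S T pot_exp_pos[of k] by (intro powr_mono2) auto
      also have "\<dots> \<le> S powr pot_exp k" using S T pot_exp_pos[of k] by (intro powr_mono) auto
      finally show "T powr (pot_exp k / 2) \<le> S powr pot_exp k" .
    qed simp
    have e3: "- (T powr (pot_exp k / 2) * (LBINT x:{T..S}. f' x * f x + f x * f' x)) \<le> ?tail"
    proof -
      have i1: "set_integrable lborel {T..S} (\<lambda>x. f' x * f x + f x * f' x)"
        by (rule set_integrable_subset[OF primitiveD(1)[OF pf2, of S]]) (use S T in auto)
      have "- (T powr (pot_exp k / 2) * (LBINT x:{T..S}. f' x * f x + f x * f' x))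
         = (LBINT x. - (T powr (pot_exp k / 2)) * (indicator {T..S} x * (f' x * f x + f x * f' x)))"
        unfolding integral_mult_right_zero set_lebesgue_integral_def by simp
      also have "\<dots> \<le> (LBINT x. indicator {T..} x * ?q x)"
      proof (rule integral_mono)
        show "integrable lborel (\<lambda>x. - (T powr (pot_exp k / 2)) * (indicator {T..S} x * (f' x * f x + f x * f' x)))"
          using i1 unfolding set_integrable_def by (intro integrable_mult_right) simp
        show "integrable lborel (\<lambda>x. indicator {T..} x * ?q x)" by (rule iq) simp
        fix x
        show "- (T powr (pot_exp k / 2)) * (indicator {T..S} x * (f' x * f x + f x * f' x)) \<le> indicator {T..} x * ?q x"
        proof (cases "x \<in> {T..S}")
          case True
          have "- (T powr (pot_exp k / 2)) * (f' x * f x + f x * f' x) \<le> \<bar>T powr (pot_exp k / 2) * (2 * f' x * f x)\<bar>"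
            by (simp add: algebra_simps)
          also have "\<dots> = 2 * \<bar>f' x\<bar> * (T powr (pot_exp k / 2) * \<bar>f x\<bar>)" by (simp add: abs_mult)
          also have "\<dots> \<le> 2 * \<bar>f' x\<bar> * (x powr (pot_exp k / 2) * \<bar>f x\<bar>)"
            using True T pot_exp_pos[of k] by (intro mult_left_mono mult_right_mono powr_mono2) auto
          also have "\<dots> \<le> \<bar>f' x\<bar>\<^sup>2 + (x powr (pot_exp k / 2) * \<bar>f x\<bar>)\<^sup>2" by (rule sum_squares_bound)
          also have "(x powr (pot_exp k / 2) * \<bar>f x\<bar>)\<^sup>2 = x powr pot_exp k * (f x)\<^sup>2"
          proof -
            have "(x powr (pot_exp k / 2))\<^sup>2 = x powr pot_exp k" by (simp add: power2_eq_square flip: powr_add)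
            then show ?thesis by (simp add: power_mult_distrib)
          qed
          finally have "- (T powr (pot_exp k / 2)) * (f' x * f x + f x * f' x) \<le> ?q x"
            using zero_le_power2[of "f x"] unfolding edens_def by (simp only: power2_abs)
          then show ?thesis using True by simp
        qed (auto simp: indicator_def edens_nonneg)
      qed
      finally show ?thesis .
    qed
    from e1 e2 e3 show ?thesis by linarith
  qed
  \<comment> \<open>A constant is rewritten as its integral over an interval of length one, so that
    \<open>step\<close> can be integrated in \<open>S\<close>.\<close>
  have "T powr (pot_exp k / 2) * (f T)\<^sup>2 - ?tail = (LBINT S. indicator {T..T+1} S * (T powr (pot_exp k / 2) * (f T)\<^sup>2 - ?tail))"
    by simp
  also have "\<dots> \<le> (LBINT S. indicator {T..} S * ?q S)"
  proof (rule integral_mono[OF integrable_indicator_Icc iq])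
    fix S
    show "indicator {T..T+1} S * (T powr (pot_exp k / 2) * (f T)\<^sup>2 - ?tail) \<le> indicator {T..} S * ?q S"
    proof (cases "S \<in> {T..T+1}")
      case True
      then show ?thesis using step[OF True] by (simp add: edens_def)
         (smt (verit) zero_le_power2)
    qed (auto simp: indicator_def edens_nonneg)
  qed simp
  finally show ?thesis by simp
qed

text \<open>A Hardy-type estimate, split at \<open>d\<close>: near the origin the square of
  \<open>f\<close> is at most \<open>x\<close> times the kinetic energy, beyond \<open>d\<close> the
  weight is bounded. The energy coefficient becomes arbitrarily small with \<open>d\<close>, at the
  price of more L2 norm.\<close>

lemma admissible_singular_weight:
  assumes f: "admissible k f f'" and d: "d > 0"
  shows "integrable lborel (\<lambda>x. (f x)\<^sup>2 * x powr (- (3/2)))"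
    and "(LBINT x. (f x)\<^sup>2 * x powr (- (3/2))) \<le> 2 * sqrt d * energy k f f' + d powr (- (3/2)) * sqnorm f"
proof -
  let ?A = "LBINT t. (f' t)\<^sup>2"
  note [measurable] = admissibleD(1,2)[OF f]
  let ?m = "\<lambda>x. ?A * (indicator {0..d} x * x powr (- (1/2))) + d powr (- (3/2)) * (f x)\<^sup>2"
  have A: "?A \<ge> 0" by (intro integral_nonneg_AE) simp
  have im: "integrable lborel ?m"
    using d by (intro Bochner_Integration.integrable_add integrable_mult_right integrable_inverse_sqrt(1)
        admissible_integrable_square[OF f]) auto
  have le: "(f x)\<^sup>2 * x powr (- (3/2)) \<le> ?m x" for x
  proof -
    consider "x \<le> 0" | "0 < x" "x \<le> d" | "x > d" by linarith
    then show ?thesis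
    proof cases
      case 1
      then show ?thesis using admissibleD(3)[OF f, of x] A by simp
    next
      case 2
      have "(f x)\<^sup>2 * x powr (- (3/2)) \<le> (x * ?A) * x powr (- (3/2))"
        using 2 by (intro mult_right_mono admissible_square_le[OF f]) auto
      also have "\<dots> = ?A * (x * x powr (- (3/2)))" by simp
      also have "x * x powr (- (3/2)) = x powr (- (1/2))" using 2 by (simp add: powr_mult_base)
      finally show ?thesis using 2 by (simp add: add_increasing2)
    next
      case 3
      have "(f x)\<^sup>2 * x powr (- (3/2)) \<le> (f x)\<^sup>2 * d powr (- (3/2))"
        using 3 d by (intro mult_left_mono powr_mono2') auto
      then show ?thesis using 3 by (simp add: mult.commute)
    qed
  qed
  show i: "integrable lborel (\<lambda>x. (f x)\<^sup>2 * x powr (- (3/2)))"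
    by (rule integrable_dominated[OF im]) (use le in simp_all)
  have "(LBINT x. (f x)\<^sup>2 * x powr (- (3/2))) \<le> (LBINT x. ?m x)" by (rule integral_mono[OF i im le])
  also have "\<dots> = ?A * (2 * sqrt d) + d powr (- (3/2)) * sqnorm f"
    using integrable_inverse_sqrt[of d] d admissible_integrable_square[OF f] by (simp add: sqnorm_def)
  also have "?A * (2 * sqrt d) \<le> energy k f f' * (2 * sqrt d)"
    using d integral_nonneg_AE[of "\<lambda>x. x powr pot_exp k * (f x)\<^sup>2" lborel]
    by (intro mult_right_mono) (auto simp: energy_split[OF f])
  finally show "(LBINT x. (f x)\<^sup>2 * x powr (- (3/2))) \<le> 2 * sqrt d * energy k f f' + d powr (- (3/2)) * sqnorm f"
    by (simp add: mult.commute mult.left_commute)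
qed

text \<open>Here \<open>y\<close> stands for the derivative of the smoothed path and
  \<open>z\<close> for the remainder. The growing parts \<open>e * sqrt x\<close> are charged to the
  energy, since x^(-2a) times x is the potential; the constant parts \<open>C\<close> go to the L2
  norm and the singular weight.\<close>

lemma tame_pointwise:
  fixes x y z g g' a e h C :: real
  assumes x: "x > 0" and a: "0 \<le> a" "a < 1/2" and h: "h > 0" and e: "e = h / 2" and C: "C \<ge> 0"
    and y: "\<bar>y\<bar> \<le> e * sqrt x + C" and z: "\<bar>z\<bar> \<le> e * sqrt x + C"
  shows "\<bar>g\<^sup>2 * x powr (- a) * y\<bar> + \<bar>z * (2 * g * g' * x powr (- a) - a * g\<^sup>2 * x powr (- a - 1))\<bar>
    \<le> h * (g'\<^sup>2 + x powr (1 - 2 * a) * g\<^sup>2) + (2 * e + 2 * C + 2 * C\<^sup>2 / h) * (g\<^sup>2 + g\<^sup>2 * x powr (- (3/2)))"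
proof -
  let ?W = "1 + x powr (- (3/2))"
  let ?B = "e * sqrt x + C"
  have e0: "e > 0" using e h by simp
  have B: "?B \<ge> 0" using e0 C x by simp
  have sq: "sqrt x = x powr (1/2)" using x by (simp add: powr_half_sqrt)
  have W1: "x powr (- a) \<le> ?W" "x powr (- (2 * a)) \<le> ?W" "x powr (- (a + 1)) \<le> ?W" "x powr (- (a + 1/2)) \<le> ?W"
    by (rule powr_minus_le_add; use x a in linarith)+
  have s1: "x powr (- a) * sqrt x \<le> x powr (1 - 2 * a) + ?W"
  proof -
    have "x powr (- a) * sqrt x = x powr ((1 - 2 * a) / 2)" unfolding sq by (simp flip: powr_add add: field_simps)
    also have "\<dots> \<le> x powr (1 - 2 * a) + 1"
    proof (cases "x \<ge> 1")
      case True
      have "x powr ((1 - 2 * a) / 2) \<le> x powr (1 - 2 * a)" using True a by (intro powr_mono) auto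
      then show ?thesis by simp
    next
      case False
      have "x powr ((1 - 2 * a) / 2) \<le> 1" using False x a by (intro powr_le1) auto
      then show ?thesis by (simp add: add_increasing)
    qed
    finally show ?thesis using powr_ge_zero[of x "- (3/2)"] by linarith
  qed
  have t1: "\<bar>g\<^sup>2 * x powr (- a) * y\<bar> \<le> g\<^sup>2 * (e * (x powr (1 - 2 * a) + ?W) + C * ?W)"
  proof -
    have "\<bar>g\<^sup>2 * x powr (- a) * y\<bar> = g\<^sup>2 * (x powr (- a) * \<bar>y\<bar>)" by (simp add: abs_mult)
    also have "\<dots> \<le> g\<^sup>2 * (x powr (- a) * ?B)" using y by (intro mult_left_mono) auto
    also have "x powr (- a) * ?B = e * (x powr (- a) * sqrt x) + C * x powr (- a)" by (simp add: algebra_simps)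
    also have "\<dots> \<le> e * (x powr (1 - 2 * a) + ?W) + C * ?W"
      using s1 W1 e0 C by (intro add_mono mult_left_mono) auto
    finally show ?thesis by (simp add: mult_left_mono)
  qed
  have t2: "\<bar>z * (2 * g * g' * x powr (- a))\<bar> \<le> h * g'\<^sup>2 + (2 * e\<^sup>2 / h) * (x powr (1 - 2 * a) * g\<^sup>2) + (2 * C\<^sup>2 / h) * (g\<^sup>2 * ?W)"
  proof -
    let ?b = "\<bar>g\<bar> * x powr (- a) * ?B"
    have "\<bar>z * (2 * g * g' * x powr (- a))\<bar> = 2 * \<bar>g'\<bar> * (\<bar>g\<bar> * x powr (- a) * \<bar>z\<bar>)" by (simp add: abs_mult)
    also have "\<dots> \<le> 2 * \<bar>g'\<bar> * ?b" using z by (intro mult_left_mono) auto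
    also have "\<dots> \<le> h * g'\<^sup>2 + ?b\<^sup>2 / h"
    proof -
      have "0 \<le> (h * \<bar>g'\<bar> - ?b)\<^sup>2 / h" using h by simp
      also have "\<dots> = h * g'\<^sup>2 - 2 * \<bar>g'\<bar> * ?b + ?b\<^sup>2 / h"
        using h by (simp add: power2_eq_square field_simps)
      finally show ?thesis by simp
    qed
    also have "?b\<^sup>2 / h \<le> (2 * e\<^sup>2 * (x powr (1 - 2 * a) * g\<^sup>2) + 2 * C\<^sup>2 * (g\<^sup>2 * ?W)) / h"
    proof (rule divide_right_mono)
      have xa: "(x powr (- a))\<^sup>2 = x powr (- (2 * a))" by (simp add: power2_eq_square flip: powr_add)
      have xb: "x powr (- (2 * a)) * x = x powr (1 - 2 * a)"
        using x powr_mult_base[of x "- (2 * a)"] by (simp add: mult.commute)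
      have "?B\<^sup>2 \<le> 2 * (e * sqrt x)\<^sup>2 + 2 * C\<^sup>2"
        using sum_squares_bound[of "e * sqrt x" C] by (simp add: power2_sum)
      also have "(e * sqrt x)\<^sup>2 = e\<^sup>2 * x" using x by (simp add: power_mult_distrib)
      finally have BB: "?B\<^sup>2 \<le> 2 * (e\<^sup>2 * x) + 2 * C\<^sup>2" .
      have "?b\<^sup>2 = g\<^sup>2 * x powr (- (2 * a)) * ?B\<^sup>2" by (simp add: power_mult_distrib xa)
      also have "\<dots> \<le> g\<^sup>2 * x powr (- (2 * a)) * (2 * (e\<^sup>2 * x) + 2 * C\<^sup>2)" using BB by (intro mult_left_mono) auto
      also have "\<dots> = 2 * e\<^sup>2 * ((x powr (- (2 * a)) * x) * g\<^sup>2) + 2 * C\<^sup>2 * (g\<^sup>2 * x powr (- (2 * a)))"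
        by (simp add: algebra_simps)
      also have "\<dots> \<le> 2 * e\<^sup>2 * (x powr (1 - 2 * a) * g\<^sup>2) + 2 * C\<^sup>2 * (g\<^sup>2 * ?W)"
        unfolding xb using W1 by (intro add_left_mono mult_left_mono) auto
      finally show "?b\<^sup>2 \<le> 2 * e\<^sup>2 * (x powr (1 - 2 * a) * g\<^sup>2) + 2 * C\<^sup>2 * (g\<^sup>2 * ?W)" .
    qed (use h in simp)
    finally show ?thesis by (simp add: add_divide_distrib)
  qed
  have t3: "\<bar>z * (a * g\<^sup>2 * x powr (- a - 1))\<bar> \<le> (e + C) * (g\<^sup>2 * ?W)"
  proof -
    have "\<bar>z * (a * g\<^sup>2 * x powr (- a - 1))\<bar> = a * (g\<^sup>2 * (x powr (- (a + 1)) * \<bar>z\<bar>))" using a by (simp add: abs_mult)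
    also have "\<dots> \<le> 1 * (g\<^sup>2 * (x powr (- (a + 1)) * \<bar>z\<bar>))" using a by (intro mult_right_mono) auto
    also have "\<dots> \<le> g\<^sup>2 * (x powr (- (a + 1)) * ?B)" using z by (simp add: mult_left_mono)
    also have "x powr (- (a + 1)) * ?B = e * (x powr (- (a + 1)) * sqrt x) + C * x powr (- (a + 1))" by (simp add: algebra_simps)
    also have "x powr (- (a + 1)) * sqrt x = x powr (- (a + 1/2))"
      unfolding sq powr_add[symmetric] by (rule arg_cong[where f="\<lambda>t. x powr t"]) simp
    also have "g\<^sup>2 * (e * x powr (- (a + 1/2)) + C * x powr (- (a + 1))) \<le> g\<^sup>2 * (e * ?W + C * ?W)"
      using W1 e0 C by (intro mult_left_mono add_mono) auto
    finally show ?thesis by (simp add: algebra_simps)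
  qed
  have "\<bar>z * (2 * g * g' * x powr (- a) - a * g\<^sup>2 * x powr (- a - 1))\<bar>
     \<le> \<bar>z * (2 * g * g' * x powr (- a))\<bar> + \<bar>z * (a * g\<^sup>2 * x powr (- a - 1))\<bar>"
    unfolding right_diff_distrib by (rule abs_triangle_ineq4)
  with t1 t2 t3 have "\<bar>g\<^sup>2 * x powr (- a) * y\<bar> + \<bar>z * (2 * g * g' * x powr (- a) - a * g\<^sup>2 * x powr (- a - 1))\<bar>
    \<le> g\<^sup>2 * (e * (x powr (1 - 2 * a) + ?W) + C * ?W) +
      (h * g'\<^sup>2 + (2 * e\<^sup>2 / h) * (x powr (1 - 2 * a) * g\<^sup>2) + (2 * C\<^sup>2 / h) * (g\<^sup>2 * ?W)) + (e + C) * (g\<^sup>2 * ?W)"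
    by linarith
  also have "\<dots> = h * g'\<^sup>2 + (e + 2 * e\<^sup>2 / h) * (x powr (1 - 2 * a) * g\<^sup>2) + (2 * e + 2 * C + 2 * C\<^sup>2 / h) * (g\<^sup>2 * ?W)"
    by (simp add: algebra_simps)
  \<comment> \<open>The choice \<open>e = h / 2\<close> is made for this: \<open>y\<close>
    contributes h/2 to the potential coefficient and \<open>z\<close> the other h/2.\<close>
  also have "e + 2 * e\<^sup>2 / h = h" using h e by (simp add: power2_eq_square field_simps)
  finally show ?thesis by (simp add: algebra_simps)
qed

text \<open>For the smooth part of the path integration by parts is undone and its bounded-growth
  derivative is used; for the small remainder it is kept. \<open>K\<close> is chosen before
  \<open>f\<close>, so one estimate gives both convergence and a bound uniform over the form
  domain.\<close>

lemma tame_pint: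
  assumes w: "tame w" and h: "h > 0"
  shows "\<exists>K\<ge>0. \<forall>f f'. admissible k f f' \<longrightarrow>
     (\<exists>l. (pint k f f' w \<longlongrightarrow> l) at_top \<and> \<bar>l\<bar> \<le> h * energy k f f' + K * sqnorm f)"
proof -
  have cw: "cpath w" using w by (simp add: tame_def)
  obtain V V' where pV: "primitive V V'" and cV: "continuous_on {0..} V" and cV': "continuous_on {0..} V'"
    and est: "\<forall>e>0. \<exists>C\<ge>0. \<forall>x\<ge>0. \<bar>V' x\<bar> \<le> e * sqrt x + C \<and> \<bar>w x - V x\<bar> \<le> e * sqrt x + C"
    by (rule tame_smoothing[OF w])
  define D where "D x = w x - V x" for x
  have cD: "continuous_on {0..} D" unfolding D_def by (intro continuous_intros cw cV)
  define h2 where "h2 = h / 2"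
  define e where "e = h2 / 2"
  have h2: "h2 > 0" and e: "e > 0" using h by (auto simp: h2_def e_def)
  obtain C where C: "C \<ge> 0" and Cb: "\<And>x. x \<ge> 0 \<Longrightarrow> \<bar>V' x\<bar> \<le> e * sqrt x + C \<and> \<bar>D x\<bar> \<le> e * sqrt x + C"
    using est[rule_format, OF e] unfolding D_def by (elim exE conjE) auto
  define K0 where "K0 = 2 * e + 2 * C + 2 * C\<^sup>2 / h2"
  have K0: "K0 > 0" using e C h2 by (simp add: K0_def add_pos_nonneg)
  \<comment> \<open>One half of \<open>h\<close> is spent in the pointwise bound; \<open>d\<close>
    makes the singular weight use up precisely the other half.\<close>
  define d where "d = (h2 / (2 * K0))\<^sup>2"
  have d: "d > 0" using h2 K0 by (simp add: d_def)
  have sd: "K0 * (2 * sqrt d) = h2" using h2 K0 by (simp add: d_def)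
  define K where "K = K0 * (1 + d powr (- (3/2)))"
  have K: "K \<ge> 0" using K0 by (simp add: K_def)
  have main: "\<exists>l. (pint k f f' w \<longlongrightarrow> l) at_top \<and> \<bar>l\<bar> \<le> h * energy k f f' + K * sqnorm f"
    if f: "admissible k f f'" for f f'
  proof -
    note [measurable] = admissibleD(1,2)[OF f]
    note pu = primitive_weight[OF f]
    let ?m = "\<lambda>x. h2 * edens k f f' x + K0 * ((f x)\<^sup>2 + (f x)\<^sup>2 * x powr (- (3/2)))"
    let ?s = "\<lambda>x. weight k f x * V' x - D x * weight_deriv k f f' x"
    have f0: "weight k f x = 0 \<and> weight_deriv k f f' x = 0" if "x \<le> 0" for x
      using admissibleD(3)[OF f that] by (simp add: weight_def weight_deriv_def)
    have im: "integrable lborel ?m"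
      by (intro Bochner_Integration.integrable_add integrable_mult_right admissibleD(6)[OF f]
          admissible_integrable_square[OF f] admissible_singular_weight(1)[OF f d])
    have m0: "?m x \<ge> 0" for x using h2 K0 by (simp add: edens_nonneg)
    have le: "\<bar>weight k f x * V' x\<bar> + \<bar>D x * weight_deriv k f f' x\<bar> \<le> ?m x" for x
    proof (cases "x > 0")
      case True
      then show ?thesis
        using tame_pointwise[OF True noise_exp_nonneg noise_exp_less h2 e_def C, of "V' x" "D x" "f x" k "f' x"] Cb[of x]
        by (simp add: weight_def weight_deriv_def edens_def pot_exp_noise_exp K0_def)
    next
      case False
      then show ?thesis using f0[of x] m0[of x] by simp
    qed
    have sle: "\<bar>?s x\<bar> \<le> ?m x" for x using le[of x] by linarith
    have meas: "(\<lambda>x. indicator {0..} x * ?s x) \<in> borel_measurable lborel"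
    proof -
      have [measurable]: "(\<lambda>x. indicator {0..} x * V' x) \<in> borel_measurable borel"
        "(\<lambda>x. indicator {0..} x * D x) \<in> borel_measurable borel"
        using borel_measurable_continuous_on_indicator[OF _ cV'] borel_measurable_continuous_on_indicator[OF _ cD]
        by auto
      have "(\<lambda>x. weight k f x * (indicator {0..} x * V' x) - (indicator {0..} x * D x) * weight_deriv k f f' x) \<in> borel_measurable lborel"
        unfolding weight_def weight_deriv_def by measurable
      then show ?thesis by (simp add: algebra_simps)
    qed
    have si: "set_integrable lborel {0..} ?s"
      unfolding set_integrable_def
    proof (rule integrable_dominated[OF im])
      show "(\<lambda>x. indicator {0..} x *\<^sub>R ?s x) \<in> borel_measurable lborel" using meas by simp
      fix x show "\<bar>indicator {0..} x *\<^sub>R ?s x\<bar> \<le> ?m x"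
        using sle[of x] m0[of x] by (cases "x \<ge> 0") (auto simp: indicator_def)
    qed
    \<comment> \<open>The product rule for \<open>weight k f\<close> and \<open>V\<close> cancels
      the boundary value of \<open>V\<close>, leaving only that of the remainder
      \<open>D\<close>.\<close>
    have decomp: "pint k f f' w T = weight k f T * D T + (LBINT x:{0..T}. ?s x)" if T: "T \<ge> 0" for T
    proof -
      have p: "primitive (\<lambda>x. weight k f x * V x) (\<lambda>x. weight_deriv k f f' x * V x + weight k f x * V' x)"
        by (rule primitive_mult[OF pu pV])
      have e1: "weight k f T * V T = (LBINT x:{0..T}. weight_deriv k f f' x * V x + weight k f x * V' x)"
        using primitive_increment[OF p order.refl T] f0[of 0] by simp
      note i1 = primitiveD(1)[OF p T] and i2 = pint_integrable[OF f cw, of T]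
      have "pint k f f' w T = weight k f T * D T + (weight k f T * V T - (LBINT x:{0..T}. w x * weight_deriv k f f' x))"
        by (simp add: pint_def stieltjes_def D_def algebra_simps)
      also have "weight k f T * V T - (LBINT x:{0..T}. w x * weight_deriv k f f' x)
         = (LBINT x:{0..T}. (weight_deriv k f f' x * V x + weight k f x * V' x) - w x * weight_deriv k f f' x)"
        unfolding e1 using set_integral_diff(2)[OF i1 i2] by simp
      also have "\<dots> = (LBINT x:{0..T}. ?s x)"
        by (intro set_lebesgue_integral_cong) (auto simp: D_def algebra_simps)
      finally show ?thesis .
    qed
    have lim1: "((\<lambda>T. LBINT x:{0..T}. ?s x) \<longlongrightarrow> (LBINT x:{0..}. ?s x)) at_top"
      by (rule tendsto_set_lebesgue_integral_at_top[OF _ si]) simp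
    \<comment> \<open>The remainder grows at most like sqrt T, which turns the weight
      \<open>T powr (- noise_exp k)\<close> into \<open>T powr (pot_exp k / 2)\<close>, the power
      controlled by the tail of the form norm.\<close>
    have lim2: "((\<lambda>T. weight k f T * D T) \<longlongrightarrow> 0) at_top"
    proof (rule Lim_null_comparison)
      show "((\<lambda>T. (e + C) * (2 * tail k f f' T)) \<longlongrightarrow> 0) at_top"
        using tendsto_mult_right_zero[OF tendsto_mult_right_zero[OF tail_form_norm_tendsto_0[OF f], of 2], of "e + C"] by simp
      show "\<forall>\<^sub>F T in at_top. norm (weight k f T * D T) \<le> (e + C) * (2 * tail k f f' T)"
        using eventually_ge_at_top[of 1]
      proof eventually_elim
        case (elim T)
        have sq: "sqrt T = T powr (1/2)" using elim by (simp add: powr_half_sqrt)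
        have "T powr (- noise_exp k) * \<bar>D T\<bar> \<le> T powr (- noise_exp k) * (e * sqrt T + C)"
          using Cb[of T] elim by (intro mult_left_mono) auto
        also have "\<dots> \<le> T powr (- noise_exp k) * (e * sqrt T + C * sqrt T)"
          using elim C by (intro mult_left_mono add_left_mono) (auto simp: mult_le_cancel_left1)
        also have "\<dots> = (e + C) * (T powr (- noise_exp k) * T powr (1/2))" unfolding sq by (simp add: algebra_simps)
        also have "T powr (- noise_exp k) * T powr (1/2) = T powr (pot_exp k / 2)"
          by (simp add: pot_exp_noise_exp field_simps flip: powr_add)
        finally have 1: "T powr (- noise_exp k) * \<bar>D T\<bar> \<le> (e + C) * T powr (pot_exp k / 2)" .
        have "norm (weight k f T * D T) = (f T)\<^sup>2 * (T powr (- noise_exp k) * \<bar>D T\<bar>)" by (simp add: weight_def abs_mult)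
        also have "\<dots> \<le> (f T)\<^sup>2 * ((e + C) * T powr (pot_exp k / 2))" using 1 by (intro mult_left_mono) auto
        also have "\<dots> = (e + C) * (T powr (pot_exp k / 2) * (f T)\<^sup>2)" by simp
        also have "\<dots> \<le> (e + C) * (2 * tail k f f' T)"
          using e C by (intro mult_left_mono boundary_tail_bound[OF f elim]) auto
        finally show ?case .
      qed
    qed
    have "((\<lambda>T. weight k f T * D T + (LBINT x:{0..T}. ?s x)) \<longlongrightarrow> 0 + (LBINT x:{0..}. ?s x)) at_top"
      by (rule tendsto_add[OF lim2 lim1])
    moreover have "eventually (\<lambda>T. pint k f f' w T = weight k f T * D T + (LBINT x:{0..T}. ?s x)) at_top"
      using eventually_ge_at_top[of 0] by eventually_elim (rule decomp)
    ultimately have lim: "(pint k f f' w \<longlongrightarrow> (LBINT x:{0..}. ?s x)) at_top"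
      using tendsto_cong[of "pint k f f' w"] by simp
    have "\<bar>LBINT x:{0..}. ?s x\<bar> \<le> (LBINT x:{0..}. \<bar>?s x\<bar>)"
      using set_integral_norm_bound[OF si] by simp
    also have "\<dots> \<le> (LBINT x. ?m x)"
      unfolding set_lebesgue_integral_def
    proof (rule integral_mono[OF _ im])
      show "integrable lborel (\<lambda>x. indicator {0..} x *\<^sub>R \<bar>?s x\<bar>)"
        using set_integrable_abs[OF si] by (simp add: set_integrable_def)
      fix x show "indicator {0..} x *\<^sub>R \<bar>?s x\<bar> \<le> ?m x"
        using sle[of x] m0[of x] by (cases "x \<ge> 0") (auto simp: indicator_def)
    qed
    also have "\<dots> = h2 * energy k f f' + K0 * (sqnorm f + (LBINT x. (f x)\<^sup>2 * x powr (- (3/2))))"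
      using admissibleD(6)[OF f] admissible_integrable_square[OF f] admissible_singular_weight(1)[OF f d]
      by (simp add: energy_def sqnorm_def)
    also have "\<dots> \<le> h2 * energy k f f' + K0 * (sqnorm f + (2 * sqrt d * energy k f f' + d powr (- (3/2)) * sqnorm f))"
      using K0 by (intro add_left_mono mult_left_mono admissible_singular_weight(2)[OF f d]) auto
    also have "\<dots> = (h2 + K0 * (2 * sqrt d)) * energy k f f' + K * sqnorm f"
      by (simp add: K_def algebra_simps)
    also have "\<dots> = h * energy k f f' + K * sqnorm f" unfolding sd by (simp add: h2_def)
    finally show ?thesis using lim by blast
  qed
  with K show ?thesis by blast
qed

lemma tame_convergent:
  assumes "tame w" "admissible k f f'"
  shows "converges (pint k f f' w)"
  using tame_pint[OF assms(1), of 1 k] assms(2) by auto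

text \<open>With \<open>h = sqrt \<beta> / 2\<close> the noise prefactor 2 / sqrt \<beta> turns the
  energy part of the bound into exactly one energy, which the form subtracts.\<close>

lemma tame_bdd_above_form_vals:
  assumes w: "tame w" and \<beta>: "\<beta> > 0"
  shows "bdd_above (form_vals \<beta> k w)"
proof -
  obtain K where K: "\<And>f f'. admissible k f f' \<Longrightarrow>
     \<exists>l. (pint k f f' w \<longlongrightarrow> l) at_top \<and> \<bar>l\<bar> \<le> sqrt \<beta> / 2 * energy k f f' + K * sqnorm f"
    using tame_pint[OF w, of "sqrt \<beta> / 2" k] \<beta> by auto
  show ?thesis
  proof (rule bdd_aboveI)
    fix v assume "v \<in> form_vals \<beta> k w"
    then obtain f f' where v: "v = 2 / sqrt \<beta> * Lim at_top (pint k f f' w) - energy k f f'"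
      and f: "admissible k f f'" "sqnorm f = 1" unfolding form_vals_def by blast
    obtain l where l: "(pint k f f' w \<longlongrightarrow> l) at_top" "\<bar>l\<bar> \<le> sqrt \<beta> / 2 * energy k f f' + K * sqnorm f"
      using K[OF f(1)] by blast
    have "v = 2 / sqrt \<beta> * l - energy k f f'" unfolding v using l(1) by (simp add: tendsto_Lim)
    also have "\<dots> \<le> 2 / sqrt \<beta> * (sqrt \<beta> / 2 * energy k f f' + K) - energy k f f'"
      using l(2) f(2) \<beta> by (intro diff_right_mono mult_left_mono) auto
    also have "\<dots> = 2 / sqrt \<beta> * K" using \<beta> by (simp add: field_simps)
    finally show "v \<le> 2 / sqrt \<beta> * K" .
  qed
qed

section \<open>Space rescaling\<close>

lemma set_integral_rescale:
  fixes h :: "real \<Rightarrow> real"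
  assumes c: "c > 0"
  shows "(LBINT y:{0..c * x}. h y) = c * (LBINT y:{0..x}. h (c * y))"
    and "set_integrable lborel {0..c * x} h \<Longrightarrow> set_integrable lborel {0..x} (\<lambda>y. h (c * y))"
proof -
  have ind: "indicator {0..c * x} (c * y) = (indicator {0..x} y :: real)" for y
    using c by (auto simp: indicator_def zero_le_mult_iff)
  show "(LBINT y:{0..c * x}. h y) = c * (LBINT y:{0..x}. h (c * y))"
    unfolding set_lebesgue_integral_def
    using lborel_integral_real_affine[of c "\<lambda>y. indicator {0..c * x} y *\<^sub>R h y" 0] c by (simp add: ind)
  show "set_integrable lborel {0..x} (\<lambda>y. h (c * y))" if "set_integrable lborel {0..c * x} h"
    using that lborel_integrable_real_affine[of "\<lambda>y. indicator {0..c * x} y *\<^sub>R h y" c 0] c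
    unfolding set_integrable_def by (simp add: ind)
qed

lemma primitive_rescale:
  assumes F: "primitive F F'" and c: "c > 0"
  shows "primitive (\<lambda>x. F (c * x)) (\<lambda>x. c * F' (c * x))"
  unfolding primitive_def
proof (intro allI impI conjI)
  fix x :: real assume x: "x \<ge> 0"
  have cx: "c * x \<ge> 0" using x c by simp
  show "set_integrable lborel {0..x} (\<lambda>x. c * F' (c * x))"
    by (intro set_integrable_mult_right set_integral_rescale(2)[OF c] primitiveD(1)[OF F cx])
  show "F (c * x) = F (c * 0) + (LBINT y:{0..x}. c * F' (c * y))"
    using primitive_increment[OF F order.refl cx] set_integral_rescale(1)[OF c, of x F'] by simp
qed

lemma integral_rescale:
  fixes h :: "real \<Rightarrow> real"
  assumes c: "c > 0"
  shows "(LBINT y. h (c * y)) = (LBINT y. h y) / c"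
  using lborel_integral_real_affine[of c h 0] c by simp

context
  fixes c :: real and f f' :: "real \<Rightarrow> real" and k :: nat
  assumes c: "c > 0" and f: "admissible k f f'"
begin

private definition "g x = sqrt c * f (c * x)"
private definition "g' x = sqrt c * (c * f' (c * x))"

private lemma deriv_sq: "(g' x)\<^sup>2 = c ^ 3 * (f' (c * x))\<^sup>2"
  using c by (simp add: g'_def power_mult_distrib power2_eq_square power3_eq_cube)

private lemma potential: "x powr pot_exp k * (g x)\<^sup>2 = c powr (1 - pot_exp k) * ((c * x) powr pot_exp k * (f (c * x))\<^sup>2)"
proof (cases "x \<le> 0")
  case True
  then have "c * x \<le> 0" using c by (simp add: mult_le_0_iff)
  then show ?thesis using admissibleD(3)[OF f, of "c * x"] by (simp add: g_def)
next
  case False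
  then have eq: "c powr (1 - pot_exp k) * (c * x) powr pot_exp k = c * x powr pot_exp k"
    using c by (simp add: powr_mult powr_diff)
  have "x powr pot_exp k * (g x)\<^sup>2 = (c * x powr pot_exp k) * (f (c * x))\<^sup>2"
    using c by (simp add: g_def power_mult_distrib)
  also have "\<dots> = c powr (1 - pot_exp k) * (c * x) powr pot_exp k * (f (c * x))\<^sup>2" by (simp only: eq)
  finally show ?thesis by (simp only: mult.assoc)
qed

lemma admissible_rescale: "admissible k (\<lambda>x. sqrt c * f (c * x)) (\<lambda>x. sqrt c * (c * f' (c * x)))"
proof -
  note [measurable] = admissibleD(1,2)[OF f]
  have "integrable lborel (\<lambda>x. c ^ 3 * (f' (c * x))\<^sup>2 + c powr (1 - pot_exp k) * ((c * x) powr pot_exp k * (f (c * x))\<^sup>2))"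
    using lborel_integrable_real_affine[OF admissible_integrable_deriv_sq[OF f], of c 0]
      lborel_integrable_real_affine[OF admissible_integrable_potential[OF f], of c 0] c
    by (intro Bochner_Integration.integrable_add integrable_mult_right) auto
  then have "integrable lborel (edens k g g')"
    unfolding edens_def deriv_sq potential .
  moreover have "primitive g g'"
    unfolding g_def[abs_def] g'_def[abs_def]
    by (intro primitive_cmult primitive_rescale admissibleD(5)[OF f] c)
  moreover have "g x = 0 \<and> g' x = 0" if "x \<le> 0" for x
  proof -
    have "c * x \<le> 0" using c that by (simp add: mult_le_0_iff)
    then show ?thesis using admissibleD(3,4)[OF f, of "c * x"] by (simp add: g_def g'_def)
  qed
  ultimately show ?thesis
    unfolding admissible_def g_def[abs_def] g'_def[abs_def] by auto
qed

text \<open>The two parts of the energy receive powers of \<open>c\<close> of opposite sign; this is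
  why \<open>s\<close> is restricted from both sides.\<close>

lemma energy_rescale:
  "energy k (\<lambda>x. sqrt c * f (c * x)) (\<lambda>x. sqrt c * (c * f' (c * x)))
    = c\<^sup>2 * (LBINT x. (f' x)\<^sup>2) + c powr (- pot_exp k) * (LBINT x. x powr pot_exp k * (f x)\<^sup>2)"
proof -
  have ad: "admissible k g g'"
    using admissible_rescale unfolding g_def[abs_def] g'_def[abs_def] .
  have "energy k g g' = c ^ 3 * ((LBINT x. (f' x)\<^sup>2) / c) + c powr (1 - pot_exp k) * ((LBINT x. x powr pot_exp k * (f x)\<^sup>2) / c)"
    unfolding energy_split[OF ad] deriv_sq potential
    by (simp add: integral_rescale[OF c, of "\<lambda>y. (f' y)\<^sup>2"] integral_rescale[OF c, of "\<lambda>y. y powr pot_exp k * (f y)\<^sup>2"])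
  also have "\<dots> = c\<^sup>2 * (LBINT x. (f' x)\<^sup>2) + c powr (- pot_exp k) * (LBINT x. x powr pot_exp k * (f x)\<^sup>2)"
    using c by (simp add: power2_eq_square power3_eq_cube powr_diff powr_minus field_simps)
  finally show ?thesis unfolding g_def[abs_def] g'_def[abs_def] .
qed

lemma sqnorm_rescale: "sqnorm (\<lambda>x. sqrt c * f (c * x)) = sqnorm f"
  using c integral_rescale[OF c, of "\<lambda>y. (f y)\<^sup>2"] by (simp add: sqnorm_def power_mult_distrib)

text \<open>The weight contributes c^(1 + a) with \<open>a = noise_exp k\<close>, one factor c from
  the normalisation of \<open>f\<close> and c^a from the singular power; dividing the path by sqrt c
  leaves a + 1/2.\<close>

lemma pint_rescale:
  assumes T: "T \<ge> 0"
  shows "pint k (\<lambda>x. sqrt c * f (c * x)) (\<lambda>x. sqrt c * (c * f' (c * x))) (\<lambda>x. w (c * x) / sqrt c) T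
    = c powr (noise_exp k + 1/2) * pint k f f' w (c * T)"
proof -
  have f0: "f 0 = 0" using admissibleD(3)[OF f, of 0] by simp
  have pc: "x powr (- noise_exp k) = c powr noise_exp k * (c * x) powr (- noise_exp k)"
    "x powr (- noise_exp k - 1) = c powr (noise_exp k + 1) * (c * x) powr (- noise_exp k - 1)" if "x \<ge> 0" for x
    using that c by (simp_all add: powr_mult powr_minus powr_add powr_diff field_simps)
  have sc: "c powr (noise_exp k + 1/2) = c powr noise_exp k * sqrt c" using c by (simp add: powr_add powr_half_sqrt)
  have ss: "sqrt c * sqrt c = c" using c by simp
  have 1: "weight k g x = c * c powr noise_exp k * weight k f (c * x)" if "x \<ge> 0" for x
    using c unfolding weight_def g_def pc[OF that] by (simp add: power_mult_distrib)
  have 2: "weight_deriv k g g' x = c\<^sup>2 * c powr noise_exp k * weight_deriv k f f' (c * x)" if "x \<ge> 0" for x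
  proof -
    have ca: "c powr (noise_exp k + 1) = c powr noise_exp k * c" using c by (simp add: powr_add)
    have "weight_deriv k g g' x = (sqrt c * sqrt c) * c * c powr noise_exp k * weight_deriv k f f' (c * x)"
      unfolding weight_deriv_def g_def g'_def pc[OF that] ca power_mult_distrib
      using c by (simp only: power2_eq_square ss) (simp add: algebra_simps)
    then show ?thesis using c by (simp add: power2_eq_square)
  qed
  have "(LBINT x:{0..T}. w (c * x) / sqrt c * weight_deriv k g g' x)
     = (LBINT x:{0..T}. (c\<^sup>2 * c powr noise_exp k / sqrt c) * (w (c * x) * weight_deriv k f f' (c * x)))"
    by (intro set_lebesgue_integral_cong) (auto simp: 2)
  also have "\<dots> = (c\<^sup>2 * c powr noise_exp k / sqrt c) * ((LBINT x:{0..c*T}. w x * weight_deriv k f f' x) / c)"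
    using set_integral_rescale(1)[OF c, of T "\<lambda>x. w x * weight_deriv k f f' x"] c by simp
  also have "\<dots> = c powr (noise_exp k + 1/2) * (LBINT x:{0..c*T}. w x * weight_deriv k f f' x)"
    using c unfolding sc by (simp add: power2_eq_square real_div_sqrt field_simps)
  finally have i: "(LBINT x:{0..T}. w (c * x) / sqrt c * weight_deriv k g g' x)
     = c powr (noise_exp k + 1/2) * (LBINT x:{0..c*T}. w x * weight_deriv k f f' x)" .
  have "pint k g g' (\<lambda>x. w (c * x) / sqrt c) T = c powr (noise_exp k + 1/2) * pint k f f' w (c * T)"
    unfolding pint_def stieltjes_def i 1[OF T] right_diff_distrib sc
    using c by (simp add: real_div_sqrt field_simps)
  then show ?thesis unfolding g_def[abs_def] g'_def[abs_def] .
qed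

end

text \<open>Rescaling space by this factor makes the noise terms agree; both energy
  coefficients then decrease exactly when \<open>s\<close> lies in the stated range.\<close>
lemma scaling_exponents:
  fixes \<beta>1 \<beta>2 s :: real and k :: nat
  assumes \<beta>: "0 < \<beta>1" "\<beta>1 < \<beta>2"
    and s: "1 / (4 * real k + 3) \<le> s" "s \<le> (4 * real k + 2) / (4 * real k + 3)"
  defines "c \<equiv> (\<beta>2 / \<beta>1) powr ((s - 1/2) / (noise_exp k + 1/2))"
  shows "c > 0" "\<beta>1 powr s / sqrt \<beta>1 * c powr (noise_exp k + 1/2) = \<beta>2 powr s / sqrt \<beta>2"
    "\<beta>1 powr s * c\<^sup>2 \<le> \<beta>2 powr s" "\<beta>1 powr s * c powr (- pot_exp k) \<le> \<beta>2 powr s"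
proof -
  define r where "r = \<beta>2 / \<beta>1"
  have r: "r > 1" and b2: "\<beta>2 = r * \<beta>1" using \<beta> by (auto simp: r_def)
  have c: "c = r powr ((s - 1/2) / (noise_exp k + 1/2))" by (simp add: c_def r_def)
  have a: "noise_exp k + 1/2 > 0" using noise_exp_nonneg[of k] by simp
  have aeq: "noise_exp k + 1/2 = (4 * real k + 1) / (4 * real k + 2)" by (simp add: noise_exp_def field_simps)
  show "c > 0" using r by (simp add: c)
  have bs: "\<beta>2 powr s = r powr s * \<beta>1 powr s" using r \<beta> by (simp add: b2 powr_mult)
  have "c powr (noise_exp k + 1/2) = r powr (s - 1/2)" using a by (simp add: c powr_powr)
  also have "\<dots> = r powr s / sqrt r" using r by (simp add: powr_diff powr_half_sqrt)
  finally show "\<beta>1 powr s / sqrt \<beta>1 * c powr (noise_exp k + 1/2) = \<beta>2 powr s / sqrt \<beta>2"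
    unfolding bs using r \<beta> by (simp add: b2 real_sqrt_mult mult.commute)
  \<comment> \<open>Equivalent to the upper bound on \<open>s\<close>, with equality at the upper
    end point: the kinetic part.\<close>
  have le1: "(s - 1/2) / (noise_exp k + 1/2) * 2 \<le> s"
  proof -
    have "(s - 1/2) * 2 \<le> s * (noise_exp k + 1/2)"
      using s(2) unfolding aeq by (simp add: field_simps)
    then show ?thesis using a by (simp add: field_simps)
  qed
  have "c\<^sup>2 = r powr ((s - 1/2) / (noise_exp k + 1/2) * 2)"
    unfolding c power2_eq_square powr_add[symmetric] by (rule arg_cong[where f="\<lambda>t. r powr t"]) simp
  also have "\<dots> \<le> r powr s" using le1 r by (intro powr_mono) auto
  finally show "\<beta>1 powr s * c\<^sup>2 \<le> \<beta>2 powr s" unfolding bs by (simp add: mult.commute mult_left_mono)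
  \<comment> \<open>Equivalent to the lower bound on \<open>s\<close>, with equality at the lower
    end point: the potential part.\<close>
  have le2: "(s - 1/2) / (noise_exp k + 1/2) * (- pot_exp k) \<le> s"
  proof -
    have "(s - 1/2) * (- pot_exp k) = (1 - 2 * s) / (4 * real k + 2)" by (simp add: pot_exp_def field_simps)
    also have "\<dots> \<le> (s * (4 * real k + 1)) / (4 * real k + 2)"
      using s(1) by (intro divide_right_mono) (simp_all add: field_simps)
    also have "\<dots> = s * (noise_exp k + 1/2)" unfolding aeq by simp
    finally have "(s - 1/2) * (- pot_exp k) \<le> s * (noise_exp k + 1/2)" .
    then show ?thesis using a by (simp add: field_simps)
  qed
  have "c powr (- pot_exp k) = r powr ((s - 1/2) / (noise_exp k + 1/2) * (- pot_exp k))" by (simp add: c powr_powr)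
  also have "\<dots> \<le> r powr s" using le2 r by (intro powr_mono) auto
  finally show "\<beta>1 powr s * c powr (- pot_exp k) \<le> \<beta>2 powr s" unfolding bs by (simp add: mult.commute mult_left_mono)
qed

lemma form_vals_memI:
  assumes "admissible k f f'" "sqnorm f = 1"
  shows "2 / sqrt \<beta> * Lim at_top (pint k f f' w) - energy k f f' \<in> form_vals \<beta> k w"
  using assms unfolding form_vals_def by blast

text \<open>Every test function for \<open>w\<close> is turned into one for the rescaled path with
  at least the same weighted value. Tameness of \<open>w\<close> makes its limits genuine, so that
  they scale; tameness of the rescaled path bounds the right-hand set, so that its
  \<open>Sup\<close> dominates the members.\<close>

lemma Sup_form_vals_scaling:
  fixes \<beta>1 \<beta>2 s :: real and k :: nat
  assumes \<beta>: "0 < \<beta>1" "\<beta>1 < \<beta>2"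
    and s: "1 / (4 * real k + 3) \<le> s" "s \<le> (4 * real k + 2) / (4 * real k + 3)"
  defines "c \<equiv> (\<beta>2 / \<beta>1) powr ((s - 1/2) / (noise_exp k + 1/2))"
  assumes w: "tame w" and w': "tame (\<lambda>x. w (c * x) / sqrt c)"
  shows "\<beta>2 powr s * Sup (form_vals \<beta>2 k w) \<le> \<beta>1 powr s * Sup (form_vals \<beta>1 k (\<lambda>x. w (c * x) / sqrt c))"
proof -
  let ?w' = "\<lambda>x. w (c * x) / sqrt c"
  note e = scaling_exponents[OF \<beta> s, folded c_def]
  have b2: "\<beta>2 powr s > 0" using \<beta> by simp
  have "v \<le> \<beta>1 powr s * Sup (form_vals \<beta>1 k ?w') / \<beta>2 powr s" if vm: "v \<in> form_vals \<beta>2 k w" for v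
  proof -
    obtain f f' where v: "v = 2 / sqrt \<beta>2 * Lim at_top (pint k f f' w) - energy k f f'"
      and f: "admissible k f f'" "sqnorm f = 1" using vm unfolding form_vals_def by blast
    obtain l where l: "(pint k f f' w \<longlongrightarrow> l) at_top" using tame_convergent[OF w f(1)] by blast
    let ?g = "\<lambda>x. sqrt c * f (c * x)" and ?g' = "\<lambda>x. sqrt c * (c * f' (c * x))"
    let ?A = "LBINT x. (f' x)\<^sup>2" and ?B = "LBINT x. x powr pot_exp k * (f x)\<^sup>2"
    have AB: "?A \<ge> 0" "?B \<ge> 0" by (auto intro!: integral_nonneg_AE)
    have "filterlim (\<lambda>T. c * T) at_top at_top"
      by (rule filterlim_tendsto_pos_mult_at_top[OF tendsto_const e(1) filterlim_ident])
    from filterlim_compose[OF l this] have "((\<lambda>T. c powr (noise_exp k + 1/2) * pint k f f' w (c * T)) \<longlongrightarrow> c powr (noise_exp k + 1/2) * l) at_top"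
      by (intro tendsto_intros)
    moreover have "eventually (\<lambda>T. pint k ?g ?g' ?w' T = c powr (noise_exp k + 1/2) * pint k f f' w (c * T)) at_top"
      using eventually_ge_at_top[of 0] by eventually_elim (rule pint_rescale[OF e(1) f(1)])
    ultimately have lg: "(pint k ?g ?g' ?w' \<longlongrightarrow> c powr (noise_exp k + 1/2) * l) at_top"
      using tendsto_cong[of "pint k ?g ?g' ?w'"] by simp
    have "2 / sqrt \<beta>1 * Lim at_top (pint k ?g ?g' ?w') - energy k ?g ?g' \<in> form_vals \<beta>1 k ?w'"
      using f(2) by (intro form_vals_memI admissible_rescale[OF e(1) f(1)]) (simp only: sqnorm_rescale[OF e(1) f(1)])
    then have m: "2 / sqrt \<beta>1 * (c powr (noise_exp k + 1/2) * l) - (c\<^sup>2 * ?A + c powr (- pot_exp k) * ?B) \<in> form_vals \<beta>1 k ?w'"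
      using lg by (simp add: tendsto_Lim energy_rescale[OF e(1) f(1)])
    have "\<beta>2 powr s * v = 2 * (\<beta>2 powr s / sqrt \<beta>2) * l - \<beta>2 powr s * ?A - \<beta>2 powr s * ?B"
      unfolding v energy_split[OF f(1)] using l by (simp add: tendsto_Lim algebra_simps)
    also have "\<dots> \<le> 2 * (\<beta>2 powr s / sqrt \<beta>2) * l - (\<beta>1 powr s * c\<^sup>2) * ?A - (\<beta>1 powr s * c powr (- pot_exp k)) * ?B"
      using mult_right_mono[OF e(3) AB(1)] mult_right_mono[OF e(4) AB(2)] by linarith
    also have "\<dots> = \<beta>1 powr s * (2 / sqrt \<beta>1 * (c powr (noise_exp k + 1/2) * l) - (c\<^sup>2 * ?A + c powr (- pot_exp k) * ?B))"
      unfolding e(2)[symmetric] by (simp add: algebra_simps)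
    also have "\<dots> \<le> \<beta>1 powr s * Sup (form_vals \<beta>1 k ?w')"
      by (intro mult_left_mono cSup_upper[OF m tame_bdd_above_form_vals[OF w' \<beta>(1)]]) simp
    finally show ?thesis using b2 by (simp add: field_simps)
  qed
  then have "Sup (form_vals \<beta>2 k w) \<le> \<beta>1 powr s * Sup (form_vals \<beta>1 k ?w') / \<beta>2 powr s"
    by (intro cSup_least form_vals_nonempty)
  then show ?thesis using b2 by (simp add: field_simps)
qed

section \<open>Brownian paths\<close>

text \<open>A new dyadic point of level m + 1 lies one increment of that level to the right of a
  point of level m.\<close>

lemma dyadic_chaining:
  fixes w :: "real \<Rightarrow> real"
  assumes L: "L \<ge> 0"
    and inc: "\<And>j i. i < 2 ^ j \<Longrightarrow> \<bar>w (a + (real i + 1) / 2 ^ j) - w (a + real i / 2 ^ j)\<bar> \<le> L * (9/10) ^ j"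
  shows "k \<le> 2 ^ m \<Longrightarrow> \<bar>w (a + real k / 2 ^ m) - w a\<bar> \<le> L * (\<Sum>j\<le>m. (9/10) ^ j)"
proof (induction m arbitrary: k)
  case 0
  then have "k = 0 \<or> k = 1" by auto
  then show ?case using inc[of 0 0] L by auto
next
  case (Suc m)
  let ?S = "\<Sum>j\<le>m. (9/10::real) ^ j"
  have S: "L * (\<Sum>j\<le>Suc m. (9/10) ^ j) = L * ?S + L * (9/10) ^ Suc m" by (simp add: algebra_simps)
  have L0: "L * (9/10) ^ Suc m \<ge> 0" using L by simp
  show ?case
  proof (cases "even k")
    case True
    then obtain i where k: "k = 2 * i" by blast
    then have "real k / 2 ^ Suc m = real i / 2 ^ m" by simp
    moreover have "i \<le> 2 ^ m" using Suc.prems k by simp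
    ultimately show ?thesis using Suc.IH[of i] L0 unfolding S by simp
  next
    case False
    then obtain i where k: "k = 2 * i + 1" using oddE by blast
    have i: "2 * i < 2 ^ Suc m" "i \<le> 2 ^ m" using Suc.prems k by auto
    have e: "(real (2 * i) + 1) / 2 ^ Suc m = real k / 2 ^ Suc m" "real (2 * i) / 2 ^ Suc m = real i / 2 ^ m"
      using k by auto
    show ?thesis using inc[OF i(1)] Suc.IH[OF i(2)] unfolding S e by linarith
  qed
qed

text \<open>Each point is the limit of its dyadic approximations from the left; 10 is the sum of the
  geometric series with ratio 9/10.\<close>

lemma dyadic_chaining_continuous:
  fixes w :: "real \<Rightarrow> real"
  assumes w: "continuous_on {a..a+1} w" and L: "L \<ge> 0"
    and inc: "\<And>j i. i < 2 ^ j \<Longrightarrow> \<bar>w (a + (real i + 1) / 2 ^ j) - w (a + real i / 2 ^ j)\<bar> \<le> L * (9/10) ^ j"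
    and x: "x \<in> {a..a+1}"
  shows "\<bar>w x - w a\<bar> \<le> 10 * L"
proof -
  define k where "k m = nat \<lfloor>(x - a) * 2 ^ m\<rfloor>" for m
  have kf: "real (k m) \<le> (x - a) * 2 ^ m" "(x - a) * 2 ^ m \<le> real (k m) + 1" for m
    using x by (auto simp: k_def)
  have kb: "real (k m) / 2 ^ m \<le> x - a" "x - a - 1 / 2 ^ m \<le> real (k m) / 2 ^ m" for m
  proof -
    show "real (k m) / 2 ^ m \<le> x - a" using kf(1)[of m] by (simp add: pos_divide_le_eq)
    have "x - a \<le> (real (k m) + 1) / 2 ^ m" using kf(2)[of m] by (simp add: pos_le_divide_eq)
    then show "x - a - 1 / 2 ^ m \<le> real (k m) / 2 ^ m" by (simp add: add_divide_distrib)
  qed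
  have k2: "k m \<le> 2 ^ m" for m
  proof -
    have "(x - a) * 2 ^ m \<le> 1 * 2 ^ m" using x by (intro mult_right_mono) auto
    then have "real (k m) \<le> 2 ^ m" using kf(1)[of m] by linarith
    then show ?thesis by simp
  qed
  have z: "(\<lambda>m. 1 / 2 ^ m :: real) \<longlonglongrightarrow> 0"
    using LIMSEQ_power_zero[of "1/2 :: real"] by (simp add: power_one_over)
  have lim: "(\<lambda>m. a + real (k m) / 2 ^ m) \<longlonglongrightarrow> x"
  proof (rule tendsto_sandwich[of "\<lambda>m. x - 1 / 2 ^ m" _ _ "\<lambda>m. x"])
    show "(\<lambda>m. x - 1 / 2 ^ m) \<longlonglongrightarrow> x" using tendsto_diff[OF tendsto_const[of x] z] by simp
  qed (use kb in \<open>auto intro!: always_eventually simp: algebra_simps\<close>)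
  have in_int: "a + real (k m) / 2 ^ m \<in> {a..a+1}" for m using k2[of m] by auto
  have "(\<lambda>m. w (a + real (k m) / 2 ^ m)) \<longlonglongrightarrow> w x"
    by (rule continuous_on_tendsto_compose[OF w lim x]) (use in_int in auto)
  then have "(\<lambda>m. \<bar>w (a + real (k m) / 2 ^ m) - w a\<bar>) \<longlonglongrightarrow> \<bar>w x - w a\<bar>" by (intro tendsto_intros)
  moreover have "\<bar>w (a + real (k m) / 2 ^ m) - w a\<bar> \<le> 10 * L" for m
  proof -
    have le: "\<bar>w (a + real (k m) / 2 ^ m) - w a\<bar> \<le> L * (\<Sum>j\<le>m. (9/10) ^ j)"
      by (rule dyadic_chaining[OF L inc k2])
    have "(\<Sum>j\<le>m. (9/10::real) ^ j) \<le> 10"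
    proof -
      have "(\<Sum>j\<le>m. (9/10::real) ^ j) = 10 * (1 - (9/10) ^ Suc m)"
        by (induction m) auto
      also have "\<dots> \<le> 10 * (1 - 0)" by (intro mult_left_mono diff_left_mono) auto
      finally show ?thesis by simp
    qed
    from le mult_left_mono[OF this L] show ?thesis by linarith
  qed
  ultimately show ?thesis by (intro LIMSEQ_le_const2) auto
qed

text \<open>Any exponent below 1/2 gives oscillation of smaller order than sqrt x. The value 3/8 is
  also large enough for the fourth-moment series over unit intervals to converge, since 4 times 3/8
  exceeds 1.\<close>

lemma tame_of_growth:
  fixes w :: "real \<Rightarrow> real"
  assumes w: "cpath w" and B: "B \<ge> 0"
    and g: "\<And>n x. real n \<le> x \<Longrightarrow> x \<le> real n + 1 \<Longrightarrow> \<bar>w x - w (real n)\<bar> \<le> B * (real n + 1) powr (3/8)"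
  shows "tame w"
  unfolding tame_def
proof (intro conjI w allI impI)
  fix e :: real assume e: "e > 0"
  \<comment> \<open>If \<open>x\<close> and \<open>y\<close> lie in neighbouring unit intervals, the
    path is followed from \<open>y\<close> to n + 1, from there to n, and from n to
    \<open>x\<close>.\<close>
  define D where "D = 3 * B"
  have D: "D \<ge> 0" using B by (simp add: D_def)
  define C where "C = e * sqrt 2 + D * (D / e) ^ 3"
  have osc: "\<bar>w y - w x\<bar> \<le> D * (x + 2) powr (3/8)" if x: "x \<ge> 0" and y: "y \<in> {x..x+1}" for x y
  proof -
    define n where "n = nat \<lfloor>x\<rfloor>"
    have n: "real n \<le> x" "x \<le> real n + 1" using x unfolding n_def by linarith+
    have p: "(real n + 1) powr (3/8) \<le> (x + 2) powr (3/8)" "(real (Suc n) + 1) powr (3/8) \<le> (x + 2) powr (3/8)"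
      using n by (auto intro!: powr_mono2)
    have p': "B * (real n + 1) powr (3/8) \<le> B * (x + 2) powr (3/8)" "B * (real (Suc n) + 1) powr (3/8) \<le> B * (x + 2) powr (3/8)"
      using p B by (auto intro!: mult_left_mono)
    have b0: "0 \<le> B * (x + 2) powr (3/8)" using B by simp
    have wx: "\<bar>w x - w (real n)\<bar> \<le> B * (x + 2) powr (3/8)" using g[OF n] p' by linarith
    have wn: "\<bar>w (real (Suc n)) - w (real n)\<bar> \<le> B * (x + 2) powr (3/8)"
      using g[of n "real (Suc n)"] p' by simp
    show ?thesis
    proof (cases "y \<le> real n + 1")
      case True
      then have "\<bar>w y - w (real n)\<bar> \<le> B * (x + 2) powr (3/8)" using g[of n y] n y p' by simp
      with wx b0 show ?thesis unfolding D_def by linarith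
    next
      case False
      then have "\<bar>w y - w (real (Suc n))\<bar> \<le> B * (x + 2) powr (3/8)" using g[of "Suc n" y] n y p' by simp
      with wx wn show ?thesis unfolding D_def by linarith
    qed
  qed
  have gr: "D * (x + 2) powr (3/8) \<le> e * sqrt x + C" if x: "x \<ge> 0" for x
  proof -
    \<comment> \<open>In this variable the powers 3/8 and 1/2 become t^3 and t^4, and the comparison
      splits at t = D / e.\<close>
    define t where "t = (x + 2) powr (1/8)"
    have t: "t \<ge> 0" by (simp add: t_def)
    have t3: "(x + 2) powr (3/8) = t ^ 3" using x by (simp add: t_def powr_power)
    have t4: "sqrt (x + 2) = t ^ 4" using x by (simp add: t_def powr_power powr_half_sqrt)
    have "D * t ^ 3 \<le> e * t ^ 4 + D * (D / e) ^ 3"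
    proof (cases "t \<le> D / e")
      case True
      then have "D * t ^ 3 \<le> D * (D / e) ^ 3" using t D by (intro mult_left_mono power_mono) auto
      moreover have "0 \<le> e * t ^ 4" using e by simp
      ultimately show ?thesis by linarith
    next
      case False
      then have "D \<le> e * t" using e by (simp add: field_simps)
      then have "D * t ^ 3 \<le> (e * t) * t ^ 3" using t by (intro mult_right_mono) auto
      moreover have "0 \<le> D * (D / e) ^ 3" using D e by simp
      ultimately show ?thesis by (simp add: power_numeral_reduce)
    qed
    also have "e * t ^ 4 \<le> e * (sqrt x + sqrt 2)"
      unfolding t4[symmetric] using e x by (intro mult_left_mono sqrt_add_le_add_sqrt) auto
    finally show ?thesis unfolding t3 C_def by (simp add: algebra_simps)
  qed
  show "\<exists>C\<ge>0. \<forall>x\<ge>0. \<forall>y\<in>{x..x+1}. \<bar>w y - w x\<bar> \<le> e * sqrt x + C"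
  proof (intro exI[of _ C] conjI allI impI ballI)
    show "C \<ge> 0" using e D by (simp add: C_def)
    fix x y :: real assume "x \<ge> 0" "y \<in> {x..x+1}"
    then show "\<bar>w y - w x\<bar> \<le> e * sqrt x + C" using osc[of x y] gr[of x] by linarith
  qed
qed

lemma brownian_motionD:
  assumes "brownian_motion M W"
  shows "prob_space M"
    "\<And>t. t \<ge> 0 \<Longrightarrow> (\<lambda>\<omega>. W \<omega> t) \<in> borel_measurable M"
    "\<And>\<omega>. \<omega> \<in> space M \<Longrightarrow> W \<omega> 0 = 0"
    "\<And>\<omega>. \<omega> \<in> space M \<Longrightarrow> continuous_on {0..} (W \<omega>)"
    "\<And>s t. 0 \<le> s \<Longrightarrow> s < t \<Longrightarrow> distributed M lborel (\<lambda>\<omega>. W \<omega> t - W \<omega> s)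
          (\<lambda>x. ennreal (normal_density 0 (sqrt (t - s)) x))"
    "\<And>(n::nat) (ts::nat \<Rightarrow> real). 0 \<le> ts 0 \<Longrightarrow> (\<And>i. i < n \<Longrightarrow> ts i < ts (Suc i)) \<Longrightarrow>
        prob_space.indep_vars M (\<lambda>_. borel) (\<lambda>i \<omega>. W \<omega> (ts (Suc i)) - W \<omega> (ts i)) {..<n}"
  using assms unfolding brownian_motion_def by blast+

lemma brownian_fourth_moment:
  assumes W: "brownian_motion M W" and st: "0 \<le> s" "s < t"
  shows "(\<integral>\<^sup>+\<omega>. ennreal ((W \<omega> t - W \<omega> s) ^ 4) \<partial>M) = ennreal (3 * (t - s)\<^sup>2)"
proof -
  have d: "distributed M lborel (\<lambda>\<omega>. W \<omega> t - W \<omega> s) (\<lambda>x. ennreal (normal_density 0 (sqrt (t - s)) x))"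
    by (rule brownian_motionD(5)[OF W st])
  have s0: "0 < sqrt (t - s)" using st by simp
  have "has_bochner_integral lborel (\<lambda>x. normal_density 0 (sqrt (t - s)) x * x ^ 4) (3 * (t - s)\<^sup>2)"
  proof -
    have "fact (2 * 2) / ((2 / (sqrt (t - s))\<^sup>2) ^ 2 * fact 2) = 3 * (t - s)\<^sup>2"
      using st by (simp add: fact_numeral power_divide)
    with normal_moment_even[OF s0, of 0 2] show ?thesis by simp
  qed
  then have "(\<integral>\<^sup>+x. ennreal (normal_density 0 (sqrt (t - s)) x * x ^ 4) \<partial>lborel) = ennreal (3 * (t - s)\<^sup>2)"
    by (subst nn_integral_eq_integral) (auto dest: has_bochner_integral_integral_eq integrable.intros)
  moreover have "(\<integral>\<^sup>+\<omega>. ennreal ((W \<omega> t - W \<omega> s) ^ 4) \<partial>M)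
     = (\<integral>\<^sup>+x. ennreal (normal_density 0 (sqrt (t - s)) x) * ennreal (x ^ 4) \<partial>lborel)"
    by (rule distributed_nn_integral[OF d, symmetric]) measurable
  ultimately show ?thesis by (simp add: ennreal_mult')
qed

text \<open>In place of Borel-Cantelli, the normalised fourth powers of all dyadic increments are
  summed into one random series of finite expectation. Where the series is finite it bounds every
  single term, and chaining applies.\<close>

lemma AE_tame_brownian:
  assumes W: "brownian_motion M W"
  shows "AE \<omega> in M. tame (W \<omega>)"
proof -
  note [measurable] = brownian_motionD(2)[OF W]
  define \<Delta> where "\<Delta> n j i \<omega> = W \<omega> (real n + (real i + 1) / 2 ^ j) - W \<omega> (real n + real i / 2 ^ j)" for n j i :: nat and \<omega>
  \<comment> \<open>Level j has 2^j increments of fourth moment 3 (1/4)^j, so the ratio must satisfy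
    r^4 > 1/2, which 9/10 does; the power 3/8 becomes the summable (n + 1)^(-3/2).\<close>
  define b where "b n j = (9/10) ^ j * (real n + 1) powr (3/8)" for n j :: nat
  have b: "b n j > 0" for n j by (simp add: b_def)
  have b4: "b n j ^ 4 = ((9/10) ^ 4) ^ j * (real n + 1) powr (3/2)" for n j
    by (simp add: b_def power_mult_distrib powr_power power_mult[symmetric] mult.commute)
  have [measurable]: "\<Delta> n j i \<in> borel_measurable M" for n j i
    unfolding \<Delta>_def by measurable
  define S where "S \<omega> = (\<Sum>n. \<Sum>j. \<Sum>i<2 ^ j. ennreal (\<Delta> n j i \<omega> ^ 4 / b n j ^ 4))" for \<omega>
  have tm: "(\<integral>\<^sup>+\<omega>. ennreal (\<Delta> n j i \<omega> ^ 4 / b n j ^ 4) \<partial>M) = ennreal (3 * (1 / 4) ^ j / b n j ^ 4)" for n j i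
  proof -
    have "(\<integral>\<^sup>+\<omega>. ennreal (\<Delta> n j i \<omega> ^ 4 / b n j ^ 4) \<partial>M) = (\<integral>\<^sup>+\<omega>. ennreal (\<Delta> n j i \<omega> ^ 4) * ennreal (1 / b n j ^ 4) \<partial>M)"
      by (simp add: ennreal_mult'[symmetric] mult.commute)
    also have "\<dots> = (\<integral>\<^sup>+\<omega>. ennreal (\<Delta> n j i \<omega> ^ 4) \<partial>M) * ennreal (1 / b n j ^ 4)"
      by (rule nn_integral_multc) measurable
    also have "(\<integral>\<^sup>+\<omega>. ennreal (\<Delta> n j i \<omega> ^ 4) \<partial>M) = ennreal (3 * (real n + (real i + 1) / 2 ^ j - (real n + real i / 2 ^ j))\<^sup>2)"
      unfolding \<Delta>_def by (rule brownian_fourth_moment[OF W]) (auto simp: divide_strict_right_mono)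
    also have "real n + (real i + 1) / 2 ^ j - (real n + real i / 2 ^ j) = (1 / 2) ^ j"
      by (simp add: add_divide_distrib power_one_over)
    also have "((1 / 2 :: real) ^ j)\<^sup>2 = (1 / 4) ^ j" by (simp add: power2_eq_square flip: power_mult_distrib)
    finally show ?thesis using b[of n j] by (simp add: ennreal_mult''[symmetric])
  qed
  have "(\<integral>\<^sup>+\<omega>. S \<omega> \<partial>M) = (\<Sum>n. \<Sum>j. \<Sum>i<2 ^ j. \<integral>\<^sup>+\<omega>. ennreal (\<Delta> n j i \<omega> ^ 4 / b n j ^ 4) \<partial>M)"
    unfolding S_def by (simp add: nn_integral_suminf nn_integral_sum del: sum_ennreal)
  also have "\<dots> = (\<Sum>n. \<Sum>j. ennreal (3 * (real n + 1) powr (- (3/2)) * (1 / (2 * (9/10) ^ 4)) ^ j))"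
  proof (intro suminf_cong)
    fix n j
    have "(\<Sum>i<2 ^ j. \<integral>\<^sup>+\<omega>. ennreal (\<Delta> n j i \<omega> ^ 4 / b n j ^ 4) \<partial>M) = ennreal (2 ^ j * (3 * (1 / 4) ^ j / b n j ^ 4))"
      unfolding tm using b[of n j] by (subst sum_ennreal) simp_all
    also have "2 ^ j * (3 * (1 / 4) ^ j / b n j ^ 4) = 3 * (real n + 1) powr (- (3/2)) * (1 / (2 * (9/10) ^ 4)) ^ j"
    proof -
      have "2 ^ j * (1 / 4 :: real) ^ j = (1 / 2) ^ j" by (simp flip: power_mult_distrib)
      then have "2 ^ j * (3 * (1 / 4) ^ j / b n j ^ 4) = 3 * ((1 / 2) ^ j / b n j ^ 4)" by simp
      also have "\<dots> = 3 * (real n + 1) powr (- (3/2)) * ((1 / 2) ^ j / ((9/10) ^ 4) ^ j)"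
        by (simp add: b4 powr_minus field_simps)
      also have "(1 / 2 :: real) ^ j / ((9/10) ^ 4) ^ j = (1 / (2 * (9/10) ^ 4)) ^ j"
        by (simp flip: power_divide)
      finally show ?thesis .
    qed
    finally show "(\<Sum>i<2 ^ j. \<integral>\<^sup>+\<omega>. ennreal (\<Delta> n j i \<omega> ^ 4 / b n j ^ 4) \<partial>M)
       = ennreal (3 * (real n + 1) powr (- (3/2)) * (1 / (2 * (9/10) ^ 4)) ^ j)" .
  qed
  also have "\<dots> < \<infinity>"
  proof -
    let ?r = "1 / (2 * (9/10) ^ 4) :: real"
    have sj: "(\<Sum>j. ennreal (3 * (real n + 1) powr (- (3/2)) * ?r ^ j)) = ennreal ((3 * (real n + 1) powr (- (3/2))) * (1 / (1 - ?r)))" for n :: nat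
    proof (rule suminf_ennreal_eq)
      show "(\<lambda>j. 3 * (real n + 1) powr (- (3/2)) * ?r ^ j) sums ((3 * (real n + 1) powr (- (3/2))) * (1 / (1 - ?r)))"
        by (intro sums_mult geometric_sums) (simp add: power_numeral_reduce)
    qed simp
    have "summable (\<lambda>n. real n powr (- (3/2)))" by (simp add: summable_real_powr_iff)
    then have "summable (\<lambda>n. real (Suc n) powr (- (3/2)))" by (subst summable_Suc_iff)
    then have "summable (\<lambda>n. (3 * (real n + 1) powr (- (3/2))) * (1 / (1 - ?r)))"
      by (intro summable_mult2 summable_mult) (simp add: add.commute)
    then show ?thesis
      unfolding sj by (subst suminf_ennreal2) (auto simp: power_numeral_reduce)
  qed
  finally have "(\<integral>\<^sup>+\<omega>. S \<omega> \<partial>M) < \<infinity>" .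
  moreover have "S \<in> borel_measurable M" unfolding S_def by measurable
  ultimately have "AE \<omega> in M. S \<omega> \<noteq> \<infinity>" by (intro nn_integral_PInf_AE) auto
  then show ?thesis
    using AE_space
  proof eventually_elim
    case (elim \<omega>)
    have cw: "continuous_on {0..} (W \<omega>)" by (rule brownian_motionD(4)[OF W elim(2)])
    \<comment> \<open>Being at least 1 gives \<open>C \<le> C ^ 4\<close>, which avoids a fourth
      root.\<close>
    define C where "C = max 1 (enn2real (S \<omega>))"
    have C: "C \<ge> 1" by (simp add: C_def)
    have inc: "\<bar>\<Delta> n j i \<omega>\<bar> \<le> C * b n j" if i: "i < 2 ^ j" for n j i
    proof -
      have "ennreal (\<Delta> n j i \<omega> ^ 4 / b n j ^ 4) \<le> (\<Sum>i<2 ^ j. ennreal (\<Delta> n j i \<omega> ^ 4 / b n j ^ 4))"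
        using i by (intro member_le_sum) auto
      also have "\<dots> \<le> (\<Sum>j. \<Sum>i<2 ^ j. ennreal (\<Delta> n j i \<omega> ^ 4 / b n j ^ 4))"
        using sum_le_suminf[of "\<lambda>j. \<Sum>i<2 ^ j. ennreal (\<Delta> n j i \<omega> ^ 4 / b n j ^ 4)" "{j}"] by simp
      also have "\<dots> \<le> S \<omega>"
        unfolding S_def using sum_le_suminf[of "\<lambda>n. \<Sum>j. \<Sum>i<2 ^ j. ennreal (\<Delta> n j i \<omega> ^ 4 / b n j ^ 4)" "{n}"] by simp
      also have "S \<omega> = ennreal (enn2real (S \<omega>))" using elim(1) by (simp add: less_top)
      also have "\<dots> \<le> ennreal C" by (intro ennreal_leI) (simp add: C_def)
      finally have "\<Delta> n j i \<omega> ^ 4 / b n j ^ 4 \<le> C" using C by (subst (asm) ennreal_le_iff) auto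
      also have "C \<le> C ^ 4" using C by (simp add: self_le_power)
      finally have "\<bar>\<Delta> n j i \<omega>\<bar> ^ 4 \<le> (C * b n j) ^ 4"
        using b[of n j] by (simp add: field_simps power_mult_distrib)
      then show ?thesis
        using power_mono_iff[of "\<bar>\<Delta> n j i \<omega>\<bar>" "C * b n j" 4] C b[of n j] by simp
    qed
    show "tame (W \<omega>)"
    proof (rule tame_of_growth[OF cw])
      show "0 \<le> 10 * C" using C by simp
      fix n x assume x: "real n \<le> x" "x \<le> real n + 1"
      have "\<bar>W \<omega> x - W \<omega> (real n)\<bar> \<le> 10 * (C * (real n + 1) powr (3/8))"
      proof (rule dyadic_chaining_continuous[where w = "W \<omega>"])
        show "continuous_on {real n..real n + 1} (W \<omega>)" by (rule continuous_on_subset[OF cw]) auto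
        show "0 \<le> C * (real n + 1) powr (3/8)" using C by simp
        show "\<bar>W \<omega> (real n + (real i + 1) / 2 ^ j) - W \<omega> (real n + real i / 2 ^ j)\<bar>
          \<le> C * (real n + 1) powr (3/8) * (9/10) ^ j" if "i < 2 ^ j" for j i
          using inc[OF that, of n] unfolding \<Delta>_def b_def by (simp add: mult.commute mult.left_commute)
      qed (use x in auto)
      then show "\<bar>W \<omega> x - W \<omega> (real n)\<bar> \<le> 10 * C * (real n + 1) powr (3/8)" by simp
    qed
  qed
qed

section \<open>The law of Brownian motion on path space\<close>

abbreviation path_map :: "('a \<Rightarrow> real \<Rightarrow> real) \<Rightarrow> 'a \<Rightarrow> real \<Rightarrow> real" where
  "path_map W \<equiv> (\<lambda>\<omega>. restrict (W \<omega>) {0..})"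

abbreviation path_law :: "'a measure \<Rightarrow> ('a \<Rightarrow> real \<Rightarrow> real) \<Rightarrow> (real \<Rightarrow> real) measure" where
  "path_law M W \<equiv> distr M path_space (path_map W)"

abbreviation gauss :: "real \<Rightarrow> real measure" where
  "gauss v \<equiv> density lborel (\<lambda>x. ennreal (normal_density 0 (sqrt v) x))"

lemma brownian_increments_law:
  fixes ts :: "nat \<Rightarrow> real"
  assumes W: "brownian_motion M W" and n: "n > 0" and ts: "0 \<le> ts 0" "\<And>i. i < n \<Longrightarrow> ts i < ts (Suc i)"
  shows "distr M (PiM {..<n} (\<lambda>_. borel)) (\<lambda>\<omega>. \<lambda>i\<in>{..<n}. W \<omega> (ts (Suc i)) - W \<omega> (ts i))
    = PiM {..<n} (\<lambda>i. gauss (ts (Suc i) - ts i))"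
proof -
  interpret prob_space M by (rule brownian_motionD(1)[OF W])
  have pos: "0 \<le> ts i" if "i \<le> n" for i
    using that
  proof (induction i)
    case (Suc i)
    then show ?case using ts(2)[of i] by linarith
  qed (use ts in simp)
  have rv: "(\<lambda>\<omega>. W \<omega> (ts (Suc i)) - W \<omega> (ts i)) \<in> borel_measurable M" if "i \<in> {..<n}" for i
    using that pos by (intro borel_measurable_diff brownian_motionD(2)[OF W]) auto
  have "distr M borel (\<lambda>\<omega>. W \<omega> (ts (Suc i)) - W \<omega> (ts i))
     = gauss (ts (Suc i) - ts i)" if "i \<in> {..<n}" for i
  proof -
    have "distr M borel (\<lambda>\<omega>. W \<omega> (ts (Suc i)) - W \<omega> (ts i)) = distr M lborel (\<lambda>\<omega>. W \<omega> (ts (Suc i)) - W \<omega> (ts i))"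
      by (rule distr_cong) auto
    also have "\<dots> = gauss (ts (Suc i) - ts i)"
      by (rule distributed_distr_eq_density[OF brownian_motionD(5)[OF W]]) (use that pos ts in auto)
    finally show ?thesis .
  qed
  then have "PiM {..<n} (\<lambda>i. distr M borel (\<lambda>\<omega>. W \<omega> (ts (Suc i)) - W \<omega> (ts i)))
    = PiM {..<n} (\<lambda>i. gauss (ts (Suc i) - ts i))"
    by (intro PiM_cong refl)
  moreover have "distr M (PiM {..<n} (\<lambda>_. borel)) (\<lambda>\<omega>. \<lambda>i\<in>{..<n}. W \<omega> (ts (Suc i)) - W \<omega> (ts i))
     = PiM {..<n} (\<lambda>i. distr M borel (\<lambda>\<omega>. W \<omega> (ts (Suc i)) - W \<omega> (ts i)))"
    by (rule indep_vars_iff_distr_eq_PiM'[where X="\<lambda>i \<omega>. W \<omega> (ts (Suc i)) - W \<omega> (ts i)" and M'="\<lambda>_. borel",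
          THEN iffD1, OF _ rv brownian_motionD(6)[OF W, of ts n]])
       (use n ts in auto)
  ultimately show ?thesis by simp
qed

text \<open>The values at the given times are partial sums of increments along the sorted times, and
  the joint law of the increments is a product of Gaussians that depends on the times alone.\<close>

lemma brownian_finite_dim:
  assumes W: "brownian_motion M W" and W': "brownian_motion M W'"
    and J: "finite J" "J \<subseteq> {0..}" and A: "\<And>t. t \<in> J \<Longrightarrow> A t \<in> sets borel"
  shows "emeasure M {\<omega>\<in>space M. \<forall>t\<in>J. W \<omega> t \<in> A t} = emeasure M {\<omega>\<in>space M. \<forall>t\<in>J. W' \<omega> t \<in> A t}"
proof -
  \<comment> \<open>The time 0 makes the sums telescope down to \<open>W \<omega> 0 = 0\<close>; the
    time 1 guarantees at least one increment even when \<open>J\<close> is empty or contains only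
    0.\<close>
  define J' where "J' = insert 0 (insert 1 J)"
  define l where "l = sorted_list_of_set J'"
  define ts where "ts i = l ! i" for i
  define n where "n = length l - 1"
  have fJ: "finite J'" using J by (simp add: J'_def)
  have sl: "set l = J'" "sorted_wrt (<) l" using fJ by (auto simp: l_def)
  have len: "length l \<ge> 2"
  proof -
    have "card {0, 1::real} \<le> card J'" using fJ by (intro card_mono) (auto simp: J'_def)
    then show ?thesis using fJ by (simp add: l_def)
  qed
  have n: "n > 0" and nl: "i \<le> n \<longleftrightarrow> i < length l" for i using len by (auto simp: n_def)
  have tsl: "ts i < ts (Suc i)" if "i < n" for i
    using sl(2) that nl[of "Suc i"] unfolding ts_def sorted_wrt_iff_nth_less by simp
  have tsJ: "ts i \<in> J'" if "i \<le> n" for i using that nl[of i] sl(1) nth_mem[of i l] by (simp add: ts_def)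
  have pos: "0 \<le> t" if "t \<in> J'" for t using that J by (auto simp: J'_def)
  have index: "\<exists>m\<le>n. ts m = t" if "t \<in> J'" for t
  proof -
    have "t \<in> set l" using that sl(1) by simp
    then obtain m where "m < length l" "l ! m = t" by (auto simp: in_set_conv_nth)
    then show ?thesis using nl[of m] by (intro exI[of _ m]) (simp add: ts_def)
  qed
  have ts0: "ts 0 = 0"
  proof -
    obtain i where i: "i \<le> n" "ts i = 0" using index[of 0] by (auto simp: J'_def)
    have "ts 0 \<le> ts i"
      using sl(2) i(1) nl[of i] unfolding ts_def sorted_wrt_iff_nth_less by (cases "i = 0") (auto simp: less_imp_le)
    with i pos[OF tsJ[of 0]] show ?thesis by simp
  qed
  let ?P = "PiM {..<n} (\<lambda>_. borel) :: (nat \<Rightarrow> real) measure"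
  define B where "B = {z\<in>space ?P. \<forall>m\<in>{m. m \<le> n \<and> ts m \<in> J}. (\<Sum>i<m. z i) \<in> A (ts m)}"
  have B: "B \<in> sets ?P"
    unfolding B_def
  proof (rule sets.sets_Collect_countable_All')
    fix m assume m: "m \<in> {m. m \<le> n \<and> ts m \<in> J}"
    have "(\<lambda>z. \<Sum>i<m. z i) \<in> borel_measurable ?P"
      using m by (intro borel_measurable_sum measurable_component_singleton) auto
    from measurable_sets[OF this A[of "ts m"]] m
    show "{z\<in>space ?P. (\<Sum>i<m. z i) \<in> A (ts m)} \<in> sets ?P"
      by (simp add: vimage_def Int_def conj_commute)
  qed (rule countableI_type)
  have law: "emeasure M {\<omega>\<in>space M. \<forall>t\<in>J. X \<omega> t \<in> A t}
     = emeasure (PiM {..<n} (\<lambda>i. gauss (ts (Suc i) - ts i))) B"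
    if X: "brownian_motion M X" for X
  proof -
    let ?D = "\<lambda>\<omega>. \<lambda>i\<in>{..<n}. X \<omega> (ts (Suc i)) - X \<omega> (ts i)"
    have tel: "(\<Sum>i<m. ?D \<omega> i) = X \<omega> (ts m)" if "\<omega> \<in> space M" "m \<le> n" for \<omega> m
    proof -
      have "(\<Sum>i<m. ?D \<omega> i) = (\<Sum>i<m. X \<omega> (ts (Suc i)) - X \<omega> (ts i))"
        using that by (intro sum.cong) auto
      also have "\<dots> = X \<omega> (ts m) - X \<omega> (ts 0)" by (rule sum_lessThan_telescope)
      also have "X \<omega> (ts 0) = 0" unfolding ts0 by (rule brownian_motionD(3)[OF X that(1)])
      finally show ?thesis by simp
    qed
    have J_ts: "\<exists>m\<le>n. ts m = t" if "t \<in> J" for t using index[of t] that by (simp add: J'_def)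
    have Dm: "?D \<in> measurable M ?P"
      using tsJ pos by (intro measurable_restrict borel_measurable_diff brownian_motionD(2)[OF X]) auto
    have "{\<omega>\<in>space M. \<forall>t\<in>J. X \<omega> t \<in> A t} = ?D -` B \<inter> space M"
    proof (intro equalityI subsetI)
      fix \<omega> assume \<omega>: "\<omega> \<in> {\<omega>\<in>space M. \<forall>t\<in>J. X \<omega> t \<in> A t}"
      then have "?D \<omega> \<in> space ?P" using measurable_space[OF Dm, of \<omega>] by simp
      with \<omega> show "\<omega> \<in> ?D -` B \<inter> space M" unfolding B_def by (auto simp only: mem_Collect_eq tel vimage_eq Int_iff)
    next
      fix \<omega> assume \<omega>: "\<omega> \<in> ?D -` B \<inter> space M"
      have "X \<omega> t \<in> A t" if t: "t \<in> J" for t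
      proof -
        obtain m where m: "m \<le> n" "ts m = t" using J_ts[OF t] by blast
        then have "(\<Sum>i<m. ?D \<omega> i) \<in> A (ts m)" using \<omega> t unfolding B_def by blast
        then show ?thesis using tel[of \<omega> m] \<omega> m by simp
      qed
      with \<omega> show "\<omega> \<in> {\<omega>\<in>space M. \<forall>t\<in>J. X \<omega> t \<in> A t}" by blast
    qed
    then have "emeasure M {\<omega>\<in>space M. \<forall>t\<in>J. X \<omega> t \<in> A t} = emeasure (distr M ?P ?D) B"
      using emeasure_distr[OF Dm B] by simp
    also have "distr M ?P ?D = PiM {..<n} (\<lambda>i. gauss (ts (Suc i) - ts i))"
      by (rule brownian_increments_law[OF X n]) (use ts0 tsl in auto)
    finally show ?thesis .
  qed
  show ?thesis unfolding law[OF W] law[OF W'] ..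
qed

lemma path_map_measurable:
  assumes W: "brownian_motion M W"
  shows "(path_map W) \<in> measurable M path_space"
  by (intro measurable_restrict brownian_motionD(2)[OF W]) auto

text \<open>Finite-dimensional cylinders determine a finite measure on the product space, even with
  uncountably many coordinates.\<close>

lemma brownian_law_unique:
  assumes W: "brownian_motion M W" and W': "brownian_motion M W'"
  shows "path_law M W
     = path_law M W'"
proof (rule measure_eqI_PiM_infinite[where I="{0..}" and M="\<lambda>_. borel"])
  interpret prob_space M by (rule brownian_motionD(1)[OF W])
  show "finite_measure (path_law M W)"
    by (rule finite_measure_distr[OF path_map_measurable[OF W]])
  fix A :: "real \<Rightarrow> real set" and J :: "real set"
  assume J: "finite J" "J \<subseteq> {0..}" and A: "\<And>i. i \<in> J \<Longrightarrow> A i \<in> sets borel"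
  have e: "emeasure (path_law M X) (prod_emb {0..} (\<lambda>_. borel) J (Pi\<^sub>E J A))
     = emeasure M {\<omega>\<in>space M. \<forall>t\<in>J. X \<omega> t \<in> A t}" if X: "brownian_motion M X" for X
  proof -
    have "prod_emb {0..} (\<lambda>_. borel) J (Pi\<^sub>E J A) \<in> sets path_space"
      using J A by (intro sets_PiM_I) auto
    moreover have "(path_map X) -` prod_emb {0..} (\<lambda>_. borel) J (Pi\<^sub>E J A) \<inter> space M
       = {\<omega>\<in>space M. \<forall>t\<in>J. X \<omega> t \<in> A t}"
    proof -
      have "restrict (X \<omega>) {0..} \<in> prod_emb {0..} (\<lambda>_. borel) J (Pi\<^sub>E J A) \<longleftrightarrow> (\<forall>t\<in>J. X \<omega> t \<in> A t)" for \<omega>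
      proof -
        have "restrict (restrict (X \<omega>) {0..}) J = restrict (X \<omega>) J" using J by (auto simp: restrict_def fun_eq_iff)
        then show ?thesis by (simp add: prod_emb_iff PiE_iff)
      qed
      then show ?thesis by blast
    qed
    ultimately show ?thesis by (simp only: emeasure_distr[OF path_map_measurable[OF X]])
  qed
  show "emeasure (path_law M W) (prod_emb {0..} (\<lambda>_. borel) J (Pi\<^sub>E J A))
    = emeasure (path_law M W') (prod_emb {0..} (\<lambda>_. borel) J (Pi\<^sub>E J A))"
    unfolding e[OF W] e[OF W'] by (rule brownian_finite_dim[OF W W' J A])
qed auto

text \<open>All paths of a Brownian motion are continuous here, so the event is literally the
  preimage of a product-measurable set, with no null set to discard, and its probability depends on
  the law only.\<close>

lemma path_event_brownian:
  assumes Q: "path_event Q" and W: "brownian_motion M W"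
  shows "{\<omega>\<in>space M. Q (W \<omega>)} \<in> sets M"
    and "brownian_motion M W' \<Longrightarrow> measure M {\<omega>\<in>space M. Q (W \<omega>)} = measure M {\<omega>\<in>space M. Q (W' \<omega>)}"
proof -
  obtain A where A: "A \<in> sets path_space"
    and QA: "\<And>w. cpath w \<Longrightarrow> Q w \<longleftrightarrow> restrict w {0..} \<in> A"
    using Q unfolding path_event_def by blast
  have eq: "{\<omega>\<in>space M. Q (X \<omega>)} = (path_map X) -` A \<inter> space M" if "brownian_motion M X" for X
    using brownian_motionD(4)[OF that] QA by auto
  show "{\<omega>\<in>space M. Q (W \<omega>)} \<in> sets M"
    unfolding eq[OF W] by (rule measurable_sets[OF path_map_measurable[OF W] A])
  assume W': "brownian_motion M W'"
  have "measure M {\<omega>\<in>space M. Q (X \<omega>)} = measure (path_law M X) A"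
    if "brownian_motion M X" for X
    unfolding eq[OF that] by (rule measure_distr[OF path_map_measurable[OF that] A, symmetric])
  from this[OF W] this[OF W'] show "measure M {\<omega>\<in>space M. Q (W \<omega>)} = measure M {\<omega>\<in>space M. Q (W' \<omega>)}"
    unfolding brownian_law_unique[OF W W'] by simp
qed

lemma brownian_rescale:
  assumes W: "brownian_motion M W" and c: "c > 0"
  shows "brownian_motion M (\<lambda>\<omega> x. W \<omega> (c * x) / sqrt c)"
  unfolding brownian_motion_def
proof (intro conjI allI impI ballI)
  interpret prob_space M by (rule brownian_motionD(1)[OF W])
  show "prob_space M" by (rule brownian_motionD(1)[OF W])
  show "(\<lambda>\<omega>. W \<omega> (c * t) / sqrt c) \<in> borel_measurable M" if "0 \<le> t" for t
    using that c by (intro borel_measurable_divide brownian_motionD(2)[OF W]) auto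
  show "W \<omega> (c * 0) / sqrt c = 0" if "\<omega> \<in> space M" for \<omega>
    using brownian_motionD(3)[OF W that] by simp
  show "continuous_on {0..} (\<lambda>x. W \<omega> (c * x) / sqrt c)" if "\<omega> \<in> space M" for \<omega>
    using c by (intro continuous_intros continuous_on_compose2[OF brownian_motionD(4)[OF W that]]) auto
  show "distributed M lborel (\<lambda>\<omega>. W \<omega> (c * t) / sqrt c - W \<omega> (c * s) / sqrt c)
          (\<lambda>x. ennreal (normal_density 0 (sqrt (t - s)) x))" if st: "0 \<le> s \<and> s < t" for s t
  proof -
    have d: "distributed M lborel (\<lambda>\<omega>. W \<omega> (c * t) - W \<omega> (c * s)) (\<lambda>x. ennreal (normal_density 0 (sqrt (c * t - c * s)) x))"
      by (rule brownian_motionD(5)[OF W]) (use st c in auto)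
    have pos: "0 < sqrt (c * t - c * s)" using st c by simp
    have "distributed M lborel (\<lambda>\<omega>. 0 + (1 / sqrt c) * (W \<omega> (c * t) - W \<omega> (c * s)))
       (\<lambda>x. ennreal (normal_density (0 + (1 / sqrt c) * 0) (\<bar>1 / sqrt c\<bar> * sqrt (c * t - c * s)) x))"
      by (rule normal_density_affine[OF d pos]) (use c in simp)
    moreover have "\<bar>1 / sqrt c\<bar> * sqrt (c * t - c * s) = sqrt (t - s)"
      using c by (simp add: real_sqrt_mult flip: right_diff_distrib)
    ultimately show ?thesis by (simp add: diff_divide_distrib)
  qed
  fix n :: nat and ts :: "nat \<Rightarrow> real"
  assume ts: "0 \<le> ts 0 \<and> (\<forall>i<n. ts i < ts (Suc i))"
  have "indep_vars (\<lambda>_. borel) (\<lambda>i \<omega>. W \<omega> (c * ts (Suc i)) - W \<omega> (c * ts i)) {..<n}"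
    using brownian_motionD(6)[OF W, of "\<lambda>i. c * ts i" n] ts c by auto
  from indep_vars_compose2[OF this, of "\<lambda>i x. x / sqrt c" "\<lambda>_. borel"]
  show "indep_vars (\<lambda>_. borel) (\<lambda>i \<omega>. W \<omega> (c * ts (Suc i)) / sqrt c - W \<omega> (c * ts i) / sqrt c) {..<n}"
    by (simp add: diff_divide_distrib)
qed

theorem theorem3:
  fixes M :: "'a measure" and W :: "'a \<Rightarrow> real \<Rightarrow> real"
    and k :: nat and \<beta>1 \<beta>2 s :: real
  assumes "brownian_motion M W"
    and "0 < \<beta>1" and "\<beta>1 < \<beta>2"
    and "1 / (4 * real k + 3) \<le> s" and "s \<le> (4 * real k + 2) / (4 * real k + 3)"
  shows "\<forall>t::real. measure M {\<omega> \<in> space M. \<beta>1 powr s * TW \<beta>1 k W \<omega> > t}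
                 \<ge> measure M {\<omega> \<in> space M. \<beta>2 powr s * TW \<beta>2 k W \<omega> > t}"
proof
  fix t :: real
  note W = assms(1)
  interpret prob_space M by (rule brownian_motionD(1)[OF W])
  define c where "c = (\<beta>2 / \<beta>1) powr ((s - 1/2) / (noise_exp k + 1/2))"
  have c: "c > 0" using assms(2,3) by (simp add: c_def)
  \<comment> \<open>Another Brownian motion on the same probability space: the comparison runs for
    each outcome, between \<open>W\<close> on the \<beta>2 side and \<open>W'\<close> on the
    \<beta>1 side.\<close>
  define W' where "W' \<omega> x = W \<omega> (c * x) / sqrt c" for \<omega> x
  have W': "brownian_motion M W'"
    unfolding W'_def[abs_def] by (rule brownian_rescale[OF W c])
  have "path_event (\<lambda>w. Sup (form_vals \<beta>1 k w) > t / \<beta>1 powr s)"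
    by (rule path_event_Sup_form_vals[OF assms(2)])
  moreover have "(Sup (form_vals \<beta>1 k w) > t / \<beta>1 powr s) \<longleftrightarrow> \<beta>1 powr s * Sup (form_vals \<beta>1 k w) > t" for w
    using assms(2) by (simp add: field_simps)
  \<comment> \<open>The label \<open>pot_exp\<close> names a fact here, measurability of the
    \<beta>1 event, and not the exponent. Monotonicity up to null sets uses it for the larger
    event.\<close>
  ultimately have pot_exp: "path_event (\<lambda>w. \<beta>1 powr s * Sup (form_vals \<beta>1 k w) > t)" by simp
  have "measure M {\<omega> \<in> space M. \<beta>2 powr s * Sup (form_vals \<beta>2 k (W \<omega>)) > t}
     \<le> measure M {\<omega> \<in> space M. \<beta>1 powr s * Sup (form_vals \<beta>1 k (W' \<omega>)) > t}"
  proof (rule finite_measure_mono_AE[OF _ path_event_brownian(1)[OF pot_exp W']])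
    show "AE \<omega> in M. \<omega> \<in> {\<omega> \<in> space M. \<beta>2 powr s * Sup (form_vals \<beta>2 k (W \<omega>)) > t} \<longrightarrow>
        \<omega> \<in> {\<omega> \<in> space M. \<beta>1 powr s * Sup (form_vals \<beta>1 k (W' \<omega>)) > t}"
      using AE_tame_brownian[OF W] AE_tame_brownian[OF W']
    proof eventually_elim
      case (elim \<omega>)
      have "\<beta>2 powr s * Sup (form_vals \<beta>2 k (W \<omega>)) \<le> \<beta>1 powr s * Sup (form_vals \<beta>1 k (W' \<omega>))"
        unfolding W'_def[abs_def] c_def
        by (rule Sup_form_vals_scaling[OF assms(2-5) elim(1) elim(2)[unfolded W'_def[abs_def] c_def]])
      then show ?case by auto
    qed
  qed
  \<comment> \<open>Equality in law of \<open>W'\<close> and \<open>W\<close> returns the \<beta>1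
    side to the original motion.\<close>
  also have "\<dots> = measure M {\<omega> \<in> space M. \<beta>1 powr s * Sup (form_vals \<beta>1 k (W \<omega>)) > t}"
    by (rule path_event_brownian(2)[OF pot_exp W' W])
  finally show "measure M {\<omega> \<in> space M. \<beta>1 powr s * TW \<beta>1 k W \<omega> > t}
                 \<ge> measure M {\<omega> \<in> space M. \<beta>2 powr s * TW \<beta>2 k W \<omega> > t}"
    unfolding TW_eq_Sup_form_vals .
qed

end
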